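(* Let $F$ be the function on $\{(y,z)\in\mathbb R^2:y<z\}$ defined in the context and let $(y_*,z_* )$ be its unique minimizing pair. Then the $(y_*,z_* )$ ordering policy is optimal in the class $\mathcal A$; that is, it minimizes $J(\tau,Y)$ over all $(\tau,Y)\in\mathcal A$.
   Context: Drifted Brownian motion inventory model. Let $\mu,\sigma>0$, $W$ a standard Brownian motion, and let the inventory without ordering be $dX_0(t)=-\mu\,dt+\sigma\,dW(t)$, $X_0(0)=x_0\in\mathbb R$; $\{\mathcal F_t\}$ is the filtration generated by $X_0$, augmented to satisfy the usual conditions. The holding/back-order cost rate is $c_0(x)=-c_bx$ for $x<0$ and $c_0(x)=c_hx$ for $x\ge0$, with $c_b,c_h>0$; the ordering cost is $c_1(y,z)=k_1+k_2(z-y)$, $y\le z$, with constants $k_1>0$ (fixed cost per order) and $k_2>0$ (cost per unit ordered). An ordering policy $(\tau,Y)=\{(\tau_k,Y_k):k\in\mathbb N\}$ is admissible (class $\mathcal A$) if $\{\tau_k\}$ is an increasing sequence of $\{\mathcal F_t\}$-stopping times and each $Y_k$ is nonnegative (finite) and $\mathcal F_{\tau_k}$-measurable. The inventory process is $X(t)=X(0-)-\mu t+\sigma W(t)+\sum_{k\ge1}I_{\{\tau_k\le t\}}Y_k$ with $X(0-)=x_0$, and the cost is $$J(\tau,Y)=\limsup_{t\to\infty}t^{-1}\,\mathbb E\Big[\int_0^tc_0(X(s))\,ds+\sum_{k=1}^\infty I_{\{\tau_k\le t\}}c_1(X(\tau_k-),X(\tau_k))\Big].$$ For $y<z$ the $(y,z)$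 ordering policy is: $\tau_0=0$, $\tau_k=\inf\{t>\tau_{k-1}:X(t-)\le y\}$, $Y_k=z-X(\tau_k-)$, $k\ge1$. Set $\zeta(x)=x/\mu$ and $$g_0(x)=\begin{cases}-\frac{c_b}{2\mu}x^2-\frac{\sigma^2c_b}{2\mu^2}x+\frac{\sigma^4(c_b+c_h)}{4\mu^3}\big(e^{2\mu x/\sigma^2}-1\big), & x<0,\\ \frac{c_h}{2\mu}x^2+\frac{\sigma^2c_h}{2\mu^2}x, & x\ge0,\end{cases}\qquad F(y,z)=\frac{c_1(y,z)+g_0(z)-g_0(y)}{\zeta(z)-\zeta(y)}.$$ $F$ has a unique minimizing pair $(y_*,z_* )$ with $y_*<z_*$. *)

theory Defs
  imports "HOL-Probability.Probability"
begin

section \<open>Brownian motion and the filtration of the uncontrolled inventory\<close>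

locale standard_brownian_motion = prob_space M
  for M :: "'a measure" and W :: "real \<Rightarrow> 'a \<Rightarrow> real" +
  assumes random_variable_W: "\<And>t. 0 \<le> t \<Longrightarrow> W t \<in> borel_measurable M"
    and W_zero: "\<And>\<omega>. \<omega> \<in> space M \<Longrightarrow> W 0 \<omega> = 0"
    and continuous_paths: "\<And>\<omega>. \<omega> \<in> space M \<Longrightarrow> continuous_on {0..} (\<lambda>t. W t \<omega>)"
    and normal_increments: "\<And>s t. 0 \<le> s \<Longrightarrow> s < t \<Longrightarrow>
      distributed M lborel (\<lambda>\<omega>. W t \<omega> - W s \<omega>) (normal_density 0 (sqrt (t - s)))"
    and indep_increments: "\<And>(u :: nat \<Rightarrow> real) n. 0 \<le> u 0 \<Longrightarrow> mono u \<Longrightarrow>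
      indep_vars (\<lambda>_. borel) (\<lambda>i \<omega>. W (u (Suc i)) \<omega> - W (u i) \<omega>) {..<n}"

definition inventory0 ::
  "real \<Rightarrow> real \<Rightarrow> (real \<Rightarrow> 'a \<Rightarrow> real) \<Rightarrow> real \<Rightarrow> real \<Rightarrow> 'a \<Rightarrow> real" where
  "inventory0 \<mu> \<sigma> W x0 t \<omega> = x0 - \<mu> * t + \<sigma> * W t \<omega>"

text \<open>Time is indexed by \<^typ>\<open>ennreal\<close> so that stopping times may take the value \<open>\<infinity>\<close>.
  The null sets are those of the completed probability space.\<close>

definition completed_history :: "'a measure \<Rightarrow> (real \<Rightarrow> 'a \<Rightarrow> real) \<Rightarrow> ennreal \<Rightarrow> 'a measure" where
  "completed_history M X s = sigma (space M)
     ({X u -` B \<inter> space M | u B. 0 \<le> u \<and> ennreal u \<le> s \<and> B \<in> sets borel}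
      \<union> null_sets (completion M))"

text \<open>For finite \<open>t\<close> this is the right limit of the completed histories; the index \<open>s = \<infinity>\<close>
  only matters for \<open>t = \<infinity>\<close>, where it gives the terminal sigma-algebra.\<close>

definition augmented_filtration :: "'a measure \<Rightarrow> (real \<Rightarrow> 'a \<Rightarrow> real) \<Rightarrow> ennreal \<Rightarrow> 'a measure" where
  "augmented_filtration M X t = sigma (space M)
     (\<Inter>s\<in>{s. t < s \<or> s = \<infinity>}. sets (completed_history M X s))"

section \<open>Ordering policies\<close>

text \<open>A policy is a pair \<open>(\<tau>, Y)\<close> whose orders carry the indices \<open>1, 2, \<dots>\<close>; the entries with
  index \<open>0\<close> are not orders and are never charged. The order with index \<open>k\<close> is never placed on
  the event \<open>\<tau> k = \<infinity>\<close>.\<close>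

type_synonym 'a policy = "(nat \<Rightarrow> 'a \<Rightarrow> ennreal) \<times> (nat \<Rightarrow> 'a \<Rightarrow> real)"

definition admissible :: "'a measure \<Rightarrow> (ennreal \<Rightarrow> 'a measure) \<Rightarrow> 'a policy set" where
  "admissible M F = {(\<tau>, Y).
     (\<forall>k\<ge>1. stopping_time F (\<tau> k)) \<and>
     (\<forall>k\<ge>1. \<forall>\<omega>\<in>space M. \<tau> k \<omega> \<le> \<tau> (Suc k) \<omega>) \<and>
     (\<forall>k\<ge>1. \<forall>\<omega>\<in>space M. 0 \<le> Y k \<omega>) \<and>
     (\<forall>k\<ge>1. Y k \<in> borel_measurable (filtration.pre_sigma (space M) F (\<tau> k)))}"

text \<open>In \<open>inventory\<close>, \<open>inventory_left\<close>, \<open>cost_upto\<close> and \<open>yz_policy\<close>, the argument \<open>X0\<close> is the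
  inventory process without ordering, and \<open>x0\<close> is \<open>X(0-)\<close>.\<close>

definition ordered :: "'a policy \<Rightarrow> real \<Rightarrow> 'a \<Rightarrow> nat \<Rightarrow> real" where
  "ordered p t \<omega> k = (if fst p (Suc k) \<omega> \<le> ennreal t then snd p (Suc k) \<omega> else 0)"

definition inventory :: "(real \<Rightarrow> 'a \<Rightarrow> real) \<Rightarrow> 'a policy \<Rightarrow> real \<Rightarrow> 'a \<Rightarrow> real" where
  "inventory X0 p t \<omega> = X0 t \<omega> + (\<Sum>k. ordered p t \<omega> k)"

definition inventory_left ::
  "(real \<Rightarrow> 'a \<Rightarrow> real) \<Rightarrow> real \<Rightarrow> 'a policy \<Rightarrow> real \<Rightarrow> 'a \<Rightarrow> real" where
  "inventory_left X0 x0 p t \<omega> =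
     (if t = 0 then x0 else Lim (at_left t) (\<lambda>s. inventory X0 p s \<omega>))"

section \<open>Costs\<close>

definition c0 :: "real \<Rightarrow> real \<Rightarrow> real \<Rightarrow> real" where
  "c0 cb ch x = (if x < 0 then - cb * x else ch * x)"

definition c1 :: "real \<Rightarrow> real \<Rightarrow> real \<Rightarrow> real \<Rightarrow> real" where
  "c1 k1 k2 y z = k1 + k2 * (z - y)"

text \<open>If the total quantity ordered up to time \<open>t\<close> is infinite, infinitely many orders have been
  placed, so the fixed costs alone add up to \<open>\<infinity>\<close>. The case distinction records this value, because
  the real-valued series in \<open>inventory\<close> is meaningless on such paths.\<close>

definition cost_upto ::
  "(real \<Rightarrow> real) \<Rightarrow> (real \<Rightarrow> real \<Rightarrow> real) \<Rightarrow> (real \<Rightarrow> 'a \<Rightarrow> real) \<Rightarrow> real \<Rightarrow> 'a policy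
    \<Rightarrow> real \<Rightarrow> 'a \<Rightarrow> ennreal" where
  "cost_upto h K X0 x0 p t \<omega> =
     (if summable (ordered p t \<omega>) then
        (\<integral>\<^sup>+s\<in>{0..t}. ennreal (h (inventory X0 p s \<omega>)) \<partial>lborel)
        + (\<Sum>k. if fst p (Suc k) \<omega> \<le> ennreal t then
             (let r = enn2real (fst p (Suc k) \<omega>)
              in ennreal (K (inventory_left X0 x0 p r \<omega>) (inventory X0 p r \<omega>)))
            else 0)
      else \<infinity>)"

definition long_run_cost ::
  "'a measure \<Rightarrow> (real \<Rightarrow> real) \<Rightarrow> (real \<Rightarrow> real \<Rightarrow> real) \<Rightarrow> (real \<Rightarrow> 'a \<Rightarrow> real) \<Rightarrow> real
    \<Rightarrow> 'a policy \<Rightarrow> ennreal" where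
  "long_run_cost M h K X0 x0 p =
     Limsup at_top (\<lambda>t::real.
       (\<integral>\<^sup>+\<omega>. cost_upto h K X0 x0 p t \<omega> \<partial>completion M) / ennreal t)"

section \<open>The \<open>(y, z)\<close> policy\<close>

text \<open>The policy that stops after its first \<open>n\<close> orders. The next order time is the hitting time
  of \<open>(-\<infinity>, y]\<close> by (the left limits of) the inventory resulting from the previous orders;
  in particular the first order is placed at time \<open>0\<close> if \<open>x0 < y\<close>. On the null event where an
  order time is infinite the (never delivered) quantity is set to \<open>0\<close>.\<close>

primrec yz_truncated ::
  "(real \<Rightarrow> 'a \<Rightarrow> real) \<Rightarrow> real \<Rightarrow> real \<Rightarrow> real \<Rightarrow> nat \<Rightarrow> 'a policy" where
  "yz_truncated X0 x0 y z 0 = ((\<lambda>k \<omega>. if k = 0 then 0 else \<infinity>), (\<lambda>k \<omega>. 0))"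
| "yz_truncated X0 x0 y z (Suc n) =
    (let p = yz_truncated X0 x0 y z n;
         T = (\<lambda>\<omega>. Inf {ennreal t | t. 0 \<le> t \<and> fst p n \<omega> < ennreal t \<and>
                                     inventory_left X0 x0 p t \<omega> \<le> y});
         Q = (\<lambda>\<omega>. if T \<omega> = \<infinity> then 0 else z - inventory_left X0 x0 p (enn2real (T \<omega>)) \<omega>)
     in ((fst p)(Suc n := T), (snd p)(Suc n := Q)))"

definition yz_policy :: "(real \<Rightarrow> 'a \<Rightarrow> real) \<Rightarrow> real \<Rightarrow> real \<Rightarrow> real \<Rightarrow> 'a policy" where
  "yz_policy X0 x0 y z =
     ((\<lambda>k. fst (yz_truncated X0 x0 y z k) k), (\<lambda>k. snd (yz_truncated X0 x0 y z k) k))"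

section \<open>The function \<open>F\<close>\<close>

definition zeta :: "real \<Rightarrow> real \<Rightarrow> real" where
  "zeta \<mu> x = x / \<mu>"

definition g0 :: "real \<Rightarrow> real \<Rightarrow> real \<Rightarrow> real \<Rightarrow> real \<Rightarrow> real" where
  "g0 \<mu> \<sigma> cb ch x =
     (if x < 0 then
        - cb / (2 * \<mu>) * x\<^sup>2 - \<sigma>\<^sup>2 * cb / (2 * \<mu>\<^sup>2) * x
        + \<sigma> ^ 4 * (cb + ch) / (4 * \<mu> ^ 3) * (exp (2 * \<mu> * x / \<sigma>\<^sup>2) - 1)
      else ch / (2 * \<mu>) * x\<^sup>2 + \<sigma>\<^sup>2 * ch / (2 * \<mu>\<^sup>2) * x)"

definition F_ratio ::
  "real \<Rightarrow> real \<Rightarrow> real \<Rightarrow> real \<Rightarrow> real \<Rightarrow> real \<Rightarrow> real \<times> real \<Rightarrow> real" where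
  "F_ratio \<mu> \<sigma> cb ch k1 k2 = (\<lambda>(y, z).
     (c1 k1 k2 y z + g0 \<mu> \<sigma> cb ch z - g0 \<mu> \<sigma> cb ch y) / (zeta \<mu> z - zeta \<mu> y))"

end

theory Submission
  imports Defs
begin

text \<open>
  Let \<open>lam\<close> be the minimum of \<open>F\<close> and \<open>V = g0 - lam * zeta\<close>. Then \<open>V\<close> is \<open>C\<^sup>2\<close>, the generator
  \<open>\<sigma>\<^sup>2/2 V'' - \<mu> V'\<close> equals \<open>lam - c0\<close>, and minimality of \<open>F\<close> says \<open>V(a) - V(b) \<le> c1(a, b)\<close> for all
  \<open>a < b\<close>, with equality at the minimizing pair. Since \<open>V\<close> grows quadratically, \<open>E V(X(t))\<close> need not
  be \<open>o(t)\<close>; therefore \<open>V'\<close> is multiplied by a cutoff in \<open>\<delta> ln(1 + x\<^sup>2)\<close>, which costs only \<open>O(\<delta>)\<close> in the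
  generator and makes the test function bounded. Ito's formula for the controlled process then
  bounds the expected cost of every policy by \<open>(lam - O(\<delta>)) t - O(1)\<close> from below. For the
  minimizing pair all inequalities are equalities up to \<open>O(\<delta>)\<close>, and the inventory stays above
  \<open>min x0 y\<close>, where \<open>V\<close> is bounded below; so its cost is at most \<open>lam t + O(1)\<close>.

  The formula of Ito is obtained from a Taylor expansion along a grid. The increment of \<open>X0\<close> over a
  grid step is independent of the past, and the contribution of the orders telescopes order by
  order, so neither stochastic integrals nor the strong Markov property is needed. The order times of
  the \<open>(y, z)\<close> policy are explicit: they are first hitting times of \<open>X0\<close> for equidistant levels.
\<close>

section \<open>Independence of history and future increments\<close>

text \<open>The test function must satisfy \<open>U a - U b \<le> c1 k1 k2 a b\<close> for all
  \<open>a \<le> b\<close>, which a cutoff applied to V itself could destroy. A cutoff applied to V'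
  keeps its sign: V' is nonnegative outside a fixed interval, so U is nondecreasing there, and the
  inequality only has to be checked for end points inside, where U and V differ by a constant. The
  two bounds take their limits in opposite order. From below, t tends to infinity at fixed \<delta>,
  which removes the bound of U (it depends on \<delta>), and \<delta> tends to 0 last. From above,
  \<delta> tends to 0 at fixed t, so the constants there must be uniform in \<delta>; this works
  because the terminal value of U is only needed from below on a half-line. The formula of Ito is
  proved for an integrable number of orders. A policy without this property pays infinite expected
  fixed costs; for the optimal policy integrability is derived beforehand.\<close>

context standard_brownian_motion
begin

text \<open>The values of \<open>W\<close> at the times in \<open>J\<close> are partial sums of
  increments over the sorted times, and the increment after \<open>u\<close> is one more member of
  the same independent family. Inserting 0 makes the partial sums start at \<open>W 0 = 0\<close>;
  inserting \<open>u\<close> makes the last past increment end at \<open>u\<close>.\<close>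

lemma W_future_independent:
  assumes J: "finite J" "J \<subseteq> {0..u}" and u: "0 \<le> u" and h: "0 < h"
    and B: "\<And>j. B j \<in> sets borel" and C: "C \<in> sets borel"
  shows "prob ({\<omega>\<in>space M. \<forall>j\<in>J. W j \<omega> \<in> B j} \<inter> {\<omega>\<in>space M. W (u + h) \<omega> - W u \<omega> \<in> C})
    = prob {\<omega>\<in>space M. \<forall>j\<in>J. W j \<omega> \<in> B j} * prob {\<omega>\<in>space M. W (u + h) \<omega> - W u \<omega> \<in> C}"
proof -
  define l where "l = sorted_list_of_set (insert 0 (insert u J))"
  have fin: "finite (insert 0 (insert u J))" using J by simp
  have setl: "set l = insert 0 (insert u J)" using fin unfolding l_def by (rule set_sorted_list_of_set)
  have sl: "sorted l" unfolding l_def by simp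
  define m where "m = length l - 1"
  have len: "length l = Suc m" using setl unfolding m_def by (cases l) auto
  have rng: "0 \<le> x \<and> x \<le> u" if "x \<in> set l" for x using that setl J u by auto
  have l0: "l ! 0 = 0"
  proof -
    have "0 \<in> set l" using setl by simp
    then obtain i where i: "i < length l" "l ! i = 0" by (auto simp: in_set_conv_nth)
    have "l ! 0 \<le> l ! i" using sl i by (intro sorted_nth_mono) auto
    moreover have "0 \<le> l ! 0" using rng len by (metis nth_mem zero_less_Suc)
    ultimately show ?thesis using i by simp
  qed
  have lm: "l ! m = u"
  proof -
    have "u \<in> set l" using setl by simp
    then obtain i where i: "i < length l" "l ! i = u" by (auto simp: in_set_conv_nth)
    have "l ! i \<le> l ! m" using sl i len by (intro sorted_nth_mono) auto
    moreover have "l ! m \<le> u" using rng len by (metis nth_mem lessI)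
    ultimately show ?thesis using i by simp
  qed
  \<comment> \<open>Continuing the list by the constant \<open>u + h\<close> gives a sequence that
    is monotone on all indices and whose increment number \<open>m\<close> is the future
    increment.\<close>
  define r where "r i = (if i \<le> m then l ! i else u + h)" for i
  have mono: "mono r"
  proof (rule monoI)
    fix i j :: nat assume "i \<le> j"
    show "r i \<le> r j"
    proof (cases "j \<le> m")
      case True then show ?thesis using \<open>i \<le> j\<close> sl len by (auto simp: r_def intro!: sorted_nth_mono)
    next
      case False
      then show ?thesis using rng[of "l ! i"] len h by (auto simp: r_def)
    qed
  qed
  have r0: "r 0 = 0" by (simp add: r_def l0)
  define D where "D i \<omega> = W (r (Suc i)) \<omega> - W (r i) \<omega>" for i \<omega>
  have ind: "indep_vars (\<lambda>_. borel) D {..<Suc m}"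
    unfolding D_def[abs_def] by (rule indep_increments) (use r0 mono in auto)
  have ir: "indep_var (PiM {..<m} (\<lambda>_. borel)) (\<lambda>\<omega>. restrict (\<lambda>i. D i \<omega>) {..<m})
      (PiM {m} (\<lambda>_. borel)) (\<lambda>\<omega>. restrict (\<lambda>i. D i \<omega>) {m})"
    by (rule indep_var_restrict[OF ind]) auto
  have Wsum: "W (r k) \<omega> = (\<Sum>i<k. D i \<omega>)" if "\<omega> \<in> space M" for k \<omega>
    using sum_lessThan_telescope[of "\<lambda>i. W (r i) \<omega>" k] W_zero[OF that] r0 by (simp add: D_def)
  define EA where "EA = {f \<in> space (PiM {..<m} (\<lambda>_. borel::real measure)). \<forall>k\<in>{k. k \<le> m \<and> l ! k \<in> J}. (\<Sum>i<k. f i) \<in> B (l ! k)}"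
  define EB where "EB = {f \<in> space (PiM {m} (\<lambda>_. borel::real measure)). f m \<in> C}"
  have EA: "EA \<in> sets (PiM {..<m} (\<lambda>_. borel::real measure))"
  proof -
    have *: "{f \<in> space (PiM {..<m} (\<lambda>_. borel::real measure)). (\<Sum>i<k. f i) \<in> B (l ! k)} \<in> sets (PiM {..<m} (\<lambda>_. borel))"
      if "k \<le> m" for k
    proof -
      have "(\<lambda>f. \<Sum>i<k. f i) \<in> borel_measurable (PiM {..<m} (\<lambda>_. borel::real measure))"
        using that by (intro borel_measurable_sum measurable_component_singleton) auto
      from measurable_sets_Collect[OF this, of "\<lambda>x. x \<in> B (l ! k)"] show ?thesis using B by simp
    qed
    show ?thesis unfolding EA_def by (intro sets.sets_Collect_finite_All) (use * in auto)
  qed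
  have EB: "EB \<in> sets (PiM {m} (\<lambda>_. borel::real measure))"
    unfolding EB_def using C by measurable
  have A: "(\<lambda>\<omega>. restrict (\<lambda>i. D i \<omega>) {..<m}) -` EA \<inter> space M = {\<omega>\<in>space M. \<forall>j\<in>J. W j \<omega> \<in> B j}"
  proof -
    have "(\<forall>k\<in>{k. k \<le> m \<and> l ! k \<in> J}. (\<Sum>i<k. (restrict (\<lambda>i. D i \<omega>) {..<m}) i) \<in> B (l ! k)) \<longleftrightarrow> (\<forall>j\<in>J. W j \<omega> \<in> B j)"
      if om: "\<omega> \<in> space M" for \<omega>
    proof -
      have "(\<Sum>i<k. (restrict (\<lambda>i. D i \<omega>) {..<m}) i) = W (l ! k) \<omega>" if "k \<le> m" for k
        using Wsum[OF om, of k] that by (simp add: r_def)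
      then have "(\<forall>k\<in>{k. k \<le> m \<and> l ! k \<in> J}. (\<Sum>i<k. (restrict (\<lambda>i. D i \<omega>) {..<m}) i) \<in> B (l ! k))
         \<longleftrightarrow> (\<forall>k\<in>{k. k \<le> m \<and> l ! k \<in> J}. W (l ! k) \<omega> \<in> B (l ! k))" by auto
      also have "\<dots> \<longleftrightarrow> (\<forall>j\<in>J. W j \<omega> \<in> B j)"
      proof -
        have "\<exists>k\<le>m. l ! k = j" if "j \<in> J" for j
          using that setl len by (metis in_set_conv_nth insertCI less_Suc_eq_le)
        then show ?thesis by blast
      qed
      finally show ?thesis .
    qed
    then show ?thesis unfolding EA_def by (auto simp: space_PiM)
  qed
  have Bq: "(\<lambda>\<omega>. restrict (\<lambda>i. D i \<omega>) {m}) -` EB \<inter> space M = {\<omega>\<in>space M. W (u + h) \<omega> - W u \<omega> \<in> C}"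
    by (auto simp: EB_def space_PiM D_def r_def lm)
  have "prob ((\<lambda>x. (restrict (\<lambda>i. D i x) {..<m}, restrict (\<lambda>i. D i x) {m})) -` (EA \<times> EB) \<inter> space M)
     = prob {\<omega>\<in>space M. \<forall>j\<in>J. W j \<omega> \<in> B j} * prob {\<omega>\<in>space M. W (u + h) \<omega> - W u \<omega> \<in> C}"
    using indep_varD[OF ir EA EB] unfolding A Bq .
  moreover have "(\<lambda>x. (restrict (\<lambda>i. D i x) {..<m}, restrict (\<lambda>i. D i x) {m})) -` (EA \<times> EB) \<inter> space M
     = {\<omega>\<in>space M. \<forall>j\<in>J. W j \<omega> \<in> B j} \<inter> {\<omega>\<in>space M. W (u + h) \<omega> - W u \<omega> \<in> C}"
    unfolding A[symmetric] Bq[symmetric] by auto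
  ultimately show ?thesis by simp
qed

end

section \<open>Completed histories and the uncontrolled inventory\<close>

lemma space_completed_history [simp]: "space (completed_history M X s) = space M"
  unfolding completed_history_def by (simp add: space_measure_of_conv)

lemma sets_completed_history:
  "sets (completed_history M X s) = sigma_sets (space M)
     ({X u -` B \<inter> space M | u B. 0 \<le> u \<and> ennreal u \<le> s \<and> B \<in> sets borel} \<union> null_sets (completion M))"
proof -
  have "null_sets (completion M) \<subseteq> Pow (space M)"
    using sets.sets_into_space[of _ "completion M"] by (auto simp: null_sets_def)
  then show ?thesis unfolding completed_history_def by (subst sets_measure_of) auto
qed

lemma sets_completed_history_mono:
  "s \<le> s' \<Longrightarrow> sets (completed_history M X s) \<subseteq> sets (completed_history M X s')"
  unfolding sets_completed_history by (rule sigma_sets_mono') (auto intro: order_trans)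

lemma null_sets_completed_history:
  "A \<in> null_sets (completion M) \<Longrightarrow> A \<in> sets (completed_history M X s)"
  unfolding sets_completed_history by (rule sigma_sets.Basic) auto

lemma measurable_completed_history:
  fixes X :: "real \<Rightarrow> 'a \<Rightarrow> real"
  assumes "0 \<le> u" "ennreal u \<le> s"
  shows "X u \<in> borel_measurable (completed_history M X s)"
proof (rule measurableI)
  fix A :: "real set" assume A: "A \<in> sets borel"
  show "X u -` A \<inter> space (completed_history M X s) \<in> sets (completed_history M X s)"
    unfolding sets_completed_history space_completed_history by (rule sigma_sets.Basic) (use assms A in auto)
qed simp

locale drifted_brownian_motion = standard_brownian_motion M W
  for M :: "'a measure" and W :: "real \<Rightarrow> 'a \<Rightarrow> real" +
  fixes \<mu> \<sigma> x0 :: real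
  assumes mu_pos: "0 < \<mu>" and sigma_pos: "0 < \<sigma>"
begin

abbreviation "X0 \<equiv> inventory0 \<mu> \<sigma> W x0"
abbreviation "\<H> u \<equiv> completed_history M X0 (ennreal u)"
abbreviation "P \<equiv> completion M"

lemma prob_space_P: "prob_space P"
  by (rule prob_space_completion)

sublocale P: prob_space P
  by (rule prob_space_P)

lemma X0_measurable_M: "0 \<le> u \<Longrightarrow> X0 u \<in> borel_measurable M"
  unfolding inventory0_def using random_variable_W[of u] by measurable

lemma sets_completed_history_subset: "sets (completed_history M X0 s) \<subseteq> sets P"
proof -
  have "{X0 u -` B \<inter> space M | u B. 0 \<le> u \<and> ennreal u \<le> s \<and> B \<in> sets borel} \<union> null_sets P \<subseteq> sets P"
    using measurable_sets[OF X0_measurable_M] by (auto simp: null_sets_def)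
  from sets.sigma_sets_subset[OF this] show ?thesis unfolding sets_completed_history by simp
qed

lemma measurable_completed_history_P:
  "f \<in> measurable (completed_history M X0 s) N \<Longrightarrow> f \<in> measurable P N"
  using sets_completed_history_subset by (auto simp: measurable_def)

lemma X0_zero: "\<omega> \<in> space M \<Longrightarrow> X0 0 \<omega> = x0"
  by (simp add: inventory0_def W_zero)

lemma X0_continuous: "\<omega> \<in> space M \<Longrightarrow> continuous_on {0..} (\<lambda>t. X0 t \<omega>)"
  unfolding inventory0_def using continuous_paths[of \<omega>] by (intro continuous_intros)

text \<open>Cylinder sets instead of events at a single time, because an intersection-stable
  generator is needed to extend independence to the generated sigma-algebra. Null sets are left
  out.\<close>

definition strict_past :: "real \<Rightarrow> 'a set set" where
  "strict_past u = {{\<omega>\<in>space M. \<forall>j\<in>J. X0 j \<omega> \<in> B j} | J B. finite J \<and> J \<subseteq> {0..u} \<and> (\<forall>j. B j \<in> sets borel)}"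

lemma Int_stable_strict_past: "Int_stable (strict_past u)"
proof (rule Int_stableI)
  fix a b assume "a \<in> strict_past u" "b \<in> strict_past u"
  then obtain J B K C where a: "a = {\<omega>\<in>space M. \<forall>j\<in>J. X0 j \<omega> \<in> B j}" "finite J" "J \<subseteq> {0..u}" "\<forall>j. B j \<in> sets borel"
    and b: "b = {\<omega>\<in>space M. \<forall>j\<in>K. X0 j \<omega> \<in> C j}" "finite K" "K \<subseteq> {0..u}" "\<forall>j. C j \<in> sets borel"
    unfolding strict_past_def by blast
  have "a \<inter> b = {\<omega>\<in>space M. \<forall>j\<in>J \<union> K. X0 j \<omega> \<in> (if j \<in> J then B j else UNIV) \<inter> (if j \<in> K then C j else UNIV)}"
    unfolding a b by auto
  then show "a \<inter> b \<in> strict_past u"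
    unfolding strict_past_def using a(2-4) b(2-4)
    by (intro CollectI exI[of _ "J \<union> K"] exI[of _ "\<lambda>j. (if j \<in> J then B j else UNIV) \<inter> (if j \<in> K then C j else UNIV)"]) auto
qed

lemma strict_past_events: "strict_past u \<subseteq> events"
proof
  fix a assume "a \<in> strict_past u"
  then obtain J B where a: "a = {\<omega>\<in>space M. \<forall>j\<in>J. X0 j \<omega> \<in> B j}" "finite J" "J \<subseteq> {0..u}" "\<forall>j. B j \<in> sets borel"
    unfolding strict_past_def by blast
  have "{\<omega>\<in>space M. X0 j \<omega> \<in> B j} \<in> events" if "j \<in> J" for j
    using measurable_sets_Collect[OF X0_measurable_M[of j], of "\<lambda>x. x \<in> B j"] a that by auto
  then show "a \<in> events" unfolding a(1) using a(2) by (intro sets.sets_Collect_finite_All) auto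
qed

lemma strict_past_independent:
  assumes u: "0 \<le> u" and h: "0 < h"
  shows "indep_set (sigma_sets (space M) (strict_past u))
    (sigma_sets (space M) {(\<lambda>\<omega>. W (u + h) \<omega> - W u \<omega>) -` C \<inter> space M | C. C \<in> sets borel})"
proof (rule indep_set_sigma_sets)
  show "Int_stable (strict_past u)" by (rule Int_stable_strict_past)
  show "Int_stable {(\<lambda>\<omega>. W (u + h) \<omega> - W u \<omega>) -` C \<inter> space M |C. C \<in> sets borel}"
  proof (rule Int_stableI)
    fix a b assume "a \<in> {(\<lambda>\<omega>. W (u + h) \<omega> - W u \<omega>) -` C \<inter> space M |C. C \<in> sets borel}"
      "b \<in> {(\<lambda>\<omega>. W (u + h) \<omega> - W u \<omega>) -` C \<inter> space M |C. C \<in> sets borel}"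
    then obtain A B where "a = (\<lambda>\<omega>. W (u + h) \<omega> - W u \<omega>) -` A \<inter> space M" "A \<in> sets borel"
      "b = (\<lambda>\<omega>. W (u + h) \<omega> - W u \<omega>) -` B \<inter> space M" "B \<in> sets borel" by blast
    then show "a \<inter> b \<in> {(\<lambda>\<omega>. W (u + h) \<omega> - W u \<omega>) -` C \<inter> space M |C. C \<in> sets borel}"
      by (intro CollectI exI[of _ "A \<inter> B"]) auto
  qed
  have meas: "(\<lambda>\<omega>. W (u + h) \<omega> - W u \<omega>) \<in> borel_measurable M"
    using random_variable_W[of u] random_variable_W[of "u + h"] u h by simp
  have D: "{(\<lambda>\<omega>. W (u + h) \<omega> - W u \<omega>) -` C \<inter> space M |C. C \<in> sets borel} \<subseteq> events"
    by (auto intro!: measurable_sets[OF meas])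
  show "indep_set (strict_past u) {(\<lambda>\<omega>. W (u + h) \<omega> - W u \<omega>) -` C \<inter> space M |C. C \<in> sets borel}"
  proof (rule indep_setI[OF strict_past_events D])
    fix a b assume ab: "a \<in> strict_past u" "b \<in> {(\<lambda>\<omega>. W (u + h) \<omega> - W u \<omega>) -` C \<inter> space M |C. C \<in> sets borel}"
    from ab(1) obtain J B where a: "a = {\<omega>\<in>space M. \<forall>j\<in>J. X0 j \<omega> \<in> B j}" "finite J" "J \<subseteq> {0..u}" "\<forall>j. B j \<in> sets borel"
      unfolding strict_past_def by blast
    from ab(2) obtain C where b: "b = (\<lambda>\<omega>. W (u + h) \<omega> - W u \<omega>) -` C \<inter> space M" "C \<in> sets borel"
      by blast
    \<comment> \<open>The drift is deterministic, so an event of \<open>X0\<close> at time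
      \<open>j\<close> is an event of \<open>W\<close> for the affine preimage.\<close>
    define B' where "B' j = (\<lambda>x. x0 - \<mu> * j + \<sigma> * x) -` B j" for j
    have B': "B' j \<in> sets borel" for j
    proof -
      have "(\<lambda>x. x0 - \<mu> * j + \<sigma> * x) \<in> borel_measurable borel" by measurable
      from measurable_sets[OF this, of "B j"] show ?thesis using a(4) unfolding B'_def by simp
    qed
    have a': "a = {\<omega>\<in>space M. \<forall>j\<in>J. W j \<omega> \<in> B' j}"
      unfolding a B'_def inventory0_def by simp
    have b': "b = {\<omega>\<in>space M. W (u + h) \<omega> - W u \<omega> \<in> C}" unfolding b by auto
    show "prob (a \<inter> b) = prob a * prob b"
      unfolding a' b' by (rule W_future_independent[OF a(2,3) u h B' b(2)])
  qed
qed

text \<open>Completion only adds null sets to the generators, each almost surely equal to the empty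
  set, and almost sure equality passes through complements and countable unions.\<close>

lemma completed_history_AE_eq_strict_past:
  assumes "A \<in> sets (\<H> u)"
  shows "\<exists>B\<in>sigma_sets (space M) (strict_past u). AE \<omega> in P. \<omega> \<in> A \<longleftrightarrow> \<omega> \<in> B"
  using assms unfolding sets_completed_history
proof (induction rule: sigma_sets.induct)
  case (Basic A)
  then show ?case
  proof
    assume "A \<in> {X0 v -` B \<inter> space M |v B. 0 \<le> v \<and> ennreal v \<le> ennreal u \<and> B \<in> sets borel}"
    then obtain v B where v: "A = X0 v -` B \<inter> space M" "0 \<le> v" "ennreal v \<le> ennreal u" "B \<in> sets borel" by blast
    show ?thesis
    proof (cases "v \<le> u")
      case True
      then have "A \<in> strict_past u" unfolding strict_past_def using v
        by (intro CollectI exI[of _ "{v}"] exI[of _ "\<lambda>_. B"]) auto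
      then show ?thesis by (intro bexI[of _ A]) auto
    next
      case False
      \<comment> \<open>The coercion to \<open>ennreal\<close> sends a negative \<open>u\<close> to
        0, so time 0 may count as past although \<open>v \<le> u\<close> fails. The generator is
        then trivial, since \<open>X0\<close> starts at the constant \<open>x0\<close>.\<close>
      then have "v = 0" using v(2,3) by (metis ennreal_le_iff2 linorder_not_less order_less_imp_le order_antisym)
      then have A: "A = (if x0 \<in> B then space M else {})" using v(1) X0_zero by auto
      show ?thesis by (intro bexI[of _ A]) (auto simp: A sigma_sets_top sigma_sets.Empty)
    qed
  next
    assume "A \<in> null_sets P"
    then have "AE \<omega> in P. \<omega> \<in> A \<longleftrightarrow> \<omega> \<in> {}" using AE_not_in by fastforce
    then show ?thesis by (intro bexI[of _ "{}"]) (auto intro: sigma_sets.Empty)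
  qed
next
  case Empty
  show ?case by (intro bexI[of _ "{}"]) (auto intro: sigma_sets.Empty)
next
  case (Compl A)
  then obtain B where "B \<in> sigma_sets (space M) (strict_past u)" "AE \<omega> in P. \<omega> \<in> A \<longleftrightarrow> \<omega> \<in> B" by blast
  then show ?case by (intro bexI[of _ "space M - B"]) (auto intro: sigma_sets.Compl)
next
  case (Union A)
  then have "\<forall>i. \<exists>B. B \<in> sigma_sets (space M) (strict_past u) \<and> (AE \<omega> in P. \<omega> \<in> A i \<longleftrightarrow> \<omega> \<in> B)" by blast
  then obtain B where B: "\<And>i. B i \<in> sigma_sets (space M) (strict_past u)" "\<And>i. AE \<omega> in P. \<omega> \<in> A i \<longleftrightarrow> \<omega> \<in> B i" by metis
  have "AE \<omega> in P. \<forall>i. \<omega> \<in> A i \<longleftrightarrow> \<omega> \<in> B i" using B(2) by (simp add: AE_all_countable)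
  then have "AE \<omega> in P. \<omega> \<in> (\<Union>i. A i) \<longleftrightarrow> \<omega> \<in> (\<Union>i. B i)" by eventually_elim auto
  then show ?case using B(1) by (intro bexI[of _ "\<Union>i. B i"]) (auto intro: sigma_sets.Union)
qed

lemma increment_measurable_M:
  "0 \<le> u \<Longrightarrow> 0 < h \<Longrightarrow> (\<lambda>\<omega>. W (u + h) \<omega> - W u \<omega>) \<in> borel_measurable M"
  using random_variable_W[of u] random_variable_W[of "u + h"] by simp

text \<open>An event of the completed history has the same probabilities as an almost surely equal
  event of the uncompleted one, where independence is already known.\<close>

lemma increment_independent:
  assumes \<xi>: "\<xi> \<in> borel_measurable (\<H> u)" and u: "0 \<le> u" and h: "0 < h"
  shows "P.indep_var borel \<xi> borel (\<lambda>\<omega>. W (u + h) \<omega> - W u \<omega>)"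
proof -
  let ?D = "\<lambda>\<omega>. W (u + h) \<omega> - W u \<omega>"
  let ?G = "sigma_sets (space M) {?D -` C \<inter> space M | C. C \<in> sets borel}"
  have D: "?D \<in> borel_measurable M" using u h by (rule increment_measurable_M)
  have DP: "?D \<in> borel_measurable P" by (rule measurable_completion[OF D])
  have \<xi>P: "\<xi> \<in> borel_measurable P" by (rule measurable_completed_history_P[OF \<xi>])
  have G: "?G \<subseteq> events" by (intro sets.sigma_sets_subset) (auto intro!: measurable_sets[OF D])
  have GP: "events \<subseteq> sets P" by auto
  let ?X = "sigma_sets (space M) {\<xi> -` A \<inter> space M | A. A \<in> sets borel}"
  have gen: "{\<xi> -` A \<inter> space M | A. A \<in> sets borel} \<subseteq> sets (\<H> u)"
    using measurable_sets[OF \<xi>] by auto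
  have sub: "?X \<subseteq> sets (\<H> u)"
    using sets.sigma_sets_subset[OF gen] by simp
  have ind: "P.indep_set (sets (\<H> u)) ?G"
  proof (rule P.indep_setI)
    show "sets (\<H> u) \<subseteq> P.events" by (rule sets_completed_history_subset)
    show "?G \<subseteq> P.events" using G GP by blast
    fix a b assume a: "a \<in> sets (\<H> u)" and b: "b \<in> ?G"
    obtain B where B: "B \<in> sigma_sets (space M) (strict_past u)" "AE \<omega> in P. \<omega> \<in> a \<longleftrightarrow> \<omega> \<in> B"
      using completed_history_AE_eq_strict_past[OF a] by blast
    have Bev: "B \<in> events" using B(1) sets.sigma_sets_subset[OF strict_past_events] by blast
    have bev: "b \<in> events" using b G by blast
    have aev: "a \<in> sets P" using a sets_completed_history_subset by blast
    have "P.prob (a \<inter> b) = P.prob (B \<inter> b)"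
      using B(2) aev Bev bev by (intro measure_eq_AE) (auto elim: eventually_mono)
    also have "\<dots> = prob (B \<inter> b)" using Bev bev by simp
    also have "\<dots> = prob B * prob b"
      by (rule indep_setD[OF strict_past_independent[OF u h]]) (use B b in auto)
    also have "\<dots> = P.prob B * P.prob b" using Bev bev by simp
    also have "P.prob B = P.prob a"
      using B(2) aev Bev by (intro measure_eq_AE) (auto elim: eventually_mono)
    finally show "P.prob (a \<inter> b) = P.prob a * P.prob b" .
  qed
  have "P.indep_set ?X ?G"
  proof (rule P.indep_setI)
    show "?X \<subseteq> P.events" using sub sets_completed_history_subset by (rule subset_trans)
    show "?G \<subseteq> P.events" using G GP by (rule subset_trans)
    fix a b assume "a \<in> ?X" "b \<in> ?G"
    then show "P.prob (a \<inter> b) = P.prob a * P.prob b"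
      using sub by (intro P.indep_setD[OF ind]) auto
  qed
  then show ?thesis unfolding P.indep_var_eq using DP \<xi>P by simp
qed

end

section \<open>Test functions and one time step\<close>

text \<open>Boundedness keeps all expectations finite without any moment of the controlled
  inventory; uniform continuity of the second derivative makes the Taylor error uniform in the
  position.\<close>

locale test_function =
  fixes U w v :: "real \<Rightarrow> real"
  assumes U_deriv: "\<And>x. (U has_real_derivative w x) (at x)"
    and w_deriv: "\<And>x. (w has_real_derivative v x) (at x)"
    and bounded_U: "bounded (range U)" and bounded_w: "bounded (range w)" and bounded_v: "bounded (range v)"
    and v_unif: "uniformly_continuous_on UNIV v"
begin

lemma continuous_U: "continuous_on UNIV U"
  using U_deriv by (intro DERIV_continuous_on) (auto intro: DERIV_subset)

lemma continuous_w: "continuous_on UNIV w"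
  using w_deriv by (intro DERIV_continuous_on) (auto intro: DERIV_subset)

lemma continuous_v: "continuous_on UNIV v"
  using v_unif by (rule uniformly_continuous_imp_continuous)

lemma measurable_U [measurable]: "U \<in> borel_measurable borel"
  and measurable_w [measurable]: "w \<in> borel_measurable borel"
  and measurable_v [measurable]: "v \<in> borel_measurable borel"
  using continuous_U continuous_w continuous_v by (auto intro: borel_measurable_continuous_onI)

lemma ex_bound:
  obtains B where "\<And>x. \<bar>U x\<bar> \<le> B" "\<And>x. \<bar>w x\<bar> \<le> B" "\<And>x. \<bar>v x\<bar> \<le> B" "0 < B"
proof -
  from bounded_U obtain B1 where B1: "0 < B1" "\<forall>x\<in>range U. norm x \<le> B1" unfolding bounded_pos by blast
  from bounded_w obtain B2 where B2: "0 < B2" "\<forall>x\<in>range w. norm x \<le> B2" unfolding bounded_pos by blast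
  from bounded_v obtain B3 where B3: "0 < B3" "\<forall>x\<in>range v. norm x \<le> B3" unfolding bounded_pos by blast
  have "\<bar>U x\<bar> \<le> max B1 (max B2 B3)" "\<bar>w x\<bar> \<le> max B1 (max B2 B3)" "\<bar>v x\<bar> \<le> max B1 (max B2 B3)" for x
    using B1 B2 B3 by (auto simp: le_max_iff_disj)
  then show ?thesis using that[of "max B1 (max B2 B3)"] B1 by auto
qed

text \<open>Lagrange form of the remainder. If the increment is below \<open>\<delta>\<close>, the
  modulus of continuity applies; otherwise the crude bound \<open>2 * B\<close> is multiplied by
  \<open>d\<^sup>2 / \<delta>\<^sup>2\<close>, which is at least 1. Large increments thus cost a
  fourth moment, which is of order \<open>h\<^sup>2\<close>.\<close>

lemma taylor_remainder:
  assumes B: "\<And>x. \<bar>v x\<bar> \<le> B" and d: "0 < \<delta>" and \<eta>: "\<And>x y. \<bar>x - y\<bar> < \<delta> \<Longrightarrow> \<bar>v x - v y\<bar> \<le> \<eta>"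
  shows "\<bar>U (x + d) - U x - w x * d - v x * d\<^sup>2 / 2\<bar> \<le> \<eta> * d\<^sup>2 / 2 + B * d ^ 4 / \<delta>\<^sup>2"
proof -
  have eta0: "0 \<le> \<eta>" using \<eta>[of x x] d by simp
  have B0: "0 \<le> B" using B[of x] by linarith
  have "\<exists>z. \<bar>z - x\<bar> \<le> \<bar>d\<bar> \<and> U (x + d) = U x + w x * d + v z * d\<^sup>2 / 2"
  proof (cases "d = 0")
    case True then show ?thesis by (intro exI[of _ x]) auto
  next
    case False
    define diff where "diff m = (if m = 0 then U else if m = 1 then w else v)" for m :: nat
    have "\<forall>m t. m < 2 \<and> (x - \<bar>d\<bar>) \<le> t \<and> t \<le> (x + \<bar>d\<bar>) \<longrightarrow> (diff m has_real_derivative diff (Suc m) t) (at t)"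
      using U_deriv w_deriv by (auto simp: diff_def less_2_cases_iff)
    then have "\<exists>t. (if x + d < x then x + d < t \<and> t < x else x < t \<and> t < x + d) \<and>
        U (x + d) = (\<Sum>m<2. (diff m x / fact m) * (x + d - x) ^ m) + (diff 2 t / fact 2) * (x + d - x) ^ 2"
      using False by (intro Taylor[of 2 diff U "x - \<bar>d\<bar>" "x + \<bar>d\<bar>"]) (auto simp: diff_def)
    then obtain t where t: "if x + d < x then x + d < t \<and> t < x else x < t \<and> t < x + d"
      "U (x + d) = (\<Sum>m<2. (diff m x / fact m) * (x + d - x) ^ m) + (diff 2 t / fact 2) * (x + d - x) ^ 2" by blast
    have "U (x + d) = U x + w x * d + v t * d\<^sup>2 / 2"
      using t(2) by (simp add: diff_def numeral_2_eq_2)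
    moreover have "\<bar>t - x\<bar> \<le> \<bar>d\<bar>" using t(1) by (auto split: if_splits)
    ultimately show ?thesis by blast
  qed
  then obtain z where z: "\<bar>z - x\<bar> \<le> \<bar>d\<bar>" "U (x + d) = U x + w x * d + v z * d\<^sup>2 / 2" by blast
  have "\<bar>v z - v x\<bar> \<le> \<eta> + 2 * B * d\<^sup>2 / \<delta>\<^sup>2"
  proof (cases "\<bar>d\<bar> < \<delta>")
    case True
    then have "\<bar>v z - v x\<bar> \<le> \<eta>" using z(1) by (intro \<eta>) auto
    moreover have "0 \<le> 2 * B * d\<^sup>2 / \<delta>\<^sup>2" using B0 by simp
    ultimately show ?thesis by linarith
  next
    case False
    then have "\<delta>\<^sup>2 \<le> d\<^sup>2" using d by (simp add: abs_le_square_iff[symmetric])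
    then have "1 \<le> d\<^sup>2 / \<delta>\<^sup>2" using d by (simp add: field_simps)
    then have "2 * B * 1 \<le> 2 * B * (d\<^sup>2 / \<delta>\<^sup>2)" using B0 by (intro mult_left_mono) auto
    moreover have "\<bar>v z - v x\<bar> \<le> 2 * B" using B[of z] B[of x] by linarith
    ultimately show ?thesis using eta0 by (simp add: field_simps)
  qed
  then have "\<bar>v z - v x\<bar> * (d\<^sup>2 / 2) \<le> (\<eta> + 2 * B * d\<^sup>2 / \<delta>\<^sup>2) * (d\<^sup>2 / 2)"
    by (rule mult_right_mono) simp
  moreover have E: "U (x + d) - U x - w x * d - v x * d\<^sup>2 / 2 = (v z - v x) * (d\<^sup>2 / 2)"
    unfolding z(2) by (simp add: algebra_simps)
  moreover have "\<bar>(v z - v x) * (d\<^sup>2 / 2)\<bar> = \<bar>v z - v x\<bar> * (d\<^sup>2 / 2)" by (simp add: abs_mult)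
  moreover have "(\<eta> + 2 * B * d\<^sup>2 / \<delta>\<^sup>2) * (d\<^sup>2 / 2) = \<eta> * d\<^sup>2 / 2 + B * d ^ 4 / \<delta>\<^sup>2"
    by (simp add: algebra_simps power2_eq_square power4_eq_xxxx)
  ultimately show ?thesis unfolding E by linarith
qed

end

section \<open>Moments of the increment and the expected change over one time step\<close>

context drifted_brownian_motion
begin

lemma increment_moment:
  assumes u: "0 \<le> u" and h: "0 < h"
  shows "integrable P (\<lambda>\<omega>. (W (u + h) \<omega> - W u \<omega>) ^ k)"
    and "(\<integral>\<omega>. (W (u + h) \<omega> - W u \<omega>) ^ k \<partial>P) = (\<integral>x. normal_density 0 (sqrt h) x * x ^ k \<partial>lborel)"
proof -
  have D: "distributed M lborel (\<lambda>\<omega>. W (u + h) \<omega> - W u \<omega>) (normal_density 0 (sqrt h))"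
    using normal_increments[of u "u + h"] u h by simp
  have "integrable lborel (\<lambda>x. normal_density 0 (sqrt h) x * x ^ k)"
    using integrable_normal_moment[of "sqrt h" 0 k] h by simp
  then have int: "integrable M (\<lambda>\<omega>. (W (u + h) \<omega> - W u \<omega>) ^ k)"
    by (subst (asm) distributed_integrable[OF D]) auto
  then show "integrable P (\<lambda>\<omega>. (W (u + h) \<omega> - W u \<omega>) ^ k)"
    by (subst integrable_completion) (auto dest: borel_measurable_integrable)
  have "(\<integral>\<omega>. (W (u + h) \<omega> - W u \<omega>) ^ k \<partial>P) = (\<integral>\<omega>. (W (u + h) \<omega> - W u \<omega>) ^ k \<partial>M)"
    using int by (intro integral_completion) (auto dest: borel_measurable_integrable)
  also have "\<dots> = (\<integral>x. normal_density 0 (sqrt h) x * x ^ k \<partial>lborel)"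
    by (subst distributed_integral[OF D, symmetric]) auto
  finally show "(\<integral>\<omega>. (W (u + h) \<omega> - W u \<omega>) ^ k \<partial>P) = (\<integral>x. normal_density 0 (sqrt h) x * x ^ k \<partial>lborel)" .
qed

lemma increment_moments:
  assumes u: "0 \<le> u" and h: "0 < h"
  shows "(\<integral>\<omega>. W (u + h) \<omega> - W u \<omega> \<partial>P) = 0"
    and "(\<integral>\<omega>. (W (u + h) \<omega> - W u \<omega>)\<^sup>2 \<partial>P) = h"
    and "(\<integral>\<omega>. (W (u + h) \<omega> - W u \<omega>) ^ 4 \<partial>P) = 3 * h\<^sup>2"
proof -
  note m = increment_moment(2)[OF u h]
  show "(\<integral>\<omega>. W (u + h) \<omega> - W u \<omega> \<partial>P) = 0"
    using m[of 1] integral_normal_moment_odd[of "sqrt h" 0 0] h by simp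
  show "(\<integral>\<omega>. (W (u + h) \<omega> - W u \<omega>)\<^sup>2 \<partial>P) = h"
    using m[of 2] integral_normal_moment_even[of "sqrt h" 0 1] h by simp
  show "(\<integral>\<omega>. (W (u + h) \<omega> - W u \<omega>) ^ 4 \<partial>P) = 3 * h\<^sup>2"
    using m[of 4] integral_normal_moment_even[of "sqrt h" 0 2] h
    by (simp add: fact_numeral power_divide power2_eq_square)
qed

lemma integral_indep_mult:
  fixes f g :: "real \<Rightarrow> real"
  assumes \<xi>: "\<xi> \<in> borel_measurable (\<H> u)" and u: "0 \<le> u" and h: "0 < h"
    and f: "f \<in> borel_measurable borel" "\<And>x. \<bar>f x\<bar> \<le> B" and g: "g \<in> borel_measurable borel"
    and gi: "integrable P (\<lambda>\<omega>. g (W (u + h) \<omega> - W u \<omega>))"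
  shows "integrable P (\<lambda>\<omega>. f (\<xi> \<omega>) * g (W (u + h) \<omega> - W u \<omega>))"
    and "(\<integral>\<omega>. f (\<xi> \<omega>) * g (W (u + h) \<omega> - W u \<omega>) \<partial>P) =
      (\<integral>\<omega>. f (\<xi> \<omega>) \<partial>P) * (\<integral>\<omega>. g (W (u + h) \<omega> - W u \<omega>) \<partial>P)"
proof -
  have "P.indep_var borel (f \<circ> \<xi>) borel (g \<circ> (\<lambda>\<omega>. W (u + h) \<omega> - W u \<omega>))"
    by (rule P.indep_var_compose[OF increment_independent[OF \<xi> u h] f(1) g])
  then have ind: "P.indep_var borel (\<lambda>\<omega>. f (\<xi> \<omega>)) borel (\<lambda>\<omega>. g (W (u + h) \<omega> - W u \<omega>))"
    by (simp add: comp_def)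
  have "(\<lambda>\<omega>. f (\<xi> \<omega>)) \<in> borel_measurable P"
    using measurable_compose[OF measurable_completed_history_P[OF \<xi>] f(1)] .
  then have fi: "integrable P (\<lambda>\<omega>. f (\<xi> \<omega>))"
    using f(2) by (intro P.integrable_const_bound[where B=B]) auto
  show "integrable P (\<lambda>\<omega>. f (\<xi> \<omega>) * g (W (u + h) \<omega> - W u \<omega>))"
    by (rule P.indep_var_integrable[OF ind fi gi])
  show "(\<integral>\<omega>. f (\<xi> \<omega>) * g (W (u + h) \<omega> - W u \<omega>) \<partial>P) =
      (\<integral>\<omega>. f (\<xi> \<omega>) \<partial>P) * (\<integral>\<omega>. g (W (u + h) \<omega> - W u \<omega>) \<partial>P)"
    by (rule P.indep_var_lebesgue_integral[OF ind fi gi])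
qed

definition gen :: "(real \<Rightarrow> real) \<Rightarrow> (real \<Rightarrow> real) \<Rightarrow> real \<Rightarrow> real" where
  "gen w v x = \<sigma>\<^sup>2 / 2 * v x - \<mu> * w x"

lemma fourth_power_sum_le: "(a + b :: real) ^ 4 \<le> 8 * (a ^ 4 + b ^ 4)"
proof -
  have s: "(x + y)\<^sup>2 \<le> 2 * (x\<^sup>2 + y\<^sup>2)" for x y :: real
    using zero_le_power2[of "x - y"] by (simp add: power2_eq_square algebra_simps)
  have "(a + b) ^ 4 = ((a + b)\<^sup>2)\<^sup>2" by simp
  also have "\<dots> \<le> (2 * (a\<^sup>2 + b\<^sup>2))\<^sup>2" using s[of a b] by (intro power_mono) auto
  also have "\<dots> = 4 * (a\<^sup>2 + b\<^sup>2)\<^sup>2" by (simp only: power_mult_distrib) simp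
  also have "\<dots> \<le> 4 * (2 * ((a\<^sup>2)\<^sup>2 + (b\<^sup>2)\<^sup>2))" using s[of "a\<^sup>2" "b\<^sup>2"] by (intro mult_left_mono) auto
  finally show ?thesis by simp
qed

text \<open>By independence the increment of \<open>W\<close> contributes mean 0 to the terms linear
  in it and \<open>h\<close> to the quadratic one, which produces \<open>h\<close> times the
  generator. The last summand of the bound comes from the squared drift; the others bound the Taylor
  remainder.\<close>

lemma one_step_bound:
  assumes tf: "test_function U w v" and B: "\<And>x. \<bar>U x\<bar> \<le> B" "\<And>x. \<bar>w x\<bar> \<le> B" "\<And>x. \<bar>v x\<bar> \<le> B"
    and d: "0 < \<delta>" and \<eta>: "\<And>x y. \<bar>x - y\<bar> < \<delta> \<Longrightarrow> \<bar>v x - v y\<bar> \<le> \<eta>"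
    and \<xi>: "\<xi> \<in> borel_measurable (\<H> u)" and u: "0 \<le> u" and h: "0 < h"
  shows "\<bar>(\<integral>\<omega>. U (\<xi> \<omega> + (X0 (u + h) \<omega> - X0 u \<omega>)) - U (\<xi> \<omega>) \<partial>P) - h * (\<integral>\<omega>. gen w v (\<xi> \<omega>) \<partial>P)\<bar>
    \<le> \<eta> / 2 * (\<mu>\<^sup>2 * h\<^sup>2 + \<sigma>\<^sup>2 * h) + B / \<delta>\<^sup>2 * (8 * (\<mu> ^ 4 * h ^ 4 + 3 * \<sigma> ^ 4 * h\<^sup>2)) + \<mu>\<^sup>2 * h\<^sup>2 / 2 * B"
proof -
  interpret test_function U w v by fact
  let ?D = "\<lambda>\<omega>. W (u + h) \<omega> - W u \<omega>"
  define d where "d \<omega> = - \<mu> * h + \<sigma> * ?D \<omega>" for \<omega>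
  have dX: "X0 (u + h) \<omega> - X0 u \<omega> = d \<omega>" for \<omega>
    by (simp add: inventory0_def d_def algebra_simps)
  have \<xi>P [measurable]: "\<xi> \<in> borel_measurable P" by (rule measurable_completed_history_P[OF \<xi>])
  have DP [measurable]: "?D \<in> borel_measurable P"
    by (rule measurable_completion[OF increment_measurable_M[OF u h]])
  have dP [measurable]: "d \<in> borel_measurable P" unfolding d_def by measurable
  note mo = increment_moments[OF u h]
  have i1: "integrable P ?D" using increment_moment(1)[OF u h, of 1] by simp
  have i2: "integrable P (\<lambda>\<omega>. (?D \<omega>)\<^sup>2)" using increment_moment(1)[OF u h, of 2] by simp
  have i4: "integrable P (\<lambda>\<omega>. (?D \<omega>) ^ 4)" using increment_moment(1)[OF u h, of 4] by simp
  have iU: "integrable P (\<lambda>\<omega>. U (\<xi> \<omega>))" "integrable P (\<lambda>\<omega>. U (\<xi> \<omega> + d \<omega>))"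
    using B by (auto intro!: P.integrable_const_bound[where B=B])
  have iw: "integrable P (\<lambda>\<omega>. w (\<xi> \<omega>))" and iv: "integrable P (\<lambda>\<omega>. v (\<xi> \<omega>))"
    using B by (auto intro!: P.integrable_const_bound[where B=B])
  note w1 = integral_indep_mult[OF \<xi> u h measurable_w B(2), of "\<lambda>x. x"]
  note v1 = integral_indep_mult[OF \<xi> u h measurable_v B(3), of "\<lambda>x. x"]
  note v2 = integral_indep_mult[OF \<xi> u h measurable_v B(3), of "\<lambda>x. x\<^sup>2"]
  have iwD: "integrable P (\<lambda>\<omega>. w (\<xi> \<omega>) * ?D \<omega>)" and ewD: "(\<integral>\<omega>. w (\<xi> \<omega>) * ?D \<omega> \<partial>P) = 0"
    using w1 i1 mo(1) by auto
  have ivD: "integrable P (\<lambda>\<omega>. v (\<xi> \<omega>) * ?D \<omega>)" and evD: "(\<integral>\<omega>. v (\<xi> \<omega>) * ?D \<omega> \<partial>P) = 0"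
    using v1 i1 mo(1) by auto
  have ivD2: "integrable P (\<lambda>\<omega>. v (\<xi> \<omega>) * (?D \<omega>)\<^sup>2)"
    and evD2: "(\<integral>\<omega>. v (\<xi> \<omega>) * (?D \<omega>)\<^sup>2 \<partial>P) = (\<integral>\<omega>. v (\<xi> \<omega>) \<partial>P) * h"
    using v2 i2 mo(2) by auto
  have e1: "w x * d \<omega> + v x * (d \<omega>)\<^sup>2 / 2 =
      - \<mu> * h * w x + \<sigma> * (w x * ?D \<omega>) + (\<mu>\<^sup>2 * h\<^sup>2 / 2) * v x - \<mu> * h * \<sigma> * (v x * ?D \<omega>) + \<sigma>\<^sup>2 / 2 * (v x * (?D \<omega>)\<^sup>2)" for x \<omega>
  proof -
    have "w x * (- \<mu> * h + \<sigma> * D) + v x * (- \<mu> * h + \<sigma> * D)\<^sup>2 / 2 =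
      - \<mu> * h * w x + \<sigma> * (w x * D) + (\<mu>\<^sup>2 * h\<^sup>2 / 2) * v x - \<mu> * h * \<sigma> * (v x * D) + \<sigma>\<^sup>2 / 2 * (v x * D\<^sup>2)" for D :: real
      by (simp add: power2_eq_square field_simps)
    then show ?thesis unfolding d_def .
  qed
  have iq: "integrable P (\<lambda>\<omega>. w (\<xi> \<omega>) * d \<omega> + v (\<xi> \<omega>) * (d \<omega>)\<^sup>2 / 2)"
    unfolding e1 using iw iv iwD ivD ivD2
    by (intro Bochner_Integration.integrable_add Bochner_Integration.integrable_diff integrable_mult_right) auto
  have eq: "(\<integral>\<omega>. w (\<xi> \<omega>) * d \<omega> + v (\<xi> \<omega>) * (d \<omega>)\<^sup>2 / 2 \<partial>P)
     = - \<mu> * h * (\<integral>\<omega>. w (\<xi> \<omega>) \<partial>P) + (\<mu>\<^sup>2 * h\<^sup>2 / 2) * (\<integral>\<omega>. v (\<xi> \<omega>) \<partial>P) + \<sigma>\<^sup>2 / 2 * ((\<integral>\<omega>. v (\<xi> \<omega>) \<partial>P) * h)"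
    unfolding e1 using iw iv iwD ivD ivD2 by (simp add: ewD evD evD2)
  have eg: "(\<integral>\<omega>. gen w v (\<xi> \<omega>) \<partial>P) = \<sigma>\<^sup>2 / 2 * (\<integral>\<omega>. v (\<xi> \<omega>) \<partial>P) - \<mu> * (\<integral>\<omega>. w (\<xi> \<omega>) \<partial>P)"
    unfolding gen_def using iw iv by simp
  have id2: "integrable P (\<lambda>\<omega>. (d \<omega>)\<^sup>2)" and ed2: "(\<integral>\<omega>. (d \<omega>)\<^sup>2 \<partial>P) = \<mu>\<^sup>2 * h\<^sup>2 + \<sigma>\<^sup>2 * h"
  proof -
    have e: "(d \<omega>)\<^sup>2 = \<mu>\<^sup>2 * h\<^sup>2 - 2 * \<mu> * h * \<sigma> * ?D \<omega> + \<sigma>\<^sup>2 * (?D \<omega>)\<^sup>2" for \<omega>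
      unfolding d_def by (simp add: power2_eq_square algebra_simps)
    note i1' = integrable_mult_right[of "2 * \<mu> * h * \<sigma>" P ?D, OF i1]
    note i2' = integrable_mult_right[of "\<sigma>\<^sup>2" P "\<lambda>\<omega>. (?D \<omega>)\<^sup>2", OF i2]
    note i3' = Bochner_Integration.integrable_diff[OF P.integrable_const i1', of "\<mu>\<^sup>2 * h\<^sup>2"]
    show "integrable P (\<lambda>\<omega>. (d \<omega>)\<^sup>2)" unfolding e
      by (rule Bochner_Integration.integrable_add[OF i3' i2'])
    show "(\<integral>\<omega>. (d \<omega>)\<^sup>2 \<partial>P) = \<mu>\<^sup>2 * h\<^sup>2 + \<sigma>\<^sup>2 * h"
      unfolding e Bochner_Integration.integral_add[OF i3' i2'] Bochner_Integration.integral_diff[OF P.integrable_const i1']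
        integral_mult_right_zero mo
      by (simp add: prob_space)
  qed
  have i4': "integrable P (\<lambda>\<omega>. 8 * (\<mu> ^ 4 * h ^ 4 + \<sigma> ^ 4 * (?D \<omega>) ^ 4))"
    using i4 by (intro integrable_mult_right Bochner_Integration.integrable_add) auto
  have d4: "(d \<omega>) ^ 4 \<le> 8 * (\<mu> ^ 4 * h ^ 4 + \<sigma> ^ 4 * (?D \<omega>) ^ 4)" for \<omega>
    using fourth_power_sum_le[of "- \<mu> * h" "\<sigma> * ?D \<omega>"] unfolding d_def by (simp add: power_mult_distrib)
  have id4: "integrable P (\<lambda>\<omega>. (d \<omega>) ^ 4)"
    by (rule Bochner_Integration.integrable_bound[OF i4']) (use d4 in \<open>auto intro: order_trans\<close>)
  have "(\<integral>\<omega>. (d \<omega>) ^ 4 \<partial>P) \<le> (\<integral>\<omega>. 8 * (\<mu> ^ 4 * h ^ 4 + \<sigma> ^ 4 * (?D \<omega>) ^ 4) \<partial>P)"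
    by (rule integral_mono[OF id4 i4' d4])
  also have "\<dots> = 8 * (\<mu> ^ 4 * h ^ 4 + 3 * \<sigma> ^ 4 * h\<^sup>2)"
    using i4 mo(3) by (simp add: prob_space)
  finally have ed4: "(\<integral>\<omega>. (d \<omega>) ^ 4 \<partial>P) \<le> 8 * (\<mu> ^ 4 * h ^ 4 + 3 * \<sigma> ^ 4 * h\<^sup>2)" .
  let ?R = "\<lambda>\<omega>. U (\<xi> \<omega> + d \<omega>) - U (\<xi> \<omega>) - (w (\<xi> \<omega>) * d \<omega> + v (\<xi> \<omega>) * (d \<omega>)\<^sup>2 / 2)"
  have iR: "integrable P ?R" using iU iq by auto
  have ib: "integrable P (\<lambda>\<omega>. \<eta> / 2 * (d \<omega>)\<^sup>2 + B / \<delta>\<^sup>2 * (d \<omega>) ^ 4)" using id2 id4 by auto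
  have "\<bar>\<integral>\<omega>. ?R \<omega> \<partial>P\<bar> \<le> (\<integral>\<omega>. \<bar>?R \<omega>\<bar> \<partial>P)" by (rule integral_abs_bound)
  also have "\<dots> \<le> (\<integral>\<omega>. \<eta> / 2 * (d \<omega>)\<^sup>2 + B / \<delta>\<^sup>2 * (d \<omega>) ^ 4 \<partial>P)"
  proof (rule integral_mono)
    show "integrable P (\<lambda>\<omega>. \<bar>?R \<omega>\<bar>)" using iR by (rule integrable_abs)
    fix \<omega>
    show "\<bar>?R \<omega>\<bar> \<le> \<eta> / 2 * (d \<omega>)\<^sup>2 + B / \<delta>\<^sup>2 * (d \<omega>) ^ 4"
      using taylor_remainder[OF B(3) \<open>0 < \<delta>\<close> \<eta>, of "\<xi> \<omega>" "d \<omega>"] by (simp add: algebra_simps)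
  qed (rule ib)
  also have "\<dots> = \<eta> / 2 * (\<mu>\<^sup>2 * h\<^sup>2 + \<sigma>\<^sup>2 * h) + B / \<delta>\<^sup>2 * (\<integral>\<omega>. (d \<omega>) ^ 4 \<partial>P)"
    using id2 id4 ed2 by simp
  also have "\<dots> \<le> \<eta> / 2 * (\<mu>\<^sup>2 * h\<^sup>2 + \<sigma>\<^sup>2 * h) + B / \<delta>\<^sup>2 * (8 * (\<mu> ^ 4 * h ^ 4 + 3 * \<sigma> ^ 4 * h\<^sup>2))"
    using B(1)[of 0] by (intro add_left_mono mult_left_mono ed4) auto
  finally have b1: "\<bar>\<integral>\<omega>. ?R \<omega> \<partial>P\<bar> \<le> \<eta> / 2 * (\<mu>\<^sup>2 * h\<^sup>2 + \<sigma>\<^sup>2 * h) + B / \<delta>\<^sup>2 * (8 * (\<mu> ^ 4 * h ^ 4 + 3 * \<sigma> ^ 4 * h\<^sup>2))" .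
  have "(\<integral>\<omega>. ?R \<omega> \<partial>P) = (\<integral>\<omega>. U (\<xi> \<omega> + d \<omega>) - U (\<xi> \<omega>) \<partial>P) - (\<integral>\<omega>. w (\<xi> \<omega>) * d \<omega> + v (\<xi> \<omega>) * (d \<omega>)\<^sup>2 / 2 \<partial>P)"
    using iU iq by (intro Bochner_Integration.integral_diff) auto
  then have "(\<integral>\<omega>. U (\<xi> \<omega> + d \<omega>) - U (\<xi> \<omega>) \<partial>P) - h * (\<integral>\<omega>. gen w v (\<xi> \<omega>) \<partial>P) = (\<integral>\<omega>. ?R \<omega> \<partial>P) + (\<mu>\<^sup>2 * h\<^sup>2 / 2) * (\<integral>\<omega>. v (\<xi> \<omega>) \<partial>P)"
    unfolding eq eg by (simp add: algebra_simps)
  moreover have "\<bar>\<integral>\<omega>. v (\<xi> \<omega>) \<partial>P\<bar> \<le> B"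
  proof -
    have "\<bar>\<integral>\<omega>. v (\<xi> \<omega>) \<partial>P\<bar> \<le> (\<integral>\<omega>. \<bar>v (\<xi> \<omega>)\<bar> \<partial>P)" by (rule integral_abs_bound)
    also have "\<dots> \<le> (\<integral>\<omega>. B \<partial>P)" using iv B(3) by (intro integral_mono) auto
    finally show ?thesis by (simp add: prob_space)
  qed
  then have "\<bar>(\<mu>\<^sup>2 * h\<^sup>2 / 2) * (\<integral>\<omega>. v (\<xi> \<omega>) \<partial>P)\<bar> \<le> \<mu>\<^sup>2 * h\<^sup>2 / 2 * B"
    unfolding abs_mult by (intro mult_mono) auto
  ultimately show ?thesis using b1 unfolding dX by linarith
qed

text \<open>The error is o(h) uniformly in \<open>u\<close> and \<open>\<xi>\<close>, so that its
  sum over all steps of a grid vanishes as the grid is refined.\<close>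

lemma one_step:
  assumes tf: "test_function U w v" and e: "0 < \<epsilon>"
  shows "\<exists>h0>0. \<forall>h u (\<xi> :: 'a \<Rightarrow> real). 0 < h \<longrightarrow> h < h0 \<longrightarrow> 0 \<le> u \<longrightarrow> \<xi> \<in> borel_measurable (\<H> u) \<longrightarrow>
    \<bar>(\<integral>\<omega>. U (\<xi> \<omega> + (X0 (u + h) \<omega> - X0 u \<omega>)) - U (\<xi> \<omega>) \<partial>P) - h * (\<integral>\<omega>. gen w v (\<xi> \<omega>) \<partial>P)\<bar> \<le> \<epsilon> * h"
proof -
  interpret test_function U w v by fact
  obtain B where B: "\<And>x. \<bar>U x\<bar> \<le> B" "\<And>x. \<bar>w x\<bar> \<le> B" "\<And>x. \<bar>v x\<bar> \<le> B" "0 < B" using ex_bound by blast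
  \<comment> \<open>With this choice the part of the error that is linear in \<open>h\<close> is
    \<open>\<epsilon> * h / 2\<close>; the other half is left for the higher orders.\<close>
  define \<eta> where "\<eta> = \<epsilon> / \<sigma>\<^sup>2"
  have "\<eta> > 0" using e sigma_pos by (simp add: \<eta>_def)
  then obtain \<delta> where \<delta>: "\<delta> > 0" "\<And>x y. \<bar>x - y\<bar> < \<delta> \<Longrightarrow> \<bar>v x - v y\<bar> \<le> \<eta>"
    using v_unif unfolding uniformly_continuous_on_def dist_real_def by (metis UNIV_I less_imp_le abs_minus_commute)
  \<comment> \<open>The bound of \<open>one_step_bound\<close> divided by \<open>h\<close>.\<close>
  let ?e = "\<lambda>h. \<eta> / 2 * (\<mu>\<^sup>2 * h + \<sigma>\<^sup>2) + B / \<delta>\<^sup>2 * (8 * (\<mu> ^ 4 * h ^ 3 + 3 * \<sigma> ^ 4 * h)) + \<mu>\<^sup>2 * h / 2 * B"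
  have "(?e \<longlongrightarrow> ?e 0) (at_right 0)"
    using \<delta>(1) by (intro tendsto_intros) auto
  moreover have "?e 0 < \<epsilon>" using sigma_pos e by (simp add: \<eta>_def)
  ultimately have "eventually (\<lambda>h. ?e h < \<epsilon>) (at_right 0)" by (rule order_tendstoD)
  then obtain h0 where h0: "h0 > 0" "\<And>h. 0 < h \<Longrightarrow> h < h0 \<Longrightarrow> ?e h < \<epsilon>"
    unfolding eventually_at_right_field by auto
  show ?thesis
  proof (intro exI[of _ h0] conjI allI impI h0(1))
    fix h u :: real and \<xi> :: "'a \<Rightarrow> real" assume h: "0 < h" "h < h0" "0 \<le> u" "\<xi> \<in> borel_measurable (\<H> u)"
    have "?e h * h \<le> \<epsilon> * h" using h0(2)[OF h(1,2)] h(1) by (intro mult_right_mono) auto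
    moreover have "?e h * h = \<eta> / 2 * (\<mu>\<^sup>2 * h\<^sup>2 + \<sigma>\<^sup>2 * h) + B / \<delta>\<^sup>2 * (8 * (\<mu> ^ 4 * h ^ 4 + 3 * \<sigma> ^ 4 * h\<^sup>2)) + \<mu>\<^sup>2 * h\<^sup>2 / 2 * B"
      by (simp add: algebra_simps power2_eq_square power4_eq_xxxx power3_eq_cube)
    moreover have "\<bar>(\<integral>\<omega>. U (\<xi> \<omega> + (X0 (u + h) \<omega> - X0 u \<omega>)) - U (\<xi> \<omega>) \<partial>P) - h * (\<integral>\<omega>. gen w v (\<xi> \<omega>) \<partial>P)\<bar>
      \<le> \<eta> / 2 * (\<mu>\<^sup>2 * h\<^sup>2 + \<sigma>\<^sup>2 * h) + B / \<delta>\<^sup>2 * (8 * (\<mu> ^ 4 * h ^ 4 + 3 * \<sigma> ^ 4 * h\<^sup>2)) + \<mu>\<^sup>2 * h\<^sup>2 / 2 * B"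
      by (rule one_step_bound[OF tf]) (use B \<delta> h in auto)
    ultimately show "\<bar>(\<integral>\<omega>. U (\<xi> \<omega> + (X0 (u + h) \<omega> - X0 u \<omega>)) - U (\<xi> \<omega>) \<partial>P) - h * (\<integral>\<omega>. gen w v (\<xi> \<omega>) \<partial>P)\<bar> \<le> \<epsilon> * h"
      by linarith
  qed
qed

end

section \<open>A discretized Ito formula\<close>

lemma finite_downclosed_nat:
  assumes "finite A" and "\<And>k. Suc k \<in> A \<Longrightarrow> k \<in> A"
  shows "A = {..<card A}"
proof -
  have dc: "j \<in> A" if "k \<in> A" "j \<le> k" for j k
    using that(2,1) by (induction rule: inc_induct) (use assms(2) in auto)
  define m where "m = (LEAST k. k \<notin> A)"
  have "\<exists>k. k \<notin> A" using assms(1) infinite_UNIV_nat by (metis UNIV_eq_I)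
  then have m: "m \<notin> A" unfolding m_def by (rule LeastI_ex)
  have "k \<in> A" if "k < m" for k using not_less_Least that unfolding m_def by blast
  then have "A = {..<m}" using m dc by (auto simp: not_less[symmetric])
  then show ?thesis by simp
qed

text \<open>A Riemann sum written as the integral of a step function becomes accessible to dominated
  convergence.\<close>

lemma step_function_integral:
  fixes \<phi> :: "nat \<Rightarrow> real"
  assumes t: "0 < t" and n: "0 < n"
  shows "has_bochner_integral lborel (\<lambda>s. indicator {0..<t} s * \<phi> (nat \<lfloor>s * real n / t\<rfloor>)) (\<Sum>i<n. t / real n * \<phi> i)"
proof -
  have eq: "indicator {0..<t} s * \<phi> (nat \<lfloor>s * real n / t\<rfloor>) =
      (\<Sum>i<n. \<phi> i * indicator {real i * t / real n..<(real i + 1) * t / real n} s)" for s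
  proof -
    have ind: "s \<in> {real i * t / real n..<(real i + 1) * t / real n} \<longleftrightarrow> 0 \<le> s \<and> nat \<lfloor>s * real n / t\<rfloor> = i" for i
    proof -
      have "s \<in> {real i * t / real n..<(real i + 1) * t / real n} \<longleftrightarrow> real i \<le> s * real n / t \<and> s * real n / t < real i + 1"
        using t n by (auto simp: field_simps)
      also have "\<dots> \<longleftrightarrow> \<lfloor>s * real n / t\<rfloor> = int i" by (simp add: floor_eq_iff)
      also have "\<dots> \<longleftrightarrow> 0 \<le> s \<and> nat \<lfloor>s * real n / t\<rfloor> = i"
      proof -
        have "0 \<le> \<lfloor>s * real n / t\<rfloor> \<longleftrightarrow> 0 \<le> s" using t n by (simp add: zero_le_divide_iff zero_le_mult_iff)
        then show ?thesis by (metis int_nat_eq nat_int of_nat_0_le_iff)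
      qed
      finally show ?thesis .
    qed
    have lt: "nat \<lfloor>s * real n / t\<rfloor> < n \<longleftrightarrow> s < t" if "0 \<le> s"
    proof -
      have "0 \<le> s * real n / t" using t that by simp
      then have "nat \<lfloor>s * real n / t\<rfloor> < n \<longleftrightarrow> s * real n / t < real n" by (metis floor_less_iff nat_less_iff of_int_of_nat_eq zero_le_floor)
      also have "\<dots> \<longleftrightarrow> s < t" using t n by (simp add: field_simps)
      finally show ?thesis .
    qed
    show ?thesis
    proof (cases "0 \<le> s")
      case True
      have "(\<Sum>i<n. \<phi> i * indicator {real i * t / real n..<(real i + 1) * t / real n} s) =
        (\<Sum>i<n. if nat \<lfloor>s * real n / t\<rfloor> = i then \<phi> i else 0)"
        by (rule sum.cong) (use ind True in \<open>auto simp: indicator_def\<close>)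
      then show ?thesis using lt True by (simp add: sum.delta' indicator_def)
    next
      case False
      then have "indicator {real i * t / real n..<(real i + 1) * t / real n} s = (0::real)" for i
        using ind by (simp add: indicator_def)
      then show ?thesis using False by simp
    qed
  qed
  have "has_bochner_integral lborel (\<lambda>s. \<phi> i * indicator {real i * t / real n..<(real i + 1) * t / real n} s) (t / real n * \<phi> i)" for i
  proof -
    have "real i * t / real n \<le> (real i + 1) * t / real n" using t n by (simp add: field_simps)
    then have "has_bochner_integral lborel (indicator {real i * t / real n..<(real i + 1) * t / real n}) ((real i + 1) * t / real n - real i * t / real n :: real)"
      using has_bochner_integral_real_indicator[of "{real i * t / real n..<(real i + 1) * t / real n}" lborel] by (simp add: measure_def)
    moreover have "\<phi> i * ((real i + 1) * t / real n - real i * t / real n) = t / real n * \<phi> i"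
      using n by (simp add: field_simps)
    ultimately show ?thesis using has_bochner_integral_mult_right[of "\<phi> i" lborel] by metis
  qed
  then show ?thesis unfolding eq by (intro has_bochner_integral_sum) auto
qed

lemma integral_indicator_const:
  assumes "0 \<le> t"
  shows "integrable lborel (\<lambda>s. indicator {0..<t} s * (l::real))"
    and "(\<integral>s. indicator {0..<t} s * l \<partial>lborel) = l * t"
proof -
  have "has_bochner_integral lborel (\<lambda>s. l * indicator {0..<t} s) (l * t)"
    using has_bochner_integral_mult_right[OF has_bochner_integral_real_indicator[of "{0..<t}" lborel], of l] assms
    by (simp add: measure_def)
  then show "integrable lborel (\<lambda>s. indicator {0..<t} s * l)" "(\<integral>s. indicator {0..<t} s * l \<partial>lborel) = l * t"
    by (auto simp: has_bochner_integral_iff mult.commute)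
qed

lemma tendsto_floor_grid:
  fixes t :: real assumes t: "0 < t"
  shows "(\<lambda>n. real (nat \<lfloor>s * real (Suc n) / t\<rfloor>) * t / real (Suc n)) \<longlonglongrightarrow> max 0 s"
proof (rule tendsto_sandwich[OF always_eventually always_eventually, rule_format])
  fix n
  let ?x = "s * real (Suc n) / t"
  have "real (nat \<lfloor>?x\<rfloor>) \<le> max 0 ?x" "max 0 ?x - 1 \<le> real (nat \<lfloor>?x\<rfloor>)" by linarith+
  moreover have "max 0 ?x = max 0 s * real (Suc n) / t"
    using t by (auto simp: max_def zero_le_mult_iff zero_le_divide_iff)
  ultimately have *: "real (nat \<lfloor>?x\<rfloor>) \<le> max 0 s * real (Suc n) / t" "max 0 s * real (Suc n) / t - 1 \<le> real (nat \<lfloor>?x\<rfloor>)" by auto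
  have grid: "a \<le> b * m / t \<Longrightarrow> a * t / m \<le> b" "b * m / t - 1 \<le> a \<Longrightarrow> b - t / m \<le> a * t / m" if "0 < m" for a b m :: real
  proof -
    show "a \<le> b * m / t \<Longrightarrow> a * t / m \<le> b" using t that by (simp add: field_simps)
    have "(b * m / t - 1) * (t / m) = b - t / m" using t that by (simp add: field_simps)
    then show "b * m / t - 1 \<le> a \<Longrightarrow> b - t / m \<le> a * t / m"
      using mult_right_mono[of "b * m / t - 1" a "t / m"] t that by simp
  qed
  show "real (nat \<lfloor>?x\<rfloor>) * t / real (Suc n) \<le> max 0 s" using *(1) by (intro grid) auto
  show "max 0 s - t / real (Suc n) \<le> real (nat \<lfloor>?x\<rfloor>) * t / real (Suc n)" using *(2) by (intro grid) auto
next
  have "(\<lambda>n. max 0 s - t / real (Suc n)) \<longlonglongrightarrow> max 0 s - 0" by (intro tendsto_intros LIMSEQ_Suc lim_const_over_n)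
  then show "(\<lambda>n. max 0 s - t / real (Suc n)) \<longlonglongrightarrow> max 0 s" by simp
qed simp

lemma tendsto_ceiling_grid:
  fixes t :: real assumes t: "0 < t" and s: "0 \<le> s"
  shows "(\<lambda>n. real (nat \<lceil>s * real (Suc n) / t\<rceil>) * t / real (Suc n)) \<longlonglongrightarrow> s"
proof (rule tendsto_sandwich[OF always_eventually always_eventually, rule_format])
  fix n
  let ?x = "s * real (Suc n) / t"
  have "0 \<le> ?x" using t s by simp
  then have *: "?x \<le> real (nat \<lceil>?x\<rceil>)" "real (nat \<lceil>?x\<rceil>) \<le> ?x + 1" by linarith+
  have grid: "b * m / t \<le> a \<Longrightarrow> b \<le> a * t / m" "a \<le> b * m / t + 1 \<Longrightarrow> a * t / m \<le> b + t / m" if "0 < m" for a b m :: real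
    using t that by (simp_all add: field_simps)
  show "s \<le> real (nat \<lceil>?x\<rceil>) * t / real (Suc n)" using *(1) by (intro grid) auto
  show "real (nat \<lceil>?x\<rceil>) * t / real (Suc n) \<le> s + t / real (Suc n)" using *(2) by (intro grid) auto
next
  have "(\<lambda>n. s + t / real (Suc n)) \<longlonglongrightarrow> s + 0" by (intro tendsto_intros LIMSEQ_Suc lim_const_over_n)
  then show "(\<lambda>n. s + t / real (Suc n)) \<longlonglongrightarrow> s" by simp
qed simp

text \<open>A stopping time of the right-continuous filtration need not be one for the completed
  history, but its events at time \<open>s\<close> belong to the history at every later
  \<open>u\<close>. Only this is demanded of the order times, so they may also be changed to
  \<infinity> on a null set or from some index on. Index 0 is the first order here.\<close>

locale ordering = drifted_brownian_motion M W \<mu> \<sigma> x0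
  for M :: "'a measure" and W :: "real \<Rightarrow> 'a \<Rightarrow> real" and \<mu> \<sigma> x0 :: real +
  fixes T :: "nat \<Rightarrow> 'a \<Rightarrow> ennreal" and Q :: "nat \<Rightarrow> 'a \<Rightarrow> real"
  assumes T_mono: "\<And>k \<omega>. \<omega> \<in> space M \<Longrightarrow> T k \<omega> \<le> T (Suc k) \<omega>"
    and T_adapted: "\<And>k s u. 0 \<le> s \<Longrightarrow> s < u \<Longrightarrow> {\<omega>\<in>space M. T k \<omega> \<le> ennreal s} \<in> sets (\<H> u)"
    and Q_adapted: "\<And>k s u. 0 \<le> s \<Longrightarrow> s < u \<Longrightarrow>
      (\<lambda>\<omega>. if T k \<omega> \<le> ennreal s then Q k \<omega> else 0) \<in> borel_measurable (\<H> u)"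
begin

text \<open>Orders are counted strictly before \<open>t\<close>, in agreement with
  \<open>Zl\<close>, the quantity ordered up to the left limit.\<close>

definition "N t \<omega> = card {k. T k \<omega> < ennreal t}"
definition "Z s \<omega> = (\<Sum>k\<in>{k. T k \<omega> \<le> ennreal s}. Q k \<omega>)"
definition "Zl s \<omega> = (\<Sum>k\<in>{k. T k \<omega> < ennreal s}. Q k \<omega>)"
definition "S k \<omega> = (\<Sum>j<k. Q j \<omega>)"
text \<open>Simultaneous orders are applied one after another in the order of their indices, so that
  jumps telescope. The value at an infinite order time is meaningless and never summed.\<close>

definition "jump U k \<omega> = (let x = X0 (enn2real (T k \<omega>)) \<omega> in U (x + S (Suc k) \<omega>) - U (x + S k \<omega>) :: real)"

lemma less_iff:
  assumes om: "\<omega> \<in> space M" and fin: "finite {k. T k \<omega> < ennreal t}"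
  shows "T k \<omega> < ennreal t \<longleftrightarrow> k < N t \<omega>"
proof -
  have "{k. T k \<omega> < ennreal t} = {..<N t \<omega>}"
    unfolding N_def by (rule finite_downclosed_nat[OF fin]) (use T_mono[OF om] in \<open>auto intro: order_le_less_trans\<close>)
  then show ?thesis by auto
qed

lemma Z_eq:
  assumes om: "\<omega> \<in> space M" and fin: "finite {k. T k \<omega> < ennreal t}" and s: "0 \<le> s" "s < t"
  shows "Z s \<omega> = (\<Sum>k<N t \<omega>. if T k \<omega> \<le> ennreal s then Q k \<omega> else 0)"
    and "\<exists>c\<le>N t \<omega>. Z s \<omega> = S c \<omega> \<and> (\<forall>k. T k \<omega> \<le> ennreal s \<longleftrightarrow> k < c)"
proof -
  have st: "ennreal s < ennreal t" using s by (simp add: ennreal_less_iff)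
  have sub: "{k. T k \<omega> \<le> ennreal s} \<subseteq> {..<N t \<omega>}"
    using less_iff[OF om fin] st by (auto intro: order_le_less_trans)
  show "Z s \<omega> = (\<Sum>k<N t \<omega>. if T k \<omega> \<le> ennreal s then Q k \<omega> else 0)"
    unfolding Z_def using sub by (subst sum.inter_filter[symmetric]) (auto intro!: sum.cong)
  have "{k. T k \<omega> \<le> ennreal s} = {..<card {k. T k \<omega> \<le> ennreal s}}"
    by (rule finite_downclosed_nat) (use finite_subset[OF sub] T_mono[OF om] in \<open>auto intro: order_trans\<close>)
  then obtain c where c: "{k. T k \<omega> \<le> ennreal s} = {..<c}" by blast
  then have "c \<le> N t \<omega>" using sub by auto
  then show "\<exists>c\<le>N t \<omega>. Z s \<omega> = S c \<omega> \<and> (\<forall>k. T k \<omega> \<le> ennreal s \<longleftrightarrow> k < c)"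
    using c unfolding Z_def S_def by (intro exI[of _ c]) auto
qed

lemma Zl_eq:
  assumes "\<omega> \<in> space M" and "finite {k. T k \<omega> < ennreal t}"
  shows "Zl t \<omega> = S (N t \<omega>) \<omega>"
  unfolding Zl_def S_def using less_iff[OF assms] by (intro sum.cong) auto

text \<open>The index range of the sum depends on the path. Sums over fixed ranges are measurable
  and eventually constant on each path.\<close>

lemma Z_measurable:
  assumes fin: "\<And>\<omega>. \<omega> \<in> space M \<Longrightarrow> finite {k. T k \<omega> < ennreal t}" and s: "0 \<le> s" "s < t" "s < u"
  shows "Z s \<in> borel_measurable (\<H> u)"
proof (rule borel_measurable_LIMSEQ_real)
  show "(\<lambda>\<omega>. \<Sum>k<n. if T k \<omega> \<le> ennreal s then Q k \<omega> else 0) \<in> borel_measurable (\<H> u)" for n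
    using Q_adapted[OF s(1,3)] by (intro borel_measurable_sum) auto
  fix \<omega> assume "\<omega> \<in> space (\<H> u)"
  then have om: "\<omega> \<in> space M" by simp
  obtain c where c: "Z s \<omega> = S c \<omega>" "\<And>k. T k \<omega> \<le> ennreal s \<longleftrightarrow> k < c"
    using Z_eq(2)[OF om fin[OF om] s(1,2)] by blast
  have "(\<Sum>k<n. if T k \<omega> \<le> ennreal s then Q k \<omega> else 0) = Z s \<omega>" if "c \<le> n" for n
    unfolding c(1) S_def c(2) using that by (subst sum.inter_filter[symmetric]) (auto intro!: sum.cong)
  then show "(\<lambda>n. \<Sum>k<n. if T k \<omega> \<le> ennreal s then Q k \<omega> else 0) \<longlonglongrightarrow> Z s \<omega>"
    by (intro tendsto_eventually) (auto simp: eventually_sequentially)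
qed

lemma gen_continuous_bounded:
  assumes tf: "test_function U w v"
  shows "continuous_on UNIV (gen w v)" and "\<exists>A. \<forall>x. \<bar>gen w v x\<bar> \<le> A"
proof -
  interpret test_function U w v by fact
  obtain B where B: "\<And>x. \<bar>U x\<bar> \<le> B" "\<And>x. \<bar>w x\<bar> \<le> B" "\<And>x. \<bar>v x\<bar> \<le> B" "0 < B" using ex_bound by blast
  show "continuous_on UNIV (gen w v)" unfolding gen_def[abs_def] using continuous_w continuous_v by (intro continuous_intros) auto
  have "\<bar>gen w v x\<bar> \<le> \<sigma>\<^sup>2 / 2 * B + \<mu> * B" for x
  proof -
    have "\<bar>\<sigma>\<^sup>2 / 2 * v x\<bar> \<le> \<sigma>\<^sup>2 / 2 * B" "\<bar>\<mu> * w x\<bar> \<le> \<mu> * B"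
      using B mu_pos by (auto simp: abs_mult intro!: mult_left_mono)
    then show ?thesis unfolding gen_def by linarith
  qed
  then show "\<exists>A. \<forall>x. \<bar>gen w v x\<bar> \<le> A" by blast
qed

lemma T_real:
  assumes om: "\<omega> \<in> space M" and fin: "finite {k. T k \<omega> < ennreal t}" and k: "k < N t \<omega>"
  shows "T k \<omega> = ennreal (enn2real (T k \<omega>))" "0 \<le> enn2real (T k \<omega>)" "enn2real (T k \<omega>) < t"
proof -
  have lt: "T k \<omega> < ennreal t" using less_iff[OF om fin] k by blast
  then show "T k \<omega> = ennreal (enn2real (T k \<omega>))" by (metis ennreal_enn2real ennreal_less_top order_less_trans)
  then show "enn2real (T k \<omega>) < t" using lt by (metis ennreal_less_iff enn2real_nonneg)
  show "0 \<le> enn2real (T k \<omega>)" by simp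
qed

lemma path_measurable:
  fixes a :: "real \<Rightarrow> real"
  assumes a [measurable]: "a \<in> borel_measurable borel" and om: "\<omega> \<in> space M" and fin: "finite {k. T k \<omega> < ennreal t}"
  shows "(\<lambda>s. indicator {0..<t} s * a (X0 s \<omega> + Z s \<omega>)) \<in> borel_measurable lborel"
proof -
  note Tr = T_real[OF om fin]
    have "continuous_on {0..<t} (\<lambda>s. X0 s \<omega>)" by (rule continuous_on_subset[OF X0_continuous[OF om]]) auto
    \<comment> \<open>The path is only known to be continuous on \<open>{0..}\<close>; multiplying
      by the indicator gives a function measurable on the whole line.\<close>
    then have c [measurable]: "(\<lambda>s. indicator {0..<t} s *\<^sub>R X0 s \<omega>) \<in> borel_measurable borel"
      by (intro borel_measurable_continuous_on_indicator) auto
    have "(\<lambda>s. indicator {0..<t} s * a (indicator {0..<t} s *\<^sub>R X0 s \<omega> + (\<Sum>k<N t \<omega>. if enn2real (T k \<omega>) \<le> s then Q k \<omega> else 0))) \<in> borel_measurable lborel"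
      by measurable
    moreover have "indicator {0..<t} s * a (indicator {0..<t} s *\<^sub>R X0 s \<omega> + (\<Sum>k<N t \<omega>. if enn2real (T k \<omega>) \<le> s then Q k \<omega> else 0))
       = indicator {0..<t} s * a (X0 s \<omega> + Z s \<omega>)" for s
    proof (cases "s \<in> {0..<t}")
      case True
      have "Z s \<omega> = (\<Sum>k<N t \<omega>. if enn2real (T k \<omega>) \<le> s then Q k \<omega> else 0)"
      proof -
        have "Z s \<omega> = (\<Sum>k<N t \<omega>. if T k \<omega> \<le> ennreal s then Q k \<omega> else 0)"
          using True by (intro Z_eq(1)[OF om fin]) auto
        also have "\<dots> = (\<Sum>k<N t \<omega>. if enn2real (T k \<omega>) \<le> s then Q k \<omega> else 0)"
        proof (rule sum.cong[OF refl])
          fix k assume "k \<in> {..<N t \<omega>}"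
          then have "T k \<omega> \<le> ennreal s \<longleftrightarrow> enn2real (T k \<omega>) \<le> s"
            using Tr(1)[of k] True by (metis ennreal_le_iff atLeastLessThan_iff lessThan_iff)
          then show "(if T k \<omega> \<le> ennreal s then Q k \<omega> else 0) = (if enn2real (T k \<omega>) \<le> s then Q k \<omega> else 0)" by simp
        qed
        finally show ?thesis .
      qed
      then show ?thesis using True by simp
    qed simp
    ultimately show ?thesis by (simp only:)
  qed

lemma path_integrable:
  assumes tf: "test_function U w v" and om: "\<omega> \<in> space M" and fin: "finite {k. T k \<omega> < ennreal t}"
  shows "integrable lborel (\<lambda>s. indicator {0..<t} s * gen w v (X0 s \<omega> + Z s \<omega>))"
proof -
  have [measurable]: "gen w v \<in> borel_measurable borel"
    using gen_continuous_bounded(1)[OF tf] by (rule borel_measurable_continuous_onI)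
  obtain A where A: "\<And>x. \<bar>gen w v x\<bar> \<le> A" using gen_continuous_bounded(2)[OF tf] by blast
  have meas: "(\<lambda>s. indicator {0..<t} s * gen w v (X0 s \<omega> + Z s \<omega>)) \<in> borel_measurable lborel"
    by (rule path_measurable[OF _ om fin]) measurable
  have "emeasure lborel {0..<t} < \<infinity>" by (cases "0 \<le> t") auto
  then have "integrable lborel (\<lambda>s. A * indicator {0..<t} s)" by (intro integrable_mult_right integrable_real_indicator) auto
  then show ?thesis
    by (rule Bochner_Integration.integrable_bound[OF _ meas]) (auto simp: indicator_def intro: order_trans[OF A abs_ge_self])
qed

text \<open>Along the grid the change of \<open>U\<close> splits into moves of \<open>X0\<close>
  with frozen orders (\<open>D\<close>) and order updates with frozen \<open>X0\<close>
  (\<open>Jn\<close>). By \<open>one_step\<close> the expected moves differ from the Riemann sum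
  \<open>In\<close> of the generator by a vanishing amount. The sums converge path by path, and the
  bounds \<open>2 * B * N t\<close>, \<open>t * A\<close> and \<open>B\<close> allow dominated
  convergence.\<close>

lemma ito:
  assumes tf: "test_function U w v" and t: "0 < t"
    and fin: "\<And>\<omega>. \<omega> \<in> space M \<Longrightarrow> finite {k. T k \<omega> < ennreal t}"
    and Nint: "integrable P (\<lambda>\<omega>. real (N t \<omega>))"
  shows "integrable P (\<lambda>\<omega>. \<integral>s. indicator {0..<t} s * gen w v (X0 s \<omega> + Z s \<omega>) \<partial>lborel)" (is "integrable P ?I")
    and "integrable P (\<lambda>\<omega>. \<Sum>k<N t \<omega>. jump U k \<omega>)" (is "integrable P ?J")
    and "integrable P (\<lambda>\<omega>. U (X0 t \<omega> + Zl t \<omega>))"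
    and "(\<integral>\<omega>. U (X0 t \<omega> + Zl t \<omega>) \<partial>P) = U x0 +
      (\<integral>\<omega>. (\<integral>s. indicator {0..<t} s * gen w v (X0 s \<omega> + Z s \<omega>) \<partial>lborel) \<partial>P) + (\<integral>\<omega>. (\<Sum>k<N t \<omega>. jump U k \<omega>) \<partial>P)"
proof -
  interpret test_function U w v by fact
  obtain B where B: "\<And>x. \<bar>U x\<bar> \<le> B" "\<And>x. \<bar>w x\<bar> \<le> B" "\<And>x. \<bar>v x\<bar> \<le> B" "0 < B" using ex_bound by blast
  let ?a = "gen w v"
  have a_cont: "continuous_on UNIV ?a" using gen_continuous_bounded(1)[OF tf] .
  then have a_meas [measurable]: "?a \<in> borel_measurable borel" by (rule borel_measurable_continuous_onI)
  obtain A where a_bound: "\<And>x. \<bar>?a x\<bar> \<le> A" using gen_continuous_bounded(2)[OF tf] by blast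
  define h where "h n = t / real (Suc n)" for n
  have h0: "0 < h n" for n using t by (simp add: h_def)
  have hn: "real (Suc n) * h n = t" for n by (simp add: h_def)
  txt \<open>The grid process counts the orders one grid step late. This makes it adapted to the completed
    history itself, so that the right limits in the augmented filtration never enter.\<close>
  define Zm where "Zm n i \<omega> = (if i = 0 then 0 else Z ((real i - 1) * h n) \<omega>)" for n i \<omega>
  define \<xi> where "\<xi> n i \<omega> = X0 (real i * h n) \<omega> + Zm n i \<omega>" for n i \<omega>
  have lt: "(real i - 1) * h n < t" if "i \<le> Suc n" for i n
  proof -
    have "(real i - 1) * h n < real (Suc n) * h n" using that h0[of n] by (intro mult_strict_right_mono) auto
    then show ?thesis by (simp only: hn)
  qed
  have Zm_meas: "Zm n i \<in> borel_measurable (\<H> (real i * h n))" if "i \<le> Suc n" for n i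
  proof (cases "i = 0")
    case True then show ?thesis by (simp add: Zm_def[abs_def])
  next
    case False
    then have "Z ((real i - 1) * h n) \<in> borel_measurable (\<H> (real i * h n))"
      using h0[of n] lt[OF that] by (intro Z_measurable[OF fin]) auto
    then show ?thesis using False by (simp add: Zm_def[abs_def])
  qed
  have \<xi>_meas: "\<xi> n i \<in> borel_measurable (\<H> (real i * h n))" if "i \<le> Suc n" for n i
    unfolding \<xi>_def[abs_def] using Zm_meas[OF that] h0[of n]
    by (intro borel_measurable_add measurable_completed_history) (auto intro: less_imp_le)
  have X0_P: "X0 s \<in> borel_measurable P" if "0 \<le> s" for s
    using X0_measurable_M[OF that] by (rule measurable_completion)
  have Zm_P: "Zm n i \<in> borel_measurable P" if "i \<le> Suc n" for n i
    by (rule measurable_completed_history_P[OF Zm_meas[OF that]])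
  \<comment> \<open>The update is taken at the right end point of the step, after the move of
    \<open>X0\<close>.\<close>
  define Jn where "Jn n \<omega> = (\<Sum>i<Suc n. U (X0 (real (Suc i) * h n) \<omega> + Zm n (Suc i) \<omega>) - U (X0 (real (Suc i) * h n) \<omega> + Zm n i \<omega>))" for n \<omega>
  define In where "In n \<omega> = (\<Sum>i<Suc n. h n * ?a (\<xi> n i \<omega>))" for n \<omega>
  have Jn_P: "Jn n \<in> borel_measurable P" for n
    unfolding Jn_def[abs_def]
  proof (intro borel_measurable_sum borel_measurable_diff)
    fix i assume i: "i \<in> {..<Suc n}"
    show "(\<lambda>\<omega>. U (X0 (real (Suc i) * h n) \<omega> + Zm n (Suc i) \<omega>)) \<in> borel_measurable P"
      "(\<lambda>\<omega>. U (X0 (real (Suc i) * h n) \<omega> + Zm n i \<omega>)) \<in> borel_measurable P"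
      using i h0[of n] by (auto intro!: measurable_compose[OF _ measurable_U] borel_measurable_add X0_P Zm_P)
  qed
  have In_P: "In n \<in> borel_measurable P" for n
    unfolding In_def[abs_def]
    by (intro borel_measurable_sum borel_measurable_times measurable_compose[OF _ a_meas] measurable_completed_history_P[OF \<xi>_meas]) auto

  txt \<open>\<open>gr n k\<close> is the index of the first grid point at or after the time of order \<open>k\<close>; the order
    enters \<open>Zm n\<close> from index \<open>gr n k + 1\<close> on.\<close>
  define gr where "gr n k \<omega> = nat \<lceil>enn2real (T k \<omega>) * real (Suc n) / t\<rceil>" for n k \<omega>
  have Tr: "T k \<omega> = ennreal (enn2real (T k \<omega>))" "0 \<le> enn2real (T k \<omega>)" "enn2real (T k \<omega>) < t"
    if "\<omega> \<in> space M" "k < N t \<omega>" for k \<omega>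
    using T_real[OF that(1) fin[OF that(1)] that(2)] by blast+
  have mem: "T k \<omega> \<le> ennreal (real i * h n) \<longleftrightarrow> gr n k \<omega> \<le> i" if "\<omega> \<in> space M" "k < N t \<omega>" for n k i \<omega>
  proof -
    have "T k \<omega> \<le> ennreal (real i * h n) \<longleftrightarrow> enn2real (T k \<omega>) \<le> real i * h n"
      using Tr[OF that] h0[of n] by (metis ennreal_le_iff mult_nonneg_nonneg of_nat_0_le_iff less_imp_le)
    also have "\<dots> \<longleftrightarrow> enn2real (T k \<omega>) * real (Suc n) / t \<le> real i"
      unfolding h_def using t by (simp add: field_simps del: of_nat_Suc)
    also have "\<dots> \<longleftrightarrow> gr n k \<omega> \<le> i" unfolding gr_def by (simp add: nat_ceiling_le_eq)
    finally show ?thesis .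
  qed
  let ?\<phi> = "\<lambda>x k \<omega>. U (x + S (Suc k) \<omega>) - U (x + S k \<omega>)"
  \<comment> \<open>The effect of all orders counted so far is a telescoping sum at an arbitrary
    position \<open>x\<close>. Applied to two successive indices at the same \<open>x\<close>, it
    isolates the orders entering in between.\<close>
  have Usum: "U (x + Zm n i \<omega>) - U x = (\<Sum>k<N t \<omega>. if gr n k \<omega> < i then ?\<phi> x k \<omega> else 0)"
    if om: "\<omega> \<in> space M" and i: "i \<le> Suc n" for x n i \<omega>
  proof (cases "i = 0")
    case True then show ?thesis by (simp add: Zm_def)
  next
    case False
    then obtain j where j: "i = Suc j" by (cases i) auto
    have jl: "real j * h n < t" using lt[OF i] j by simp
    have "0 \<le> real j * h n" using h0[of n] by simp
    from Z_eq(2)[OF om fin[OF om] this jl] obtain c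
      where c: "c \<le> N t \<omega>" "Z (real j * h n) \<omega> = S c \<omega>" "\<And>k. T k \<omega> \<le> ennreal (real j * h n) \<longleftrightarrow> k < c" by blast
    have "(\<Sum>k<N t \<omega>. if gr n k \<omega> < i then ?\<phi> x k \<omega> else 0) = (\<Sum>k<N t \<omega>. if k < c then ?\<phi> x k \<omega> else 0)"
      by (rule sum.cong) (use mem[OF om, of _ j n] c(3) j in \<open>auto simp: less_Suc_eq_le\<close>)
    also have "\<dots> = (\<Sum>k<c. ?\<phi> x k \<omega>)"
      using c(1) by (subst sum.inter_filter[symmetric]) (auto intro!: sum.cong)
    also have "\<dots> = U (x + S c \<omega>) - U (x + S 0 \<omega>)" by (rule sum_lessThan_telescope)
    also have "\<dots> = U (x + Zm n i \<omega>) - U x" using c(2) j by (simp add: Zm_def S_def)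
    finally show ?thesis by simp
  qed
  have Jn_eq: "Jn n \<omega> = (\<Sum>k<N t \<omega>. if gr n k \<omega> < Suc n then ?\<phi> (X0 (real (Suc (gr n k \<omega>)) * h n) \<omega>) k \<omega> else 0)"
    if om: "\<omega> \<in> space M" for n \<omega>
  proof -
    have "Jn n \<omega> = (\<Sum>i<Suc n. \<Sum>k<N t \<omega>. if gr n k \<omega> = i then ?\<phi> (X0 (real (Suc i) * h n) \<omega>) k \<omega> else 0)"
      unfolding Jn_def
    proof (rule sum.cong[OF refl])
      fix i assume i: "i \<in> {..<Suc n}"
      let ?x = "X0 (real (Suc i) * h n) \<omega>"
      have "U (?x + Zm n (Suc i) \<omega>) - U (?x + Zm n i \<omega>) =
        (U (?x + Zm n (Suc i) \<omega>) - U ?x) - (U (?x + Zm n i \<omega>) - U ?x)" by simp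
      also have "\<dots> = (\<Sum>k<N t \<omega>. if gr n k \<omega> < Suc i then ?\<phi> ?x k \<omega> else 0) - (\<Sum>k<N t \<omega>. if gr n k \<omega> < i then ?\<phi> ?x k \<omega> else 0)"
        using i by (intro arg_cong2[where f="(-)"] Usum[OF om]) auto
      also have "\<dots> = (\<Sum>k<N t \<omega>. if gr n k \<omega> = i then ?\<phi> ?x k \<omega> else 0)"
        unfolding sum_subtractf[symmetric] by (rule sum.cong) auto
      finally show "U (?x + Zm n (Suc i) \<omega>) - U (?x + Zm n i \<omega>) = (\<Sum>k<N t \<omega>. if gr n k \<omega> = i then ?\<phi> ?x k \<omega> else 0)" .
    qed
    \<comment> \<open>After exchanging the sums every order contributes once, at the step
      \<open>i = gr n k\<close>, as an approximation of its jump.\<close>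
    also have "\<dots> = (\<Sum>k<N t \<omega>. \<Sum>i<Suc n. if gr n k \<omega> = i then ?\<phi> (X0 (real (Suc i) * h n) \<omega>) k \<omega> else 0)"
      by (rule sum.swap)
    also have "\<dots> = (\<Sum>k<N t \<omega>. if gr n k \<omega> < Suc n then ?\<phi> (X0 (real (Suc (gr n k \<omega>)) * h n) \<omega>) k \<omega> else 0)"
      by (intro sum.cong refl) (subst sum.delta', auto)
    finally show ?thesis .
  qed
  have Jn_bound: "\<bar>Jn n \<omega>\<bar> \<le> 2 * B * real (N t \<omega>)" if om: "\<omega> \<in> space M" for n \<omega>
  proof -
    have "\<bar>?\<phi> x k \<omega>\<bar> \<le> 2 * B" for x k using B(1)[of "x + S (Suc k) \<omega>"] B(1)[of "x + S k \<omega>"] by linarith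
    then have "\<bar>Jn n \<omega>\<bar> \<le> (\<Sum>k<N t \<omega>. 2 * B)"
      unfolding Jn_eq[OF om] using B(4) by (intro order_trans[OF sum_abs] sum_mono) auto
    then show ?thesis by (simp add: mult.commute)
  qed
  have h_lim: "h \<longlonglongrightarrow> 0" unfolding h_def[abs_def] by (intro LIMSEQ_Suc lim_const_over_n)
  have X0_lim: "(\<lambda>n. X0 (f n) \<omega>) \<longlonglongrightarrow> X0 s \<omega>"
    if om: "\<omega> \<in> space M" and f: "f \<longlonglongrightarrow> s" "\<And>n. 0 \<le> f n" "0 \<le> s" for f s \<omega>
    using X0_continuous[OF om] f unfolding continuous_on_sequentially by (auto simp: comp_def)
  have Jn_lim: "(\<lambda>n. Jn n \<omega>) \<longlonglongrightarrow> ?J \<omega>" if om: "\<omega> \<in> space M" for \<omega>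
    unfolding Jn_eq[OF om]
  proof (rule tendsto_sum)
    fix k assume "k \<in> {..<N t \<omega>}"
    then have k: "k < N t \<omega>" by simp
    let ?r = "enn2real (T k \<omega>)"
    have g1: "(\<lambda>n. real (gr n k \<omega>) * h n) \<longlonglongrightarrow> ?r"
      using tendsto_ceiling_grid[OF t Tr(2)[OF om k]] by (simp add: gr_def h_def)
    have "(\<lambda>n. real (gr n k \<omega>) * h n + h n) \<longlonglongrightarrow> ?r + 0" by (intro tendsto_add g1 h_lim)
    then have "(\<lambda>n. real (Suc (gr n k \<omega>)) * h n) \<longlonglongrightarrow> ?r" by (simp add: algebra_simps)
    then have "(\<lambda>n. X0 (real (Suc (gr n k \<omega>)) * h n) \<omega>) \<longlonglongrightarrow> X0 ?r \<omega>"
      using h0 by (intro X0_lim[OF om]) (auto intro: less_imp_le)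
    then have "(\<lambda>n. ?\<phi> (X0 (real (Suc (gr n k \<omega>)) * h n) \<omega>) k \<omega>) \<longlonglongrightarrow> ?\<phi> (X0 ?r \<omega>) k \<omega>"
      by (intro tendsto_diff continuous_on_tendsto_compose[OF continuous_U] tendsto_add tendsto_const) auto
    moreover have "eventually (\<lambda>n. ?\<phi> (X0 (real (Suc (gr n k \<omega>)) * h n) \<omega>) k \<omega> =
      (if gr n k \<omega> < Suc n then ?\<phi> (X0 (real (Suc (gr n k \<omega>)) * h n) \<omega>) k \<omega> else 0)) sequentially"
      using order_tendstoD(2)[OF g1 Tr(3)[OF om k]]
    proof eventually_elim
      case (elim n)
      then have "real (gr n k \<omega>) * h n < real (Suc n) * h n" by (simp only: hn)
      then have "gr n k \<omega> < Suc n" using h0[of n] by (simp only: mult_less_cancel_right_pos of_nat_less_iff)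
      then show ?case by simp
    qed
    ultimately have "(\<lambda>n. if gr n k \<omega> < Suc n then ?\<phi> (X0 (real (Suc (gr n k \<omega>)) * h n) \<omega>) k \<omega> else 0) \<longlonglongrightarrow> ?\<phi> (X0 ?r \<omega>) k \<omega>"
      by (rule Lim_transform_eventually)
    then show "(\<lambda>n. if gr n k \<omega> < Suc n then ?\<phi> (X0 (real (Suc (gr n k \<omega>)) * h n) \<omega>) k \<omega> else 0) \<longlonglongrightarrow> jump U k \<omega>"
      by (simp add: jump_def Let_def)
  qed
  have J_P: "?J \<in> borel_measurable P"
    by (rule borel_measurable_LIMSEQ_real[OF _ Jn_P]) (use Jn_lim in auto)
  have N2: "integrable P (\<lambda>\<omega>. 2 * B * real (N t \<omega>))" using Nint by simp
  have J_dct: "integrable P ?J" "(\<lambda>n. \<integral>\<omega>. Jn n \<omega> \<partial>P) \<longlonglongrightarrow> (\<integral>\<omega>. ?J \<omega> \<partial>P)" "\<And>n. integrable P (Jn n)"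
  proof -
    have l: "AE \<omega> in P. (\<lambda>n. Jn n \<omega>) \<longlonglongrightarrow> ?J \<omega>" and b: "\<And>n. AE \<omega> in P. norm (Jn n \<omega>) \<le> 2 * B * real (N t \<omega>)"
      using Jn_lim Jn_bound by (auto intro!: AE_I2)
    show "integrable P ?J" by (rule integrable_dominated_convergence[OF J_P Jn_P N2 l b])
    show "(\<lambda>n. \<integral>\<omega>. Jn n \<omega> \<partial>P) \<longlonglongrightarrow> (\<integral>\<omega>. ?J \<omega> \<partial>P)" by (rule integral_dominated_convergence[OF J_P Jn_P N2 l b])
    show "\<And>n. integrable P (Jn n)" by (rule integrable_dominated_convergence2[OF J_P Jn_P N2 l b])
  qed
  show "integrable P ?J" by (rule J_dct(1))

  have path_meas: "(\<lambda>s. indicator {0..<t} s * ?a (X0 s \<omega> + Z s \<omega>)) \<in> borel_measurable lborel" if om: "\<omega> \<in> space M" for \<omega>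
    using path_integrable[OF tf om fin[OF om]] by (rule borel_measurable_integrable)
  have In_int: "In n \<omega> = (\<integral>s. indicator {0..<t} s * ?a (\<xi> n (nat \<lfloor>s * real (Suc n) / t\<rfloor>) \<omega>) \<partial>lborel)"
    and In_meas: "(\<lambda>s. indicator {0..<t} s * ?a (\<xi> n (nat \<lfloor>s * real (Suc n) / t\<rfloor>) \<omega>)) \<in> borel_measurable lborel" for n \<omega>
    using step_function_integral[OF t, of "Suc n" "\<lambda>i. ?a (\<xi> n i \<omega>)"]
    by (auto simp: In_def h_def has_bochner_integral_iff)
  have In_lim: "(\<lambda>n. In n \<omega>) \<longlonglongrightarrow> ?I \<omega>" if om: "\<omega> \<in> space M" for \<omega>
    unfolding In_int
  proof (rule integral_dominated_convergence[where w="\<lambda>s. indicator {0..<t} s * A"])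
    show "(\<lambda>s. indicator {0..<t} s * ?a (X0 s \<omega> + Z s \<omega>)) \<in> borel_measurable lborel" by (rule path_meas[OF om])
    show "(\<lambda>s. indicator {0..<t} s * ?a (\<xi> n (nat \<lfloor>s * real (Suc n) / t\<rfloor>) \<omega>)) \<in> borel_measurable lborel" for n by (rule In_meas)
    show "integrable lborel (\<lambda>s. indicator {0..<t} s * A)" using t by (intro integral_indicator_const) simp
    show "AE s in lborel. norm (indicator {0..<t} s * ?a (\<xi> n (nat \<lfloor>s * real (Suc n) / t\<rfloor>) \<omega>)) \<le> indicator {0..<t} s * A" for n
      using a_bound by (auto simp: indicator_def)
    \<comment> \<open>If \<open>s\<close> is an order time, the lag of one step keeps this order out
      of \<open>Zm\<close> on every grid; these finitely many points and 0 are removed.\<close>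
    have "AE s in lborel. s \<notin> insert 0 ((\<lambda>k. enn2real (T k \<omega>)) ` {..<N t \<omega>})"
      by (rule AE_not_in) (auto intro: finite_imp_null_set_lborel)
    then show "AE s in lborel. (\<lambda>n. indicator {0..<t} s * ?a (\<xi> n (nat \<lfloor>s * real (Suc n) / t\<rfloor>) \<omega>)) \<longlonglongrightarrow> indicator {0..<t} s * ?a (X0 s \<omega> + Z s \<omega>)"
    proof eventually_elim
      case (elim s)
      show ?case
      proof (cases "s \<in> {0..<t}")
        case False then show ?thesis by simp
      next
        case True
        then have s: "0 < s" "s < t" using elim by auto
        let ?i = "\<lambda>n. nat \<lfloor>s * real (Suc n) / t\<rfloor>"
        have i1: "(\<lambda>n. real (?i n) * h n) \<longlonglongrightarrow> s"
          using tendsto_floor_grid[OF t, of s] s by (simp add: h_def)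
        have "(\<lambda>n. real (?i n) * h n - h n) \<longlonglongrightarrow> s - 0" by (intro tendsto_diff i1 h_lim)
        then have i2: "(\<lambda>n. (real (?i n) - 1) * h n) \<longlonglongrightarrow> s" by (simp add: algebra_simps)
        have X: "(\<lambda>n. X0 (real (?i n) * h n) \<omega>) \<longlonglongrightarrow> X0 s \<omega>"
        proof (rule X0_lim[OF om i1])
          show "0 \<le> real (?i n) * h n" for n by (intro mult_nonneg_nonneg of_nat_0_le_iff less_imp_le[OF h0])
        qed (use s in simp)
        have "eventually (\<lambda>n. Zm n (?i n) \<omega> = Z s \<omega>) sequentially"
        proof -
          have "eventually (\<lambda>n. \<forall>k\<in>{..<N t \<omega>}. enn2real (T k \<omega>) \<le> (real (?i n) - 1) * h n \<longleftrightarrow> enn2real (T k \<omega>) \<le> s) sequentially"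
          proof (intro eventually_ball_finite ballI)
            fix k assume k: "k \<in> {..<N t \<omega>}"
            then have ne: "enn2real (T k \<omega>) \<noteq> s" using elim by auto
            show "eventually (\<lambda>n. enn2real (T k \<omega>) \<le> (real (?i n) - 1) * h n \<longleftrightarrow> enn2real (T k \<omega>) \<le> s) sequentially"
            proof (cases "enn2real (T k \<omega>) < s")
              case True
              show ?thesis by (rule eventually_mono[OF order_tendstoD(1)[OF i2 True]]) (use True in simp)
            next
              case False
              then have "s < enn2real (T k \<omega>)" using ne by simp
              show ?thesis
                by (rule eventually_mono[OF order_tendstoD(2)[OF i2 \<open>s < enn2real (T k \<omega>)\<close>]])
                  (use \<open>s < enn2real (T k \<omega>)\<close> in simp)
            qed
          qed simp
          moreover have "eventually (\<lambda>n. 0 < (real (?i n) - 1) * h n) sequentially" by (rule order_tendstoD(1)[OF i2 s(1)])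
          moreover have "eventually (\<lambda>n. (real (?i n) - 1) * h n < t) sequentially" by (rule order_tendstoD(2)[OF i2 s(2)])
          ultimately show ?thesis
          proof eventually_elim
            case (elim n)
            have pos: "?i n \<noteq> 0" using elim(2) h0[of n] by (intro notI) (simp add: mult_less_0_iff)
            have e: "T k \<omega> \<le> ennreal y \<longleftrightarrow> enn2real (T k \<omega>) \<le> y" if "k < N t \<omega>" "0 \<le> y" for k y
              using Tr(1)[OF om that(1)] that(2) by (metis ennreal_le_iff)
            have "Zm n (?i n) \<omega> = Z ((real (?i n) - 1) * h n) \<omega>" using pos by (simp add: Zm_def)
            also have "\<dots> = (\<Sum>k<N t \<omega>. if T k \<omega> \<le> ennreal ((real (?i n) - 1) * h n) then Q k \<omega> else 0)"
              using elim by (intro Z_eq(1)[OF om fin[OF om]]) auto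
            also have "\<dots> = (\<Sum>k<N t \<omega>. if T k \<omega> \<le> ennreal s then Q k \<omega> else 0)"
              using elim s by (intro sum.cong refl) (simp add: e)
            also have "\<dots> = Z s \<omega>" using s by (intro Z_eq(1)[OF om fin[OF om], symmetric]) auto
            finally show ?case .
          qed
        qed
        then have "(\<lambda>n. Zm n (?i n) \<omega>) \<longlonglongrightarrow> Z s \<omega>" by (rule tendsto_eventually)
        then have "(\<lambda>n. ?a (\<xi> n (?i n) \<omega>)) \<longlonglongrightarrow> ?a (X0 s \<omega> + Z s \<omega>)"
          unfolding \<xi>_def by (intro continuous_on_tendsto_compose[OF a_cont] tendsto_add X) auto
        then show ?thesis using True by simp
      qed
    qed
  qed
  have In_bound: "\<bar>In n \<omega>\<bar> \<le> t * A" for n \<omega>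
  proof -
    have "\<bar>In n \<omega>\<bar> \<le> (\<Sum>i<Suc n. h n * A)"
      unfolding In_def using a_bound h0[of n] by (intro order_trans[OF sum_abs] sum_mono) (simp add: abs_mult)
    also have "\<dots> = (real (Suc n) * h n) * A" by simp
    finally show ?thesis by (simp only: hn)
  qed
  have I_P: "?I \<in> borel_measurable P"
    by (rule borel_measurable_LIMSEQ_real[OF _ In_P]) (use In_lim in auto)
  have I_dct: "integrable P ?I" "(\<lambda>n. \<integral>\<omega>. In n \<omega> \<partial>P) \<longlonglongrightarrow> (\<integral>\<omega>. ?I \<omega> \<partial>P)" "\<And>n. integrable P (In n)"
  proof -
    have l: "AE \<omega> in P. (\<lambda>n. In n \<omega>) \<longlonglongrightarrow> ?I \<omega>" and b: "\<And>n. AE \<omega> in P. norm (In n \<omega>) \<le> t * A"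
      using In_lim In_bound by (auto intro!: AE_I2)
    have c: "integrable P (\<lambda>\<omega>. t * A)" by simp
    show "integrable P ?I" by (rule integrable_dominated_convergence[OF I_P In_P c l b])
    show "(\<lambda>n. \<integral>\<omega>. In n \<omega> \<partial>P) \<longlonglongrightarrow> (\<integral>\<omega>. ?I \<omega> \<partial>P)" by (rule integral_dominated_convergence[OF I_P In_P c l b])
    show "\<And>n. integrable P (In n)" by (rule integrable_dominated_convergence2[OF I_P In_P c l b])
  qed
  show "integrable P ?I" by (rule I_dct(1))

  define En where "En n \<omega> = U (\<xi> n (Suc n) \<omega>)" for n \<omega>
  have En_eq: "En n \<omega> = U (X0 t \<omega> + Zm n (Suc n) \<omega>)" for n \<omega>
    unfolding En_def \<xi>_def hn ..
  have En_P: "En n \<in> borel_measurable P" for n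
    unfolding En_def[abs_def] by (rule measurable_compose[OF measurable_completed_history_P[OF \<xi>_meas] measurable_U]) simp
  have En_lim: "(\<lambda>n. En n \<omega>) \<longlonglongrightarrow> U (X0 t \<omega> + Zl t \<omega>)" if om: "\<omega> \<in> space M" for \<omega>
  proof -
    have e: "En n \<omega> = U (X0 t \<omega>) + (\<Sum>k<N t \<omega>. if gr n k \<omega> < Suc n then ?\<phi> (X0 t \<omega>) k \<omega> else 0)" for n
      using Usum[OF om, of "Suc n" n "X0 t \<omega>"] by (simp add: En_eq)
    \<comment> \<open>At the last index the grid process has counted the orders up to time
      \<open>t - h n\<close>. In the limit these are the orders strictly before \<open>t\<close>,
      hence \<open>Zl\<close>.\<close>
    have "eventually (\<lambda>n. \<forall>k\<in>{..<N t \<omega>}. gr n k \<omega> < Suc n) sequentially"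
    proof (intro eventually_ball_finite ballI)
      fix k assume "k \<in> {..<N t \<omega>}"
      then have k: "k < N t \<omega>" by simp
      have g1: "(\<lambda>n. real (gr n k \<omega>) * h n) \<longlonglongrightarrow> enn2real (T k \<omega>)"
        using tendsto_ceiling_grid[OF t Tr(2)[OF om k]] by (simp add: gr_def h_def)
      show "eventually (\<lambda>n. gr n k \<omega> < Suc n) sequentially"
        using order_tendstoD(2)[OF g1 Tr(3)[OF om k]]
      proof eventually_elim
        case (elim n)
        then have "real (gr n k \<omega>) * h n < real (Suc n) * h n" by (simp only: hn)
        then show ?case using h0[of n] by (simp only: mult_less_cancel_right_pos of_nat_less_iff)
      qed
    qed simp
    then have "eventually (\<lambda>n. En n \<omega> = U (X0 t \<omega> + Zl t \<omega>)) sequentially"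
    proof eventually_elim
      case (elim n)
      have "En n \<omega> = U (X0 t \<omega>) + (\<Sum>k<N t \<omega>. ?\<phi> (X0 t \<omega>) k \<omega>)" unfolding e using elim by simp
      also have "(\<Sum>k<N t \<omega>. ?\<phi> (X0 t \<omega>) k \<omega>) = U (X0 t \<omega> + S (N t \<omega>) \<omega>) - U (X0 t \<omega> + S 0 \<omega>)" by (rule sum_lessThan_telescope)
      finally show ?case by (simp add: Zl_eq[OF om fin[OF om]] S_def)
    qed
    then show ?thesis by (rule tendsto_eventually)
  qed
  have E_P: "(\<lambda>\<omega>. U (X0 t \<omega> + Zl t \<omega>)) \<in> borel_measurable P"
    by (rule borel_measurable_LIMSEQ_real[OF _ En_P]) (use En_lim in auto)
  have E_dct: "integrable P (\<lambda>\<omega>. U (X0 t \<omega> + Zl t \<omega>))" "(\<lambda>n. \<integral>\<omega>. En n \<omega> \<partial>P) \<longlonglongrightarrow> (\<integral>\<omega>. U (X0 t \<omega> + Zl t \<omega>) \<partial>P)" "\<And>n. integrable P (En n)"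
  proof -
    have l: "AE \<omega> in P. (\<lambda>n. En n \<omega>) \<longlonglongrightarrow> U (X0 t \<omega> + Zl t \<omega>)" and b: "\<And>n. AE \<omega> in P. norm (En n \<omega>) \<le> B"
      using En_lim B(1) by (auto intro!: AE_I2 simp: En_def)
    have c: "integrable P (\<lambda>\<omega>. B)" by simp
    show "integrable P (\<lambda>\<omega>. U (X0 t \<omega> + Zl t \<omega>))" by (rule integrable_dominated_convergence[OF E_P En_P c l b])
    show "(\<lambda>n. \<integral>\<omega>. En n \<omega> \<partial>P) \<longlonglongrightarrow> (\<integral>\<omega>. U (X0 t \<omega> + Zl t \<omega>) \<partial>P)" by (rule integral_dominated_convergence[OF E_P En_P c l b])
    show "\<And>n. integrable P (En n)" by (rule integrable_dominated_convergence2[OF E_P En_P c l b])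
  qed
  show "integrable P (\<lambda>\<omega>. U (X0 t \<omega> + Zl t \<omega>))" by (rule E_dct(1))

  define D where "D n i \<omega> = U (\<xi> n i \<omega> + (X0 (real i * h n + h n) \<omega> - X0 (real i * h n) \<omega>)) - U (\<xi> n i \<omega>)" for n i \<omega>
  have D_eq: "D n i \<omega> = U (X0 (real (Suc i) * h n) \<omega> + Zm n i \<omega>) - U (\<xi> n i \<omega>)" for n i \<omega>
    unfolding D_def \<xi>_def by (simp add: algebra_simps)
  have D_int: "integrable P (D n i)" if "i \<le> Suc n" for n i
  proof (rule P.integrable_const_bound[where B="2 * B"])
    show "AE \<omega> in P. norm (D n i \<omega>) \<le> 2 * B"
    proof (rule AE_I2)
      fix \<omega> show "norm (D n i \<omega>) \<le> 2 * B"
        using B(1)[of "X0 (real (Suc i) * h n) \<omega> + Zm n i \<omega>"] B(1)[of "\<xi> n i \<omega>"] unfolding D_eq real_norm_def by linarith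
    qed
    show "D n i \<in> borel_measurable P"
      unfolding D_eq[abs_def] using h0[of n] that
      by (intro borel_measurable_diff measurable_compose[OF _ measurable_U] borel_measurable_add X0_P Zm_P
        measurable_completed_history_P[OF \<xi>_meas]) auto
  qed
  have tele: "En n \<omega> = U x0 + Jn n \<omega> + (\<Sum>i<Suc n. D n i \<omega>)" if om: "\<omega> \<in> space M" for n \<omega>
  proof -
    have "Jn n \<omega> + (\<Sum>i<Suc n. D n i \<omega>) = (\<Sum>i<Suc n. U (\<xi> n (Suc i) \<omega>) - U (\<xi> n i \<omega>))"
      unfolding Jn_def D_eq sum.distrib[symmetric] \<xi>_def by (rule sum.cong) auto
    also have "\<dots> = U (\<xi> n (Suc n) \<omega>) - U (\<xi> n 0 \<omega>)" by (rule sum_lessThan_telescope)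
    also have "\<xi> n 0 \<omega> = x0" unfolding \<xi>_def Zm_def using X0_zero[OF om] by simp
    finally show ?thesis unfolding En_def by simp
  qed
  \<comment> \<open>The total error of the one-step expansions; its convergence to 0 is the claimed
    identity.\<close>
  define R where "R n = (\<integral>\<omega>. En n \<omega> \<partial>P) - U x0 - (\<integral>\<omega>. Jn n \<omega> \<partial>P) - (\<integral>\<omega>. In n \<omega> \<partial>P)" for n
  have a_int: "integrable P (\<lambda>\<omega>. ?a (\<xi> n i \<omega>))" if "i \<le> Suc n" for n i
    using a_bound measurable_compose[OF measurable_completed_history_P[OF \<xi>_meas[OF that]] a_meas]
    by (intro P.integrable_const_bound[where B=A]) auto
  have R_eq: "R n = (\<Sum>i<Suc n. (\<integral>\<omega>. D n i \<omega> \<partial>P) - h n * (\<integral>\<omega>. ?a (\<xi> n i \<omega>) \<partial>P))" for n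
  proof -
    have "(\<integral>\<omega>. En n \<omega> \<partial>P) = (\<integral>\<omega>. U x0 + Jn n \<omega> + (\<Sum>i<Suc n. D n i \<omega>) \<partial>P)"
      by (rule Bochner_Integration.integral_cong) (use tele in auto)
    also have "\<dots> = (\<integral>\<omega>. U x0 + Jn n \<omega> \<partial>P) + (\<integral>\<omega>. (\<Sum>i<Suc n. D n i \<omega>) \<partial>P)"
      using J_dct(3) D_int by (intro Bochner_Integration.integral_add Bochner_Integration.integrable_add Bochner_Integration.integrable_sum) auto
    also have "(\<integral>\<omega>. U x0 + Jn n \<omega> \<partial>P) = U x0 + (\<integral>\<omega>. Jn n \<omega> \<partial>P)"
      using J_dct(3) by (simp add: prob_space)
    also have "(\<integral>\<omega>. (\<Sum>i<Suc n. D n i \<omega>) \<partial>P) = (\<Sum>i<Suc n. \<integral>\<omega>. D n i \<omega> \<partial>P)"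
      using D_int by (intro Bochner_Integration.integral_sum) auto
    finally have e: "(\<integral>\<omega>. En n \<omega> \<partial>P) = U x0 + (\<integral>\<omega>. Jn n \<omega> \<partial>P) + (\<Sum>i<Suc n. \<integral>\<omega>. D n i \<omega> \<partial>P)" .
    have "(\<integral>\<omega>. In n \<omega> \<partial>P) = (\<Sum>i<Suc n. \<integral>\<omega>. h n * ?a (\<xi> n i \<omega>) \<partial>P)"
      unfolding In_def using a_int by (intro Bochner_Integration.integral_sum) auto
    then show ?thesis unfolding R_def e by (simp add: sum_subtractf)
  qed
  have "R \<longlonglongrightarrow> 0"
  proof (rule LIMSEQ_I)
    fix r :: real assume r: "0 < r"
    \<comment> \<open>The \<open>Suc n\<close> steps have total length \<open>t\<close>, so the
      errors \<open>\<epsilon> * h n\<close> add up to \<open>r / 2\<close>.\<close>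
    define \<epsilon> where "\<epsilon> = r / (2 * t)"
    have \<epsilon>: "0 < \<epsilon>" using r t by (simp add: \<epsilon>_def)
    from one_step[OF tf this] obtain h0' where h0': "0 < h0'"
      "\<And>h u (\<xi> :: 'a \<Rightarrow> real). 0 < h \<Longrightarrow> h < h0' \<Longrightarrow> 0 \<le> u \<Longrightarrow> \<xi> \<in> borel_measurable (\<H> u) \<Longrightarrow>
        \<bar>(\<integral>\<omega>. U (\<xi> \<omega> + (X0 (u + h) \<omega> - X0 u \<omega>)) - U (\<xi> \<omega>) \<partial>P) - h * (\<integral>\<omega>. ?a (\<xi> \<omega>) \<partial>P)\<bar> \<le> \<epsilon> * h" by blast
    obtain n0 where n0: "\<And>n. n0 \<le> n \<Longrightarrow> h n < h0'"
      using order_tendstoD(2)[OF h_lim h0'(1)] unfolding eventually_sequentially by blast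
    show "\<exists>n0. \<forall>n\<ge>n0. norm (R n - 0) < r"
    proof (intro exI[of _ n0] allI impI)
      fix n assume "n0 \<le> n"
      have "\<bar>R n\<bar> \<le> (\<Sum>i<Suc n. \<epsilon> * h n)"
        unfolding R_eq
      proof (intro order_trans[OF sum_abs] sum_mono)
        fix i assume i: "i \<in> {..<Suc n}"
        show "\<bar>(\<integral>\<omega>. D n i \<omega> \<partial>P) - h n * (\<integral>\<omega>. ?a (\<xi> n i \<omega>) \<partial>P)\<bar> \<le> \<epsilon> * h n"
          unfolding D_def using i h0[of n] n0[OF \<open>n0 \<le> n\<close>] by (intro h0'(2) \<xi>_meas) auto
      qed
      also have "\<dots> = \<epsilon> * (real (Suc n) * h n)" by simp
      also have "\<dots> = r / 2" unfolding hn using t by (simp add: \<epsilon>_def)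
      finally show "norm (R n - 0) < r" using r by simp
    qed
  qed
  moreover have "R \<longlonglongrightarrow> (\<integral>\<omega>. U (X0 t \<omega> + Zl t \<omega>) \<partial>P) - U x0 - (\<integral>\<omega>. ?J \<omega> \<partial>P) - (\<integral>\<omega>. ?I \<omega> \<partial>P)"
    unfolding R_def[abs_def] by (rule tendsto_diff[OF tendsto_diff[OF tendsto_diff[OF E_dct(2) tendsto_const] J_dct(2)] I_dct(2)])
  ultimately have "(\<integral>\<omega>. U (X0 t \<omega> + Zl t \<omega>) \<partial>P) - U x0 - (\<integral>\<omega>. ?J \<omega> \<partial>P) - (\<integral>\<omega>. ?I \<omega> \<partial>P) = 0"
    by (rule LIMSEQ_unique[rotated])
  then show "(\<integral>\<omega>. U (X0 t \<omega> + Zl t \<omega>) \<partial>P) = U x0 + (\<integral>\<omega>. ?I \<omega> \<partial>P) + (\<integral>\<omega>. ?J \<omega> \<partial>P)" by simp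
qed

end

section \<open>Test functions from the function F\<close>

text \<open>A function that vanishes at 0 together with its derivative may be switched off on one
  side. Writing \<open>g0\<close> and \<open>dg\<close> as their right branch plus such a correction
  settles smoothness at the kink.\<close>

lemma neg_part_has_derivative:
  fixes f f' :: "real \<Rightarrow> real"
  assumes f: "\<And>x. (f has_real_derivative f' x) (at x)" and f0: "f 0 = 0" "f' 0 = 0"
  shows "((\<lambda>x. if x < 0 then f x else 0) has_real_derivative (if x < 0 then f' x else 0)) (at x)"
proof (cases x "0::real" rule: linorder_cases)
  case less
  have "((\<lambda>x. if x < 0 then f x else 0) has_real_derivative f' x) (at x)"
    by (rule has_field_derivative_transform_within_open[OF f, of "{..<0}"]) (use less in auto)
  then show ?thesis using less by simp
next
  case greater
  have "((\<lambda>x. if x < 0 then f x else 0) has_real_derivative 0) (at x)"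
    by (rule has_field_derivative_transform_within_open[OF DERIV_const, of "{0<..}"]) (use greater in auto)
  then show ?thesis using greater by simp
next
  case equal
  have "((\<lambda>h. f h / h) \<longlongrightarrow> 0) (at 0)"
    using f[of 0] f0 by (simp add: DERIV_def)
  then have "((\<lambda>h. \<bar>f h / h\<bar>) \<longlongrightarrow> 0) (at 0)" by (rule tendsto_rabs_zero)
  then have "((\<lambda>h. (if h < 0 then f h else 0) / h) \<longlongrightarrow> 0) (at 0)"
    by (rule Lim_null_comparison[rotated]) (auto intro!: always_eventually)
  then show ?thesis using equal f0 by (simp add: DERIV_def cong: if_cong)
qed

text \<open>Squaring makes the positive part continuously differentiable, the smoothness required of
  the cutoff.\<close>

definition sq_plus :: "real \<Rightarrow> real" where "sq_plus u = (max 0 u)\<^sup>2"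

lemma sq_plus_has_derivative: "(sq_plus has_real_derivative 2 * max 0 u) (at u)"
proof -
  have n: "((\<lambda>x::real. if x < 0 then x\<^sup>2 else 0) has_real_derivative (if u < 0 then 2 * u else 0)) (at u)"
    by (rule neg_part_has_derivative[where f'="\<lambda>x. 2 * x"]) (auto intro!: derivative_eq_intros)
  have "((\<lambda>x. x\<^sup>2 - (if x < 0 then x\<^sup>2 else 0)) has_real_derivative 2 * u - (if u < 0 then 2 * u else 0)) (at u)"
    by (rule derivative_eq_intros n refl | simp)+
  moreover have "(\<lambda>x. x\<^sup>2 - (if x < 0 then x\<^sup>2 else 0)) = sq_plus" by (auto simp: sq_plus_def max_def)
  moreover have "2 * u - (if u < 0 then 2 * u else 0) = 2 * max 0 u" by auto
  ultimately show ?thesis by simp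
qed

lemma uniformly_continuous_on_compact_support:
  fixes f :: "real \<Rightarrow> real"
  assumes f: "continuous_on UNIV f" and R: "\<And>x. R \<le> \<bar>x\<bar> \<Longrightarrow> f x = 0"
  shows "uniformly_continuous_on UNIV f" and "bounded (range f)"
proof -
  have c: "continuous_on {-R - 1..R + 1} f" using f by (rule continuous_on_subset) auto
  have u: "uniformly_continuous_on {-R - 1..R + 1} f"
    using c by (intro compact_uniformly_continuous) auto
  show "uniformly_continuous_on UNIV f"
    unfolding uniformly_continuous_on_def
  proof (intro allI impI)
    fix e :: real assume e: "0 < e"
    with u obtain d where d: "0 < d" "\<And>x x'. x \<in> {-R - 1..R + 1} \<Longrightarrow> x' \<in> {-R - 1..R + 1} \<Longrightarrow> dist x' x < d \<Longrightarrow> dist (f x') (f x) < e"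
      unfolding uniformly_continuous_on_def by metis
    \<comment> \<open>The interval exceeds the support by 1, so if one of two points at distance
      below 1 lies outside it, both lie where \<open>f\<close> vanishes.\<close>
    show "\<exists>d>0. \<forall>x\<in>UNIV. \<forall>x'\<in>UNIV. dist x' x < d \<longrightarrow> dist (f x') (f x) < e"
    proof (intro exI[of _ "min d 1"] conjI ballI impI)
      show "0 < min d 1" using d by simp
      fix x x' :: real assume dx: "dist x' x < min d 1"
      show "dist (f x') (f x) < e"
      proof (cases "x \<in> {-R - 1..R + 1} \<and> x' \<in> {-R - 1..R + 1}")
        case True then show ?thesis using d(2) dx by simp
      next
        case False
        then have "R \<le> \<bar>x\<bar>" "R \<le> \<bar>x'\<bar>" using dx by (auto simp: dist_real_def)
        then show ?thesis using R e by simp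
      qed
    qed
  qed
  have "range f \<subseteq> insert 0 (f ` {-R - 1..R + 1})"
  proof
    fix r assume "r \<in> range f"
    then obtain x where x: "r = f x" by blast
    show "r \<in> insert 0 (f ` {-R - 1..R + 1})"
    proof (cases "R \<le> \<bar>x\<bar>")
      case False
      then have "x \<in> {-R - 1..R + 1}" by auto
      then show ?thesis using x by blast
    qed (use R x in simp)
  qed
  moreover have "bounded (f ` {-R - 1..R + 1})"
    using c by (intro compact_imp_bounded compact_continuous_image) auto
  ultimately show "bounded (range f)" by (meson bounded_insert bounded_subset)
qed

lemma antiderivative_on_UNIV:
  fixes f :: "real \<Rightarrow> real"
  assumes f: "continuous_on UNIV f"
  obtains F where "\<And>x. (F has_real_derivative f x) (at x)"
proof
  fix x :: real
  have "((\<lambda>u. LBINT s=ereal 0..ereal u. f s) has_vector_derivative f x) (at x within {-\<bar>x\<bar> - 1..\<bar>x\<bar> + 1})"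
    by (rule interval_integral_FTC2) (use f in \<open>auto intro: continuous_on_subset\<close>)
  moreover have "at x within {-\<bar>x\<bar> - 1..\<bar>x\<bar> + 1} = at x"
    by (rule at_within_interior) (auto simp: interior_atLeastAtMost_real)
  ultimately show "((\<lambda>u. LBINT s=ereal 0..ereal u. f s) has_real_derivative f x) (at x)"
    by (simp add: has_real_derivative_iff_has_vector_derivative)
qed

section \<open>The relative value function V and its derivatives\<close>

locale inventory_costs =
  fixes \<mu> \<sigma> cb ch k1 k2 ys zs x0 :: real
  assumes pos: "0 < \<mu>" "0 < \<sigma>" "0 < cb" "0 < ch" "0 < k1" "0 < k2"
    and ys_less_zs: "ys < zs"
    and F_min: "\<And>a b. a < b \<Longrightarrow> F_ratio \<mu> \<sigma> cb ch k1 k2 (ys, zs) \<le> F_ratio \<mu> \<sigma> cb ch k1 k2 (a, b)"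
begin

definition "\<kappa> = 2 * \<mu> / \<sigma>\<^sup>2"
definition "lam = F_ratio \<mu> \<sigma> cb ch k1 k2 (ys, zs)"
text \<open>The right branch continued to the whole line, plus a correction on the negative
  half-line. The correction has a double zero at 0, which makes \<open>g0\<close> twice continuously
  differentiable.\<close>

definition "dg x = ch / \<mu> * x + \<sigma>\<^sup>2 * ch / (2 * \<mu>\<^sup>2)
  + (if x < 0 then \<sigma>\<^sup>2 * (cb + ch) / (2 * \<mu>\<^sup>2) * (exp (\<kappa> * x) - 1 - \<kappa> * x) else 0)"
definition "ddg x = ch / \<mu> + (if x < 0 then (cb + ch) / \<mu> * (exp (\<kappa> * x) - 1) else 0)"
definition "V x = g0 \<mu> \<sigma> cb ch x - lam * zeta \<mu> x"
definition "dV x = dg x - lam / \<mu>"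

text \<open>Subtracting from the exponential its Taylor polynomial of degree 2 turns the
  coefficients with \<open>- cb\<close> into those with \<open>ch\<close>; the constants match by
  \<open>Ck\<close> and \<open>Ck2\<close>.\<close>

lemma g0_has_derivative: "(g0 \<mu> \<sigma> cb ch has_real_derivative dg x) (at x)"
proof -
  let ?C = "\<sigma> ^ 4 * (cb + ch) / (4 * \<mu> ^ 3)"
  have Ck: "?C * \<kappa> = \<sigma>\<^sup>2 * (cb + ch) / (2 * \<mu>\<^sup>2)"
    using pos by (simp add: \<kappa>_def field_simps power2_eq_square power3_eq_cube power4_eq_xxxx)
  have Ck2: "?C * \<kappa>\<^sup>2 = (cb + ch) / \<mu>"
    using pos by (simp add: \<kappa>_def field_simps power2_eq_square power3_eq_cube power4_eq_xxxx)
  have e: "((\<lambda>x. if x < 0 then ?C * (exp (\<kappa> * x) - 1 - \<kappa> * x - (\<kappa> * x)\<^sup>2 / 2) else 0) has_real_derivative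
     (if x < 0 then \<sigma>\<^sup>2 * (cb + ch) / (2 * \<mu>\<^sup>2) * (exp (\<kappa> * x) - 1 - \<kappa> * x) else 0)) (at x)"
    unfolding Ck[symmetric]
  proof (rule neg_part_has_derivative)
    show "((\<lambda>x. c * (exp (\<kappa> * x) - 1 - \<kappa> * x - (\<kappa> * x)\<^sup>2 / 2)) has_real_derivative c * \<kappa> * (exp (\<kappa> * x) - 1 - \<kappa> * x)) (at x)" for c x
      by (auto intro!: derivative_eq_intros simp: algebra_simps power2_eq_square)
  qed auto
  have "((\<lambda>x. ch / (2 * \<mu>) * x\<^sup>2 + \<sigma>\<^sup>2 * ch / (2 * \<mu>\<^sup>2) * x
      + (if x < 0 then ?C * (exp (\<kappa> * x) - 1 - \<kappa> * x - (\<kappa> * x)\<^sup>2 / 2) else 0)) has_real_derivative dg x) (at x)"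
    unfolding dg_def by (rule derivative_eq_intros e refl | simp)+
  moreover have "(\<lambda>x. ch / (2 * \<mu>) * x\<^sup>2 + \<sigma>\<^sup>2 * ch / (2 * \<mu>\<^sup>2) * x
      + (if x < 0 then ?C * (exp (\<kappa> * x) - 1 - \<kappa> * x - (\<kappa> * x)\<^sup>2 / 2) else 0)) = g0 \<mu> \<sigma> cb ch"
  proof
    fix x
    have "c * (exp (\<kappa> * x) - 1 - \<kappa> * x - (\<kappa> * x)\<^sup>2 / 2) = c * (exp (\<kappa> * x) - 1) - (c * \<kappa>) * x - (c * \<kappa>\<^sup>2) * x\<^sup>2 / 2" for c
      by (simp add: algebra_simps power_mult_distrib)
    from this[of ?C] have "?C * (exp (\<kappa> * x) - 1 - \<kappa> * x - (\<kappa> * x)\<^sup>2 / 2) = ?C * (exp (\<kappa> * x) - 1) - (?C * \<kappa>) * x - (?C * \<kappa>\<^sup>2) * x\<^sup>2 / 2" .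
    also have "\<dots> = ?C * (exp (\<kappa> * x) - 1) - \<sigma>\<^sup>2 * (cb + ch) / (2 * \<mu>\<^sup>2) * x - (cb + ch) / \<mu> * x\<^sup>2 / 2"
      unfolding Ck Ck2 ..
    finally have e: "?C * (exp (\<kappa> * x) - 1 - \<kappa> * x - (\<kappa> * x)\<^sup>2 / 2) = ?C * (exp (\<kappa> * x) - 1) - \<sigma>\<^sup>2 * (cb + ch) / (2 * \<mu>\<^sup>2) * x - (cb + ch) / \<mu> * x\<^sup>2 / 2" .
    have k: "2 * \<mu> * x / \<sigma>\<^sup>2 = \<kappa> * x" by (simp add: \<kappa>_def)
    have "ch / (2 * \<mu>) * x\<^sup>2 + \<sigma>\<^sup>2 * ch / (2 * \<mu>\<^sup>2) * x
        + (c * (E - 1) - \<sigma>\<^sup>2 * (cb + ch) / (2 * \<mu>\<^sup>2) * x - (cb + ch) / \<mu> * x\<^sup>2 / 2)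
      = - cb / (2 * \<mu>) * x\<^sup>2 - \<sigma>\<^sup>2 * cb / (2 * \<mu>\<^sup>2) * x + c * (E - 1)" for c E
      using pos by (simp add: field_simps)
    from this[of ?C "exp (\<kappa> * x)"] show "ch / (2 * \<mu>) * x\<^sup>2 + \<sigma>\<^sup>2 * ch / (2 * \<mu>\<^sup>2) * x
      + (if x < 0 then ?C * (exp (\<kappa> * x) - 1 - \<kappa> * x - (\<kappa> * x)\<^sup>2 / 2) else 0) = g0 \<mu> \<sigma> cb ch x"
      unfolding e g0_def k by (cases "x < 0") (simp_all only: if_True if_False add_0_right)
  qed
  ultimately show ?thesis by simp
qed

lemma dg_has_derivative: "(dg has_real_derivative ddg x) (at x)"
proof -
  have k: "\<sigma>\<^sup>2 * (cb + ch) / (2 * \<mu>\<^sup>2) * \<kappa> = (cb + ch) / \<mu>"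
    using pos by (simp add: \<kappa>_def field_simps power2_eq_square)
  have e: "((\<lambda>x. if x < 0 then \<sigma>\<^sup>2 * (cb + ch) / (2 * \<mu>\<^sup>2) * (exp (\<kappa> * x) - 1 - \<kappa> * x) else 0) has_real_derivative
     (if x < 0 then (cb + ch) / \<mu> * (exp (\<kappa> * x) - 1) else 0)) (at x)"
    unfolding k[symmetric]
  proof (rule neg_part_has_derivative)
    show "((\<lambda>x. c * (exp (\<kappa> * x) - 1 - \<kappa> * x)) has_real_derivative c * \<kappa> * (exp (\<kappa> * x) - 1)) (at x)" for c x
      by (auto intro!: derivative_eq_intros simp: algebra_simps)
  qed auto
  show ?thesis unfolding dg_def[abs_def] ddg_def by (rule derivative_eq_intros e refl | simp)+
qed

lemma ddg_continuous: "continuous_on UNIV ddg"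
proof -
  have "ddg = (\<lambda>x. ch / \<mu> + (cb + ch) / \<mu> * (exp (\<kappa> * min x 0) - 1))"
    by (auto simp: ddg_def fun_eq_iff min_def)
  moreover have "continuous_on UNIV (\<lambda>x. a + b * (exp (\<kappa> * min x 0) - 1))" for a b
    by (intro continuous_intros)
  ultimately show ?thesis by (simp only:)
qed

lemma dg_neg:
  assumes "x < 0"
  shows "dg x = - cb / \<mu> * x - \<sigma>\<^sup>2 * cb / (2 * \<mu>\<^sup>2) + \<sigma>\<^sup>2 * (cb + ch) / (2 * \<mu>\<^sup>2) * exp (\<kappa> * x)"
proof -
  have k: "\<sigma>\<^sup>2 * (cb + ch) / (2 * \<mu>\<^sup>2) * (\<kappa> * x) = (cb + ch) / \<mu> * x"
    using pos by (simp add: \<kappa>_def field_simps power2_eq_square)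
  have "\<sigma>\<^sup>2 * (cb + ch) / (2 * \<mu>\<^sup>2) * (E - 1 - \<kappa> * x) = \<sigma>\<^sup>2 * (cb + ch) / (2 * \<mu>\<^sup>2) * (E - 1) - (cb + ch) / \<mu> * x" for E
    unfolding k[symmetric] by (simp only: right_diff_distrib)
  moreover have "ch / \<mu> * x + \<sigma>\<^sup>2 * ch / (2 * \<mu>\<^sup>2) + (\<sigma>\<^sup>2 * (cb + ch) / (2 * \<mu>\<^sup>2) * (E - 1) - (cb + ch) / \<mu> * x)
    = - cb / \<mu> * x - \<sigma>\<^sup>2 * cb / (2 * \<mu>\<^sup>2) + \<sigma>\<^sup>2 * (cb + ch) / (2 * \<mu>\<^sup>2) * E" for E
    using pos by (simp add: field_simps)
  ultimately show ?thesis unfolding dg_def using assms by (simp only: if_True)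
qed

lemma generator_dg: "\<sigma>\<^sup>2 / 2 * ddg x - \<mu> * dg x = - c0 cb ch x"
proof (cases "x < 0")
  case True
  have "\<sigma>\<^sup>2 / 2 * (ch / \<mu> + (cb + ch) / \<mu> * (E - 1))
    - \<mu> * (- cb / \<mu> * x - \<sigma>\<^sup>2 * cb / (2 * \<mu>\<^sup>2) + \<sigma>\<^sup>2 * (cb + ch) / (2 * \<mu>\<^sup>2) * E) = cb * x" for E
    using pos by (simp add: field_simps power2_eq_square)
  then show ?thesis unfolding dg_neg[OF True] using True by (simp add: ddg_def c0_def)
next
  case False
  have "\<sigma>\<^sup>2 / 2 * (ch / \<mu>) - \<mu> * (ch / \<mu> * x + \<sigma>\<^sup>2 * ch / (2 * \<mu>\<^sup>2)) = - (ch * x)"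
    using pos by (simp add: field_simps power2_eq_square)
  then show ?thesis using False by (simp add: ddg_def dg_def c0_def)
qed

text \<open>On the negative side the bound \<open>exp (\<kappa> * x) \<ge> 1 + \<kappa> * x\<close>
  cancels exactly the terms with \<open>cb\<close>.\<close>

lemma dg_nonneg: "0 \<le> dg x"
proof (cases "x < 0")
  case False then show ?thesis using pos by (simp add: dg_def)
next
  case True
  have "\<sigma>\<^sup>2 * cb / (2 * \<mu>\<^sup>2) * (1 + \<kappa> * x) \<le> \<sigma>\<^sup>2 * cb / (2 * \<mu>\<^sup>2) * exp (\<kappa> * x)"
    using pos by (intro mult_left_mono exp_ge_add_one_self) auto
  moreover have "\<sigma>\<^sup>2 * cb / (2 * \<mu>\<^sup>2) * (1 + \<kappa> * x) = \<sigma>\<^sup>2 * cb / (2 * \<mu>\<^sup>2) + cb / \<mu> * x"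
    using pos by (simp add: \<kappa>_def field_simps power2_eq_square)
  moreover have "0 \<le> \<sigma>\<^sup>2 * ch / (2 * \<mu>\<^sup>2) * exp (\<kappa> * x)" using pos by simp
  moreover have "\<sigma>\<^sup>2 * (cb + ch) / (2 * \<mu>\<^sup>2) * exp (\<kappa> * x) = \<sigma>\<^sup>2 * cb / (2 * \<mu>\<^sup>2) * exp (\<kappa> * x) + \<sigma>\<^sup>2 * ch / (2 * \<mu>\<^sup>2) * exp (\<kappa> * x)"
    by (simp add: add_divide_distrib distrib_left distrib_right)
  ultimately show ?thesis unfolding dg_neg[OF True] by simp
qed

lemma lam_pos: "0 < lam"
proof -
  have "g0 \<mu> \<sigma> cb ch ys \<le> g0 \<mu> \<sigma> cb ch zs"
    by (rule DERIV_nonneg_imp_nondecreasing) (use ys_less_zs g0_has_derivative dg_nonneg in \<open>auto intro!: exI[of _ "dg _"]\<close>)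
  moreover have "0 < c1 k1 k2 ys zs" using pos ys_less_zs by (simp add: c1_def add_pos_pos)
  moreover have "0 < zeta \<mu> zs - zeta \<mu> ys" using pos ys_less_zs by (simp add: zeta_def divide_strict_right_mono)
  ultimately show ?thesis unfolding lam_def F_ratio_def by (simp add: add_pos_nonneg)
qed

lemma V_has_derivative: "(V has_real_derivative dV x) (at x)"
  unfolding V_def[abs_def] dV_def zeta_def
  by (rule derivative_eq_intros g0_has_derivative refl | use pos in simp)+

lemma dV_has_derivative: "(dV has_real_derivative ddg x) (at x)"
  unfolding dV_def[abs_def] by (rule derivative_eq_intros dg_has_derivative refl | simp)+

lemma generator_dV: "\<sigma>\<^sup>2 / 2 * ddg x - \<mu> * dV x = lam - c0 cb ch x"
  using generator_dg[of x] pos by (simp add: dV_def algebra_simps)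

lemma V_order: "a \<le> b \<Longrightarrow> V a - V b \<le> c1 k1 k2 a b"
proof (cases "a = b")
  case True then show ?thesis using pos by (simp add: c1_def)
next
  case False
  assume "a \<le> b"
  then have ab: "a < b" using False by simp
  have z: "0 < zeta \<mu> b - zeta \<mu> a" using pos ab by (simp add: zeta_def divide_strict_right_mono)
  have "lam \<le> (c1 k1 k2 a b + g0 \<mu> \<sigma> cb ch b - g0 \<mu> \<sigma> cb ch a) / (zeta \<mu> b - zeta \<mu> a)"
    using F_min[OF ab] by (simp add: lam_def F_ratio_def)
  then have "lam * (zeta \<mu> b - zeta \<mu> a) \<le> c1 k1 k2 a b + g0 \<mu> \<sigma> cb ch b - g0 \<mu> \<sigma> cb ch a"
    using z by (simp add: pos_le_divide_eq)
  then show ?thesis by (simp add: V_def algebra_simps)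
qed

lemma V_order_eq: "V ys - V zs = c1 k1 k2 ys zs"
proof -
  have "0 < zeta \<mu> zs - zeta \<mu> ys" using pos ys_less_zs by (simp add: zeta_def divide_strict_right_mono)
  then have "lam * (zeta \<mu> zs - zeta \<mu> ys) = c1 k1 k2 ys zs + g0 \<mu> \<sigma> cb ch zs - g0 \<mu> \<sigma> cb ch ys"
    by (simp add: lam_def F_ratio_def)
  then show ?thesis by (simp add: V_def algebra_simps)
qed

text \<open>The growth that the logarithmic cutoff compensates: its derivative times
  \<open>1 + \<bar>x\<bar>\<close> is of order \<delta>.\<close>

lemma dV_linear_growth: "\<exists>A>0. \<forall>x. \<bar>dV x\<bar> \<le> A * (1 + \<bar>x\<bar>)"
proof -
  define A where "A = ch / \<mu> + cb / \<mu> + \<sigma>\<^sup>2 * ch / (2 * \<mu>\<^sup>2) + \<sigma>\<^sup>2 * cb / (2 * \<mu>\<^sup>2) + \<sigma>\<^sup>2 * (cb + ch) / (2 * \<mu>\<^sup>2) + lam / \<mu>"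
  have p: "0 < ch / \<mu>" "0 < cb / \<mu>" "0 < \<sigma>\<^sup>2 * ch / (2 * \<mu>\<^sup>2)" "0 < \<sigma>\<^sup>2 * cb / (2 * \<mu>\<^sup>2)" "0 < \<sigma>\<^sup>2 * (cb + ch) / (2 * \<mu>\<^sup>2)" "0 < lam / \<mu>"
    using pos lam_pos by auto
  have "\<bar>dV x\<bar> \<le> A * (1 + \<bar>x\<bar>)" for x
  proof (cases "x < 0")
    case True
    have e: "0 \<le> \<sigma>\<^sup>2 * (cb + ch) / (2 * \<mu>\<^sup>2) * exp (\<kappa> * x)" "\<sigma>\<^sup>2 * (cb + ch) / (2 * \<mu>\<^sup>2) * exp (\<kappa> * x) \<le> \<sigma>\<^sup>2 * (cb + ch) / (2 * \<mu>\<^sup>2)"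
    proof -
      have "0 < \<kappa>" using pos by (simp add: \<kappa>_def)
      then have "exp (\<kappa> * x) \<le> 1" using True by (simp add: mult_le_0_iff)
      then show "\<sigma>\<^sup>2 * (cb + ch) / (2 * \<mu>\<^sup>2) * exp (\<kappa> * x) \<le> \<sigma>\<^sup>2 * (cb + ch) / (2 * \<mu>\<^sup>2)"
        using p by (intro mult_left_le) auto
      show "0 \<le> \<sigma>\<^sup>2 * (cb + ch) / (2 * \<mu>\<^sup>2) * exp (\<kappa> * x)"
        using p by (intro mult_nonneg_nonneg) auto
    qed
    have "\<bar>dV x\<bar> \<le> cb / \<mu> * \<bar>x\<bar> + A"
    proof -
      have G: "\<bar>q - s + E - l\<bar> \<le> q + (a + b + c + s + E' + l)"
        if "0 \<le> q" "0 \<le> E" "E \<le> E'" "0 < a" "0 < b" "0 < c" "0 < s" "0 < l" for q s E E' l a b c :: real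
        using that by linarith
      have "0 \<le> cb / \<mu> * \<bar>x\<bar>" using pos by simp
      moreover have q: "- cb / \<mu> * x = cb / \<mu> * \<bar>x\<bar>" using True by simp
      ultimately show ?thesis unfolding dV_def dg_neg[OF True] A_def q using e p by (intro G) auto
    qed
    also have "\<dots> \<le> A * \<bar>x\<bar> + A"
      using p by (intro add_right_mono mult_right_mono) (auto simp: A_def)
    finally show ?thesis by (simp add: algebra_simps)
  next
    case False
    have "\<bar>dV x\<bar> \<le> ch / \<mu> * \<bar>x\<bar> + A"
    proof -
      have G: "\<bar>q + s - l\<bar> \<le> q + (a + b + s + c + d + l)"
        if "0 \<le> q" "0 < a" "0 < b" "0 < c" "0 < d" "0 < s" "0 < l" for q s l a b c d :: real
        using that by linarith
      have q: "dV x = ch / \<mu> * \<bar>x\<bar> + \<sigma>\<^sup>2 * ch / (2 * \<mu>\<^sup>2) - lam / \<mu>" using False by (simp add: dV_def dg_def)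
      have "0 \<le> ch / \<mu> * \<bar>x\<bar>" using pos by simp
      then show ?thesis unfolding q A_def using p by (intro G) auto
    qed
    also have "\<dots> \<le> A * \<bar>x\<bar> + A"
      using p by (intro add_right_mono mult_right_mono) (auto simp: A_def)
    finally show ?thesis by (simp add: algebra_simps)
  qed
  moreover have "0 < A" using p by (simp add: A_def add_pos_pos)
  ultimately show ?thesis by blast
qed

text \<open>Beyond this radius the holding cost exceeds \<open>lam\<close> (first two terms) and V
  is increasing (the third term offsets the constant in \<open>dg\<close> on the left). The other
  terms place \<open>ys\<close>, \<open>zs\<close> and \<open>x0\<close> inside, where the test
  function will agree with V up to a constant.\<close>

definition "R0 = lam / ch + lam / cb + \<sigma>\<^sup>2 / (2 * \<mu>) + \<bar>ys\<bar> + \<bar>zs\<bar> + \<bar>x0\<bar>"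

lemma R0_bounds: "\<bar>ys\<bar> \<le> R0" "\<bar>zs\<bar> \<le> R0" "\<bar>x0\<bar> \<le> R0" "0 < R0"
proof -
  have "0 < lam / ch" "0 < lam / cb" "0 < \<sigma>\<^sup>2 / (2 * \<mu>)" using pos lam_pos by auto
  then show "\<bar>ys\<bar> \<le> R0" "\<bar>zs\<bar> \<le> R0" "\<bar>x0\<bar> \<le> R0" "0 < R0" unfolding R0_def by linarith+
qed

lemma far_away:
  assumes "R0 \<le> \<bar>x\<bar>"
  shows "lam \<le> c0 cb ch x" and "0 \<le> dV x"
proof -
  have p: "0 < lam / ch" "0 < lam / cb" "0 < \<sigma>\<^sup>2 / (2 * \<mu>)" using pos lam_pos by auto
  have b: "lam / ch \<le> \<bar>x\<bar>" "lam / cb + \<sigma>\<^sup>2 / (2 * \<mu>) \<le> \<bar>x\<bar>" using assms p unfolding R0_def by linarith+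
  have "lam / cb \<le> \<bar>x\<bar>" using b(2) p by linarith
  then have "lam \<le> ch * \<bar>x\<bar>" "lam \<le> cb * \<bar>x\<bar>" using b pos by (auto simp: pos_divide_le_eq mult.commute)
  then show "lam \<le> c0 cb ch x" by (auto simp: c0_def abs_if split: if_splits)
  show "0 \<le> dV x"
  proof (cases "x < 0")
    case True
    have "cb / \<mu> * (lam / cb + \<sigma>\<^sup>2 / (2 * \<mu>)) \<le> cb / \<mu> * \<bar>x\<bar>" using b pos by (intro mult_left_mono) auto
    moreover have "cb / \<mu> * (lam / cb + \<sigma>\<^sup>2 / (2 * \<mu>)) = lam / \<mu> + \<sigma>\<^sup>2 * cb / (2 * \<mu>\<^sup>2)"
      using pos by (simp add: field_simps power2_eq_square)
    moreover have "0 \<le> \<sigma>\<^sup>2 * (cb + ch) / (2 * \<mu>\<^sup>2) * exp (\<kappa> * x)" using pos by simp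
    ultimately show ?thesis unfolding dV_def dg_neg[OF True] using True by simp
  next
    case False
    have "lam / \<mu> \<le> ch * \<bar>x\<bar> / \<mu>" using \<open>lam \<le> ch * \<bar>x\<bar>\<close> pos by (intro divide_right_mono) auto
    moreover have "0 \<le> \<sigma>\<^sup>2 * ch / (2 * \<mu>\<^sup>2)" using pos by simp
    ultimately show ?thesis unfolding dV_def dg_def using False by simp
  qed
qed

end

text \<open>The logarithm makes the cutoff so slow that its derivative times a function of linear growth
  is of order \<open>\<delta>\<close> uniformly on the line.\<close>

definition cutoff :: "real \<Rightarrow> real \<Rightarrow> real" where
  "cutoff \<delta> x = sq_plus (1 - sq_plus (\<delta> * ln (1 + x\<^sup>2) - 1))"

definition dcutoff :: "real \<Rightarrow> real \<Rightarrow> real" where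
  "dcutoff \<delta> x = 2 * max 0 (1 - sq_plus (\<delta> * ln (1 + x\<^sup>2) - 1)) * (- (2 * max 0 (\<delta> * ln (1 + x\<^sup>2) - 1) * (\<delta> * (2 * x / (1 + x\<^sup>2)))))"

lemma cutoff_has_derivative: "(cutoff \<delta> has_real_derivative dcutoff \<delta> x) (at x)"
proof -
  have p: "0 < 1 + x\<^sup>2" by (simp add: add_pos_nonneg)
  have d1: "((\<lambda>x. \<delta> * ln (1 + x\<^sup>2) - 1) has_real_derivative \<delta> * (2 * x / (1 + x\<^sup>2))) (at x)"
    using p by (auto intro!: derivative_eq_intros)
  have d2: "((\<lambda>x. sq_plus (\<delta> * ln (1 + x\<^sup>2) - 1)) has_real_derivative 2 * max 0 (\<delta> * ln (1 + x\<^sup>2) - 1) * (\<delta> * (2 * x / (1 + x\<^sup>2)))) (at x)"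
    by (rule DERIV_chain2[OF sq_plus_has_derivative d1])
  have "((\<lambda>x. 1 - sq_plus (\<delta> * ln (1 + x\<^sup>2) - 1)) has_real_derivative 0 - 2 * max 0 (\<delta> * ln (1 + x\<^sup>2) - 1) * (\<delta> * (2 * x / (1 + x\<^sup>2)))) (at x)"
    by (intro DERIV_diff DERIV_const d2)
  from DERIV_chain2[OF sq_plus_has_derivative this] show ?thesis
    unfolding cutoff_def[abs_def] dcutoff_def by simp
qed

lemma continuous_sq_plus: "continuous_on UNIV sq_plus"
  unfolding sq_plus_def[abs_def] by (intro continuous_intros)

lemma dcutoff_continuous: "continuous_on UNIV (dcutoff \<delta>)"
proof -
  have "1 + x\<^sup>2 \<noteq> 0" for x :: real by (metis add_pos_nonneg less_irrefl zero_le_power2 zero_less_one)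
  then show ?thesis unfolding dcutoff_def[abs_def]
    by (intro continuous_intros continuous_on_compose2[OF continuous_sq_plus]) (auto simp: add_pos_nonneg)
qed

lemma cutoff_bounds: "0 \<le> cutoff \<delta> x" "cutoff \<delta> x \<le> 1"
proof -
  show "0 \<le> cutoff \<delta> x" by (simp add: cutoff_def sq_plus_def)
  have "0 \<le> sq_plus (\<delta> * ln (1 + x\<^sup>2) - 1)" by (simp add: sq_plus_def)
  then have "max 0 (1 - sq_plus (\<delta> * ln (1 + x\<^sup>2) - 1)) \<le> 1" by simp
  then show "cutoff \<delta> x \<le> 1" unfolding cutoff_def sq_plus_def[of "1 - _"] by (intro power_le_one) auto
qed

lemma cutoff_eq_1: "\<delta> * ln (1 + x\<^sup>2) \<le> 1 \<Longrightarrow> cutoff \<delta> x = 1"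
  by (simp add: cutoff_def sq_plus_def max_def)

lemma cutoff_eq_0:
  assumes "2 \<le> \<delta> * ln (1 + x\<^sup>2)"
  shows "cutoff \<delta> x = 0" "dcutoff \<delta> x = 0"
proof -
  have "1 \<le> sq_plus (\<delta> * ln (1 + x\<^sup>2) - 1)" using assms by (simp add: sq_plus_def max_def)
  then show "cutoff \<delta> x = 0" "dcutoff \<delta> x = 0"
    by (auto simp: cutoff_def dcutoff_def sq_plus_def[of "1 - _"] max_def)
qed

text \<open>The two outer derivatives have a product of absolute value at most 4, since they vanish
  together once the inner argument exceeds 1. The remaining factor satisfies \<open>2 *
  \<bar>x\<bar> * (1 + \<bar>x\<bar>) \<le> 4 * (1 + x\<^sup>2)\<close>.\<close>

lemma dcutoff_bound: assumes \<delta>: "0 < \<delta>" shows "\<bar>dcutoff \<delta> x\<bar> * (1 + \<bar>x\<bar>) \<le> 16 * \<delta>"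
proof -
  let ?u = "\<delta> * ln (1 + x\<^sup>2) - 1"
  have p: "0 < 1 + x\<^sup>2" by (simp add: add_pos_nonneg)
  have "\<bar>2 * max 0 (1 - sq_plus ?u) * (2 * max 0 ?u)\<bar> \<le> 4"
  proof (cases "?u \<le> 1")
    case True
    have "0 \<le> sq_plus ?u" by (simp add: sq_plus_def)
    then have "max 0 (1 - sq_plus ?u) \<le> 1" "max 0 ?u \<le> 1" using True by auto
    then have "max 0 (1 - sq_plus ?u) * max 0 ?u \<le> 1 * 1" by (intro mult_mono) auto
    then show ?thesis by (simp add: abs_mult)
  next
    case False
    then have "dcutoff \<delta> x = 0 \<and> 1 \<le> sq_plus ?u" by (simp add: sq_plus_def max_def cutoff_eq_0)
    then show ?thesis by simp
  qed
  then have "\<bar>2 * max 0 (1 - sq_plus ?u) * (2 * max 0 ?u)\<bar> * (\<delta> * (2 * \<bar>x\<bar> / (1 + x\<^sup>2))) \<le> 4 * (\<delta> * (2 * \<bar>x\<bar> / (1 + x\<^sup>2)))"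
    using \<delta> p by (intro mult_right_mono) auto
  moreover have "\<bar>dcutoff \<delta> x\<bar> = \<bar>2 * max 0 (1 - sq_plus ?u) * (2 * max 0 ?u)\<bar> * (\<delta> * (2 * \<bar>x\<bar> / (1 + x\<^sup>2)))"
    using \<delta> p by (simp add: dcutoff_def abs_mult)
  ultimately have "\<bar>dcutoff \<delta> x\<bar> \<le> 4 * (\<delta> * (2 * \<bar>x\<bar> / (1 + x\<^sup>2)))" by simp
  then have "\<bar>dcutoff \<delta> x\<bar> * (1 + \<bar>x\<bar>) \<le> 4 * (\<delta> * (2 * \<bar>x\<bar> / (1 + x\<^sup>2))) * (1 + \<bar>x\<bar>)"
    by (rule mult_right_mono) simp
  also have "\<dots> = 8 * \<delta> * ((\<bar>x\<bar> + x\<^sup>2) / (1 + x\<^sup>2))"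
    by (simp add: field_simps power2_eq_square)
  also have "\<dots> \<le> 8 * \<delta> * 2"
  proof (intro mult_left_mono)
    have "0 \<le> (1 - \<bar>x\<bar>)\<^sup>2" by simp
    then have "2 * \<bar>x\<bar> \<le> 1 + x\<^sup>2" by (simp add: power2_diff)
    moreover have "a + b \<le> 2 * (1 + b)" if "2 * a \<le> 1 + b" "0 \<le> b" for a b :: real
      using that by simp
    ultimately have "\<bar>x\<bar> + x\<^sup>2 \<le> 2 * (1 + x\<^sup>2)" by simp
    then show "(\<bar>x\<bar> + x\<^sup>2) / (1 + x\<^sup>2) \<le> 2" using p by (simp add: pos_divide_le_eq)
  qed (use \<delta> in auto)
  finally show ?thesis by simp
qed

section \<open>Construction of the bounded test functions\<close>

context inventory_costs
begin

text \<open>The second and fourth clause bound the cost of every policy from below. The remaining ones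
  bound the cost of the \<open>(ys, zs)\<close> policy from above; there \<open>D\<close> absorbs the first order, which may
  start from \<open>x0 < ys\<close>.\<close>

definition certificate :: "real \<Rightarrow> real \<Rightarrow> real \<Rightarrow> (real \<Rightarrow> real) \<Rightarrow> (real \<Rightarrow> real) \<Rightarrow> (real \<Rightarrow> real) \<Rightarrow> bool" where
  "certificate C D \<delta> U w v \<longleftrightarrow> test_function U w v \<and>
     (\<forall>x. lam - C * \<delta> \<le> \<sigma>\<^sup>2 / 2 * v x - \<mu> * w x + c0 cb ch x) \<and>
     (\<forall>x. \<sigma>\<^sup>2 / 2 * v x - \<mu> * w x \<le> lam - cutoff \<delta> x * c0 cb ch x + C * \<delta>) \<and>
     (\<forall>a b. a \<le> b \<longrightarrow> U a - U b \<le> c1 k1 k2 a b) \<and>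
     U ys - U zs = c1 k1 k2 ys zs \<and>
     c1 k1 k2 (min x0 ys) zs \<le> U (min x0 ys) - U zs + D \<and>
     (\<forall>x\<ge>min x0 ys. U x0 - U x \<le> D)"

text \<open>\<open>C\<close>, \<open>D\<close> and \<open>\<delta>0\<close> are fixed before
  \<delta>. Within radius \<open>R0\<close> the cutoff is 1 and all properties come from V; outside,
  \<open>w\<close> is nonnegative and \<open>U\<close> monotone. Vanishing of \<open>w\<close> far
  out makes \<open>U\<close> bounded.\<close>

lemma test_function_exists:
  "\<exists>C D \<delta>0. 0 < \<delta>0 \<and> 0 \<le> C \<and> 0 \<le> D \<and> (\<forall>\<delta>. 0 < \<delta> \<longrightarrow> \<delta> < \<delta>0 \<longrightarrow> (\<exists>U w v. certificate C D \<delta> U w v))"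
proof -
  obtain A where A: "0 < A" "\<And>x. \<bar>dV x\<bar> \<le> A * (1 + \<bar>x\<bar>)" using dV_linear_growth by blast
  \<comment> \<open>Half of \<open>\<sigma>\<^sup>2\<close>, times the growth constant
    \<open>A\<close>, times the 16 of \<open>dcutoff_bound\<close>.\<close>
  define C where "C = 8 * \<sigma>\<^sup>2 * A"
  have V_cont: "continuous_on UNIV V"
    using V_has_derivative by (intro DERIV_continuous_on) (auto intro: DERIV_subset)
  have "bounded (V ` {-R0..R0})"
    using V_cont by (intro compact_imp_bounded compact_continuous_image) (auto intro: continuous_on_subset)
  then obtain K where K': "0 < K" "\<forall>r\<in>V ` {-R0..R0}. norm r \<le> K" unfolding bounded_pos by blast
  have K: "\<bar>V x\<bar> \<le> K" if "\<bar>x\<bar> \<le> R0" for x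
    using K'(2) that by (auto simp: abs_le_iff)
  \<comment> \<open>\<open>2 * K\<close> bounds the oscillation of V within radius
    \<open>R0\<close>, so the constant does not depend on \<delta>.\<close>
  define D where "D = 2 * K + \<bar>c1 k1 k2 (min x0 ys) zs\<bar>"
  \<comment> \<open>For smaller \<delta> the cutoff equals 1 up to radius \<open>R0\<close>.\<close>
  define \<delta>0 where "\<delta>0 = 1 / ln (1 + R0\<^sup>2)"
  have lnR0: "0 < ln (1 + R0\<^sup>2)" using R0_bounds(4) by (intro ln_gt_zero) simp
  have "0 < \<delta>0" using lnR0 by (simp add: \<delta>0_def)
  moreover have "0 \<le> C" using A pos by (simp add: C_def)
  moreover have "0 \<le> D" using K'(1) by (simp add: D_def)
  moreover have "\<exists>U w v. certificate C D \<delta> U w v" if \<delta>: "0 < \<delta>" "\<delta> < \<delta>0" for \<delta>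
  proof -
    define w where "w x = dV x * cutoff \<delta> x" for x
    define v where "v x = ddg x * cutoff \<delta> x + dV x * dcutoff \<delta> x" for x
    have w': "(w has_real_derivative v x) (at x)" for x
      unfolding w_def[abs_def] v_def
      by (rule derivative_eq_intros dV_has_derivative cutoff_has_derivative refl | simp)+
    have w_cont: "continuous_on UNIV w"
      using w' by (intro DERIV_continuous_on) (auto intro: DERIV_subset)
    have "continuous_on UNIV dV" "continuous_on UNIV (cutoff \<delta>)"
      using dV_has_derivative cutoff_has_derivative by (auto intro!: DERIV_continuous_on intro: DERIV_subset)
    then have v_cont: "continuous_on UNIV v"
      unfolding v_def[abs_def] by (intro continuous_intros ddg_continuous dcutoff_continuous)
    from antiderivative_on_UNIV[OF w_cont] obtain U where U: "\<And>x. (U has_real_derivative w x) (at x)" by blast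
    \<comment> \<open>The square of \<open>exp (1 / \<delta>)\<close> is
      \<open>exp (2 / \<delta>)\<close>, where the argument of the cutoff reaches 2.\<close>
    define R1 where "R1 = max R0 (exp (1 / \<delta>))"
    have far: "cutoff \<delta> x = 0" "dcutoff \<delta> x = 0" if "R1 \<le> \<bar>x\<bar>" for x
    proof -
      have "exp (1 / \<delta>) \<le> \<bar>x\<bar>" using that by (simp add: R1_def)
      then have "(exp (1 / \<delta>))\<^sup>2 \<le> \<bar>x\<bar>\<^sup>2" by (intro power_mono) auto
      then have "exp (2 / \<delta>) \<le> 1 + x\<^sup>2" by (simp add: power2_eq_square exp_add[symmetric])
      then have "2 / \<delta> \<le> ln (1 + x\<^sup>2)" by (subst ln_ge_iff) (auto simp: add_pos_nonneg)
      then have "2 \<le> \<delta> * ln (1 + x\<^sup>2)" using \<delta> by (simp add: pos_divide_le_eq mult.commute)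
      then show "cutoff \<delta> x = 0" "dcutoff \<delta> x = 0" by (rule cutoff_eq_0)+
    qed
    have near: "cutoff \<delta> x = 1" if "\<bar>x\<bar> \<le> R0" for x
    proof (rule cutoff_eq_1)
      have "x\<^sup>2 \<le> R0\<^sup>2" using that R0_bounds(4) by (simp add: abs_le_square_iff[symmetric])
      then have "ln (1 + x\<^sup>2) \<le> ln (1 + R0\<^sup>2)" by (simp add: add_pos_nonneg)
      then have "\<delta> * ln (1 + x\<^sup>2) \<le> \<delta>0 * ln (1 + R0\<^sup>2)" using \<delta> lnR0 by (intro mult_mono) (auto simp: ln_ge_zero)
      then show "\<delta> * ln (1 + x\<^sup>2) \<le> 1" using lnR0 by (simp add: \<delta>0_def)
    qed
    have w0: "w x = 0" and v0: "v x = 0" if "R1 \<le> \<bar>x\<bar>" for x using far[OF that] by (auto simp: w_def v_def)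
    have w_far: "0 \<le> w x" if "R0 \<le> \<bar>x\<bar>" for x using far_away(2)[OF that] cutoff_bounds by (simp add: w_def)
    have U_mono_right: "U a \<le> U b" if "R0 \<le> a" "a \<le> b" for a b
      using U w_far that R0_bounds(4) by (intro DERIV_nonneg_imp_nondecreasing[of a b U]) (auto intro!: exI)
    have U_mono_left: "U a \<le> U b" if "b \<le> - R0" "a \<le> b" for a b
      using U w_far that R0_bounds(4) by (intro DERIV_nonneg_imp_nondecreasing[of a b U]) (auto intro!: exI)
    have U_near: "U b - U a = V b - V a" if "\<bar>a\<bar> \<le> R0" "\<bar>b\<bar> \<le> R0" for a b
    proof -
      have "U x - V x = U (-R0) - V (-R0)" if x: "\<bar>x\<bar> \<le> R0" for x
      proof -
        have "\<exists>c. \<forall>x\<in>{-R0..R0}. U x - V x = c"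
        proof (rule has_field_derivative_zero_constant)
          fix x assume "x \<in> {-R0..R0}"
          then have "\<bar>x\<bar> \<le> R0" by auto
          then have "w x = dV x" using near[of x] by (simp add: w_def)
          then have "((\<lambda>x. U x - V x) has_real_derivative 0) (at x)"
            using DERIV_diff[OF U[of x] V_has_derivative[of x]] by simp
          then show "((\<lambda>x. U x - V x) has_real_derivative 0) (at x within {-R0..R0})" by (rule DERIV_subset) simp
        qed simp
        then obtain c where c: "\<And>x. x \<in> {-R0..R0} \<Longrightarrow> U x - V x = c" by blast
        show ?thesis using c[of x] c[of "- R0"] x R0_bounds(4) by (auto simp: abs_le_iff)
      qed
      from this[OF that(1)] this[OF that(2)] show ?thesis by linarith
    qed
    have "range U \<subseteq> U ` {-R1..R1}"
    proof
      fix r assume "r \<in> range U"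
      then obtain x where r: "r = U x" by blast
      have R1: "0 < R1" using R0_bounds(4) by (simp add: R1_def)
      have const: "U a = U b" if "a \<le> b" "R1 \<le> a \<or> b \<le> - R1" for a b
      proof (cases "a = b")
        case False
        have "w x = 0" if "a \<le> x" "x \<le> b" for x
          using that \<open>R1 \<le> a \<or> b \<le> - R1\<close> R1 by (intro w0) auto
        then have "\<And>x. a \<le> x \<Longrightarrow> x \<le> b \<Longrightarrow> (U has_real_derivative 0) (at x)" using U by metis
        then show ?thesis using False \<open>a \<le> b\<close>
          by (intro DERIV_isconst_end[of a b U, symmetric]) (auto intro!: continuous_at_imp_continuous_on DERIV_isCont)
      qed simp
      consider "x < - R1" | "x \<in> {-R1..R1}" | "R1 < x" by fastforce
      then show "r \<in> U ` {-R1..R1}"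
      proof cases
        case 1
        then have "U x = U (-R1)" by (intro const) auto
        then show ?thesis using r R1 by auto
      next
        case 2 then show ?thesis using r by auto
      next
        case 3
        then have "U R1 = U x" by (intro const) auto
        then have "r = U R1" using r by simp
        then show ?thesis using R1 by auto
      qed
    qed
    moreover have "bounded (U ` {-R1..R1})"
      using U by (intro compact_imp_bounded compact_continuous_image DERIV_continuous_on[of _ _ w]) (auto intro: DERIV_subset)
    ultimately have U_bd: "bounded (range U)" by (rule bounded_subset[rotated])
    have tf: "test_function U w v"
      using U w' U_bd uniformly_continuous_on_compact_support[OF w_cont w0] uniformly_continuous_on_compact_support[OF v_cont v0]
      by unfold_locales auto
    \<comment> \<open>By the product rule the generator is the truncated \<open>lam - c0\<close>
      plus one term with the derivative of the cutoff, which is of order \<delta>.\<close>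
    have gen: "\<bar>(\<sigma>\<^sup>2 / 2 * v x - \<mu> * w x) - cutoff \<delta> x * (lam - c0 cb ch x)\<bar> \<le> C * \<delta>" for x
    proof -
      have "(\<sigma>\<^sup>2 / 2 * v x - \<mu> * w x) - cutoff \<delta> x * (lam - c0 cb ch x) = \<sigma>\<^sup>2 / 2 * (dV x * dcutoff \<delta> x)"
        unfolding generator_dV[symmetric] v_def w_def by (simp add: algebra_simps)
      also have "\<bar>\<dots>\<bar> = \<sigma>\<^sup>2 / 2 * (\<bar>dV x\<bar> * \<bar>dcutoff \<delta> x\<bar>)" by (simp add: abs_mult)
      also have "\<dots> \<le> \<sigma>\<^sup>2 / 2 * (A * (1 + \<bar>x\<bar>) * \<bar>dcutoff \<delta> x\<bar>)"
        using A(2)[of x] by (intro mult_left_mono mult_right_mono) auto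
      also have "\<dots> = \<sigma>\<^sup>2 / 2 * A * (\<bar>dcutoff \<delta> x\<bar> * (1 + \<bar>x\<bar>))" by simp
      also have "\<dots> \<le> \<sigma>\<^sup>2 / 2 * A * (16 * \<delta>)" using A(1) dcutoff_bound[OF \<delta>(1)] by (intro mult_left_mono) auto
      also have "\<dots> = C * \<delta>" by (simp add: C_def)
      finally show ?thesis .
    qed
    have g1: "lam - C * \<delta> \<le> \<sigma>\<^sup>2 / 2 * v x - \<mu> * w x + c0 cb ch x" for x
    proof -
      \<comment> \<open>Within radius \<open>R0\<close> the first factor is 0; outside,
        \<open>lam\<close> is at most the holding cost.\<close>
      have "0 \<le> (1 - cutoff \<delta> x) * (c0 cb ch x - lam)"
        using near[of x] far_away(1)[of x] cutoff_bounds(2)[of \<delta> x] by (cases "\<bar>x\<bar> \<le> R0") auto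
      then show ?thesis using gen[of x] by (simp add: algebra_simps abs_le_iff)
    qed
    have g2: "\<sigma>\<^sup>2 / 2 * v x - \<mu> * w x \<le> lam - cutoff \<delta> x * c0 cb ch x + C * \<delta>" for x
    proof -
      have "cutoff \<delta> x * lam \<le> lam" using cutoff_bounds[of \<delta> x] lam_pos by (simp add: mult_left_le_one_le)
      then show ?thesis using gen[of x] by (simp add: algebra_simps abs_le_iff)
    qed
    have ord: "U a - U b \<le> c1 k1 k2 a b" if "a \<le> b" for a b
    proof -
      \<comment> \<open>Replacing the end points by points \<open>a'\<close>, \<open>b'\<close>
        between them increases the left side by monotonicity of \<open>U\<close> and shortens the
        order; inside, the inequality for V applies. If both end points lie on one side of the
        interval, \<open>U a \<le> U b\<close> suffices.\<close>
      have ckey: "U a - U b \<le> c1 k1 k2 a b" if u: "U a \<le> U a'" "U b' \<le> U b" "\<bar>a'\<bar> \<le> R0" "\<bar>b'\<bar> \<le> R0" "a \<le> a'" "a' \<le> b'" "b' \<le> b" for a' b'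
      proof -
        have "U a - U b \<le> V a' - V b'" using u(1,2) U_near[OF u(4,3)] by linarith
        also have "\<dots> \<le> c1 k1 k2 a' b'" by (rule V_order[OF u(6)])
        also have "\<dots> \<le> c1 k1 k2 a b" using u pos by (simp add: c1_def mult_left_mono)
        finally show ?thesis .
      qed
      have c1_nn: "0 \<le> c1 k1 k2 a b" using that pos by (simp add: c1_def)
      consider "b \<le> - R0" | "R0 \<le> a" | "- R0 < b" "a < R0" by linarith
      then show ?thesis
      proof cases
        case 1 then show ?thesis using U_mono_left[OF 1 that] c1_nn by linarith
      next
        case 2 then show ?thesis using U_mono_right[OF 2 that] c1_nn by linarith
      next
        case 3
        show ?thesis
        proof (rule ckey[of "max (-R0) a" "min R0 b"])
          show "U a \<le> U (max (-R0) a)" by (cases "a \<le> - R0") (auto simp: max_def intro: U_mono_left)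
          show "U (min R0 b) \<le> U b" by (cases "R0 \<le> b") (auto simp: min_def intro: U_mono_right)
        qed (use 3 that R0_bounds(4) in auto)
      qed
    qed
    have m: "\<bar>min x0 ys\<bar> \<le> R0" using R0_bounds by (auto simp: min_def)
    have o1: "U ys - U zs = c1 k1 k2 ys zs"
      using U_near[OF R0_bounds(2,1)] V_order_eq by linarith
    have o2: "c1 k1 k2 (min x0 ys) zs \<le> U (min x0 ys) - U zs + D"
      using U_near[OF R0_bounds(2) m] K[OF m] K[OF R0_bounds(2)] unfolding D_def by linarith
    \<comment> \<open>Since \<open>min x0 ys\<close> is at least \<open>- R0\<close>, the point
      \<open>x\<close> can leave the interval only to the right, where \<open>U\<close> is
      nondecreasing.\<close>
    have o3: "U x0 - U x \<le> D" if "min x0 ys \<le> x" for x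
    proof -
      have x: "\<bar>min R0 x\<bar> \<le> R0" using m that R0_bounds(4) by (auto simp: min_def abs_if split: if_splits)
      have "U (min R0 x) \<le> U x" by (cases "R0 \<le> x") (auto simp: min_def intro: U_mono_right)
      then show ?thesis using U_near[OF x R0_bounds(3)] K[OF x] K[OF R0_bounds(3)] unfolding D_def by linarith
    qed
    show ?thesis unfolding certificate_def using tf g1 g2 ord o1 o2 o3 by blast
  qed
  ultimately show ?thesis by blast
qed

end

section \<open>Lower bound for admissible policies\<close>

lemma ennreal_plus_le: "ennreal (a + b) \<le> ennreal a + ennreal b"
proof -
  have "ennreal (a + b) \<le> ennreal (max 0 a + max 0 b)" by (rule ennreal_leI) simp
  also have "\<dots> = ennreal (max 0 a) + ennreal (max 0 b)" by (rule ennreal_plus) auto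
  also have "ennreal (max 0 a) = ennreal a" by (auto simp: max_def ennreal_neg)
  also have "ennreal (max 0 b) = ennreal b" by (auto simp: max_def ennreal_neg)
  finally show ?thesis .
qed

lemma ennreal_sum_le: "ennreal (\<Sum>i\<in>A. f i) \<le> (\<Sum>i\<in>A. ennreal (f i))"
proof (induction A rule: infinite_finite_induct)
  case (insert x A)
  then show ?case using ennreal_plus_le[of "f x" "sum f A"] by (auto intro: order_trans add_left_mono)
qed auto

lemma ennreal_integral_le_nn_integral:
  assumes "integrable M f"
  shows "ennreal (\<integral>x. f x \<partial>M) \<le> (\<integral>\<^sup>+x. ennreal (f x) \<partial>M)"
proof -
  have i: "integrable M (\<lambda>x. max 0 (f x))" using assms by auto
  have "ennreal (\<integral>x. f x \<partial>M) \<le> ennreal (\<integral>x. max 0 (f x) \<partial>M)"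
    using assms i by (intro ennreal_leI integral_mono) auto
  also have "\<dots> = (\<integral>\<^sup>+x. ennreal (max 0 (f x)) \<partial>M)"
    using i by (intro nn_integral_eq_integral[symmetric]) auto
  also have "\<dots> = (\<integral>\<^sup>+x. ennreal (f x) \<partial>M)"
    by (intro nn_integral_cong) (auto simp: max_def ennreal_neg)
  finally show ?thesis .
qed

lemma sum_le_suminf_ennreal: "finite A \<Longrightarrow> (\<Sum>i\<in>A. f i) \<le> (\<Sum>i. f i :: ennreal)"
  by (rule sum_le_suminf) auto

abbreviation order_time :: "'a policy \<Rightarrow> nat \<Rightarrow> 'a \<Rightarrow> ennreal" where
  "order_time p k \<equiv> fst p (Suc k)"

abbreviation order_qty :: "'a policy \<Rightarrow> nat \<Rightarrow> 'a \<Rightarrow> real" where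
  "order_qty p k \<equiv> snd p (Suc k)"

lemma inventory_finite:
  assumes "finite {k. order_time p k \<omega> \<le> ennreal s}"
  shows "inventory X p s \<omega> = X s \<omega> + (\<Sum>k\<in>{k. order_time p k \<omega> \<le> ennreal s}. order_qty p k \<omega>)"
    and "summable (ordered p s \<omega>)"
proof -
  have "(\<Sum>k. ordered p s \<omega> k) = (\<Sum>k\<in>{k. order_time p k \<omega> \<le> ennreal s}. ordered p s \<omega> k)"
    using assms by (intro suminf_finite) (auto simp: ordered_def)
  then show "inventory X p s \<omega> = X s \<omega> + (\<Sum>k\<in>{k. order_time p k \<omega> \<le> ennreal s}. order_qty p k \<omega>)"
    by (simp add: inventory_def ordered_def)
  show "summable (ordered p s \<omega>)"
    using assms by (intro summable_finite[of "{k. order_time p k \<omega> \<le> ennreal s}"]) (auto simp: ordered_def)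
qed

text \<open>With finitely many orders before \<open>r\<close>, the set of orders placed is constant
  just to the left of \<open>r\<close>, and only \<open>X0\<close> moves.\<close>

lemma inventory_left_finite:
  assumes cont: "continuous_on {0..} (\<lambda>s. X s \<omega>)" and r: "0 < r"
    and fin: "finite {k. order_time p k \<omega> < ennreal r}"
  shows "inventory_left X x0 p r \<omega> = X r \<omega> + (\<Sum>k\<in>{k. order_time p k \<omega> < ennreal r}. order_qty p k \<omega>)"
proof -
  let ?K = "{k. order_time p k \<omega> < ennreal r}"
  have "eventually (\<lambda>s. \<forall>k\<in>?K. order_time p k \<omega> \<le> ennreal s) (at_left r)"
  proof (intro eventually_ball_finite fin ballI)
    fix k assume "k \<in> ?K"
    then have k: "order_time p k \<omega> < ennreal r" by simp
    then have e: "order_time p k \<omega> = ennreal (enn2real (order_time p k \<omega>))" by (metis ennreal_enn2real ennreal_less_top order_less_trans)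
    then have "enn2real (order_time p k \<omega>) < r" using k by (metis ennreal_less_iff enn2real_nonneg)
    then have "eventually (\<lambda>s. enn2real (order_time p k \<omega>) < s) (at_left r)" by (rule eventually_at_left_real[THEN eventually_mono]) auto
    then show "eventually (\<lambda>s. order_time p k \<omega> \<le> ennreal s) (at_left r)"
    proof eventually_elim
      case (elim s)
      then show ?case using e by (metis ennreal_leI less_imp_le)
    qed
  qed
  moreover have "eventually (\<lambda>s. s \<in> {0<..<r}) (at_left r)" using r by (rule eventually_at_left_real)
  ultimately have ev: "eventually (\<lambda>s. inventory X p s \<omega> = X s \<omega> + (\<Sum>k\<in>?K. order_qty p k \<omega>)) (at_left r)"
  proof eventually_elim
    case (elim s)
    then have "{k. order_time p k \<omega> \<le> ennreal s} = ?K"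
      by (auto intro: order_le_less_trans simp: ennreal_less_iff)
    then show ?case using inventory_finite(1)[of p \<omega> s X] fin by simp
  qed
  have "((\<lambda>s. X s \<omega>) \<longlongrightarrow> X r \<omega>) (at r within {0..})" using cont r by (simp add: continuous_on_def)
  moreover have "at r within {0..} = at r" by (rule at_within_interior) (use r in \<open>simp add: interior_Ici\<close>)
  ultimately have "((\<lambda>s. X s \<omega>) \<longlongrightarrow> X r \<omega>) (at_left r)" by (simp add: filterlim_at_split)
  then have "((\<lambda>s. X s \<omega> + (\<Sum>k\<in>?K. order_qty p k \<omega>)) \<longlongrightarrow> X r \<omega> + (\<Sum>k\<in>?K. order_qty p k \<omega>)) (at_left r)"
    by (intro tendsto_add tendsto_const)
  then have "((\<lambda>s. inventory X p s \<omega>) \<longlongrightarrow> X r \<omega> + (\<Sum>k\<in>?K. order_qty p k \<omega>)) (at_left r)"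
    by (rule Lim_transform_eventually) (use ev in eventually_elim, simp)
  then have "Lim (at_left r) (\<lambda>s. inventory X p s \<omega>) = X r \<omega> + (\<Sum>k\<in>?K. order_qty p k \<omega>)"
    by (intro tendsto_Lim) auto
  then show ?thesis using r by (simp add: inventory_left_def)
qed

section \<open>From the augmented filtration to completed histories\<close>

context drifted_brownian_motion
begin

lemma space_augmented [simp]: "space (augmented_filtration M X0 t) = space M"
  unfolding augmented_filtration_def by (simp add: space_measure_of_conv)

lemma sets_augmented:
  "sets (augmented_filtration M X0 t) = sigma_sets (space M) (\<Inter>s\<in>{s. t < s \<or> s = \<infinity>}. sets (completed_history M X0 s))"
proof -
  have "(\<Inter>s\<in>{s. t < s \<or> s = \<infinity>}. sets (completed_history M X0 s)) \<subseteq> sets (completed_history M X0 \<infinity>)" by blast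
  also have "\<dots> \<subseteq> Pow (space M)" using sets.space_closed[of "completed_history M X0 \<infinity>"] by simp
  finally show ?thesis unfolding augmented_filtration_def by (subst sets_measure_of) auto
qed

lemma augmented_subset_history:
  assumes "t < s \<or> s = \<infinity>"
  shows "sets (augmented_filtration M X0 t) \<subseteq> sets (completed_history M X0 s)"
proof -
  have "(\<Inter>s\<in>{s. t < s \<or> s = \<infinity>}. sets (completed_history M X0 s)) \<subseteq> sets (completed_history M X0 s)"
    using assms by (intro INF_lower) simp
  from sets.sigma_sets_subset[OF this] show ?thesis unfolding sets_augmented by simp
qed

lemma augmentedI:
  assumes "\<And>s. t < s \<or> s = \<infinity> \<Longrightarrow> A \<in> sets (completed_history M X0 s)"
  shows "A \<in> sets (augmented_filtration M X0 t)"
  unfolding sets_augmented by (rule sigma_sets.Basic) (use assms in auto)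

lemma filtration_augmented: "filtration (space M) (augmented_filtration M X0)"
proof
  fix i j :: ennreal assume "i \<le> j"
  then show "sets (augmented_filtration M X0 i) \<le> sets (augmented_filtration M X0 j)"
    unfolding sets_augmented by (intro sigma_sets_mono') (auto intro: order_le_less_trans)
qed simp

text \<open>The augmented filtration at \<open>s\<close> is contained in the completed history at
  any \<open>u > s\<close>. The complement of \<open>G\<close> is null and hence belongs to every
  completed history, so restricting the orders to \<open>G\<close> preserves adaptedness.\<close>

lemma admissible_adapted:
  assumes p: "p \<in> admissible M (augmented_filtration M X0)"
    and G: "G \<in> sets P" "AE \<omega> in P. \<omega> \<in> G"
  shows "ordering M W \<mu> \<sigma> x0 (\<lambda>k \<omega>. if \<omega> \<in> G then order_time p k \<omega> else \<infinity>) (order_qty p)"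
proof
  let ?F = "augmented_filtration M X0"
  interpret filtration "space M" ?F by (rule filtration_augmented)
  have T: "stopping_time ?F (order_time p k)" and mono: "\<And>\<omega>. \<omega> \<in> space M \<Longrightarrow> order_time p k \<omega> \<le> order_time p (Suc k) \<omega>"
    and Q: "order_qty p k \<in> borel_measurable (pre_sigma (order_time p k))" for k
    using p unfolding admissible_def by (auto simp: case_prod_beta)
  have GH: "G \<in> sets (completed_history M X0 s)" for s
  proof -
    have "space M - G \<in> null_sets P"
    proof (rule AE_iff_null_sets[THEN iffD2])
      show "space M - G \<in> sets P" using sets.compl_sets[OF G(1)] by simp
      show "AE \<omega> in P. \<omega> \<notin> space M - G" using G(2) by eventually_elim simp
    qed
    then have "space M - G \<in> sets (completed_history M X0 s)" by (rule null_sets_completed_history)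
    from sets.compl_sets[OF this] show ?thesis using G(1) sets.sets_into_space[OF G(1)] by (simp add: double_diff)
  qed
  show "\<And>k \<omega>. \<omega> \<in> space M \<Longrightarrow> (if \<omega> \<in> G then order_time p k \<omega> else \<infinity>) \<le> (if \<omega> \<in> G then order_time p (Suc k) \<omega> else \<infinity>)"
    using mono by auto
  fix k and s u :: real assume su: "0 \<le> s" "s < u"
  have sub: "sets (?F (ennreal s)) \<subseteq> sets (\<H> u)"
    using su by (intro augmented_subset_history) (simp add: ennreal_less_iff)
  have Ts: "{\<omega>\<in>space M. order_time p k \<omega> \<le> ennreal s} \<in> sets (\<H> u)"
    using stopping_timeD[OF T[of k], of "ennreal s"] sub by (auto simp: pred_def)
  have "{\<omega>\<in>space M. (if \<omega> \<in> G then order_time p k \<omega> else \<infinity>) \<le> ennreal s} = {\<omega>\<in>space M. order_time p k \<omega> \<le> ennreal s} \<inter> G"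
    by (auto simp: top_unique split: if_splits)
  then show "{\<omega>\<in>space M. (if \<omega> \<in> G then order_time p k \<omega> else \<infinity>) \<le> ennreal s} \<in> sets (\<H> u)"
    using Ts GH by auto
  have "(\<lambda>\<omega>. if order_time p k \<omega> \<le> ennreal s then order_qty p k \<omega> else 0) \<in> borel_measurable (\<H> u)"
  proof (rule measurableI)
    fix B :: "real set" assume B: "B \<in> sets borel"
    have "order_qty p k -` B \<inter> space M \<in> sets (pre_sigma (order_time p k))"
      using measurable_sets[OF Q[of k] B] by (simp add: space_pre_sigma)
    from sets_pre_sigmaD[OF T[of k] this, of "ennreal s"]
    have 1: "{\<omega> \<in> order_qty p k -` B \<inter> space M. order_time p k \<omega> \<le> ennreal s} \<in> sets (\<H> u)" using sub by blast
    have "(\<lambda>\<omega>. if order_time p k \<omega> \<le> ennreal s then order_qty p k \<omega> else 0) -` B \<inter> space (\<H> u)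
       = {\<omega> \<in> order_qty p k -` B \<inter> space M. order_time p k \<omega> \<le> ennreal s}
       \<union> (if 0 \<in> B then space M - {\<omega>\<in>space M. order_time p k \<omega> \<le> ennreal s} else {})"
      by (auto split: if_splits)
    moreover have "space M - {\<omega>\<in>space M. order_time p k \<omega> \<le> ennreal s} \<in> sets (\<H> u)"
      using sets.compl_sets[OF Ts] by simp
    ultimately show "(\<lambda>\<omega>. if order_time p k \<omega> \<le> ennreal s then order_qty p k \<omega> else 0) -` B \<inter> space (\<H> u) \<in> sets (\<H> u)"
      using 1 by auto
  qed simp
  then have "(\<lambda>\<omega>. if \<omega> \<in> G then (if order_time p k \<omega> \<le> ennreal s then order_qty p k \<omega> else 0) else 0) \<in> borel_measurable (\<H> u)"
    using GH sets.sets_into_space[OF G(1)] by (intro measurable_If_set) (auto simp: Int_absorb2)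
  moreover have "(\<lambda>\<omega>. if \<omega> \<in> G then (if order_time p k \<omega> \<le> ennreal s then order_qty p k \<omega> else 0) else 0)
    = (\<lambda>\<omega>. if (if \<omega> \<in> G then order_time p k \<omega> else \<infinity>) \<le> ennreal s then order_qty p k \<omega> else 0)"
    by (auto simp: top_unique)
  ultimately show "(\<lambda>\<omega>. if (if \<omega> \<in> G then order_time p k \<omega> else \<infinity>) \<le> ennreal s then order_qty p k \<omega> else 0) \<in> borel_measurable (\<H> u)"
    by simp
qed

end

section \<open>The number of orders as a random variable\<close>

context ordering
begin

lemma T_less_sets: "{\<omega>\<in>space M. T k \<omega> < ennreal t} \<in> sets P"
proof -
  have eq: "{\<omega>\<in>space M. T k \<omega> < ennreal t} = (\<Union>q\<in>{q::rat. 0 \<le> q \<and> real_of_rat q < t}. {\<omega>\<in>space M. T k \<omega> \<le> ennreal (real_of_rat q)})"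
  proof (intro equalityI subsetI)
    fix \<omega> assume "\<omega> \<in> {\<omega>\<in>space M. T k \<omega> < ennreal t}"
    then have om: "\<omega> \<in> space M" "T k \<omega> < ennreal t" by auto
    then have e: "T k \<omega> = ennreal (enn2real (T k \<omega>))" by (metis ennreal_enn2real ennreal_less_top order_less_trans)
    then have "enn2real (T k \<omega>) < t" using om by (metis ennreal_less_iff enn2real_nonneg)
    then obtain q where q: "enn2real (T k \<omega>) < real_of_rat q" "real_of_rat q < t" using of_rat_dense by blast
    then have "0 \<le> q" by (metis enn2real_nonneg of_rat_less_0_iff order_le_less_trans not_less order_less_le)
    moreover have "T k \<omega> \<le> ennreal (real_of_rat q)" using q e by (metis ennreal_leI less_imp_le)
    ultimately show "\<omega> \<in> (\<Union>q\<in>{q::rat. 0 \<le> q \<and> real_of_rat q < t}. {\<omega>\<in>space M. T k \<omega> \<le> ennreal (real_of_rat q)})"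
      using om q by blast
  next
    fix \<omega> assume "\<omega> \<in> (\<Union>q\<in>{q::rat. 0 \<le> q \<and> real_of_rat q < t}. {\<omega>\<in>space M. T k \<omega> \<le> ennreal (real_of_rat q)})"
    then obtain q :: rat where q: "0 \<le> q" "real_of_rat q < t" "\<omega> \<in> space M" "T k \<omega> \<le> ennreal (real_of_rat q)" by blast
    then have "ennreal (real_of_rat q) < ennreal t" by (simp add: ennreal_less_iff)
    then show "\<omega> \<in> {\<omega>\<in>space M. T k \<omega> < ennreal t}" using q by auto
  qed
  show ?thesis unfolding eq
  proof (intro sets.countable_UN'')
    fix q assume "q \<in> {q::rat. 0 \<le> q \<and> real_of_rat q < t}"
    then have "{\<omega>\<in>space M. T k \<omega> \<le> ennreal (real_of_rat q)} \<in> sets (\<H> (real_of_rat q + 1))"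
      by (intro T_adapted) auto
    then show "{\<omega>\<in>space M. T k \<omega> \<le> ennreal (real_of_rat q)} \<in> sets P" using sets_completed_history_subset by blast
  qed auto
qed

lemma order_count_measurable: "(\<lambda>\<omega>. \<Sum>k. if T k \<omega> < ennreal t then 1 else 0 :: ennreal) \<in> borel_measurable P"
proof (intro borel_measurable_suminf_order measurable_If measurable_const)
  fix k show "{x \<in> space P. T k x < ennreal t} \<in> sets P" using T_less_sets[of k t] by simp
qed simp_all

lemma order_count_finite:
  assumes "finite {k. T k \<omega> < ennreal t}"
  shows "(\<Sum>k. if T k \<omega> < ennreal t then 1 else 0 :: ennreal) = ennreal (real (N t \<omega>))"
proof -
  have "(\<Sum>k. if T k \<omega> < ennreal t then 1 else 0 :: ennreal) = (\<Sum>k\<in>{k. T k \<omega> < ennreal t}. if T k \<omega> < ennreal t then 1 else 0)"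
    using assms by (intro suminf_finite) auto
  also have "\<dots> = of_nat (N t \<omega>)" by (simp add: N_def)
  finally show ?thesis by (simp add: ennreal_of_nat_eq_real_of_nat)
qed

lemma integrable_N:
  assumes fin: "\<And>\<omega>. \<omega> \<in> space M \<Longrightarrow> finite {k. T k \<omega> < ennreal t}"
    and "(\<integral>\<^sup>+\<omega>. (\<Sum>k. if T k \<omega> < ennreal t then 1 else 0) \<partial>P) < \<infinity>"
  shows "integrable P (\<lambda>\<omega>. real (N t \<omega>))"
proof (rule integrableI_nonneg)
  have "(\<lambda>\<omega>. enn2real (\<Sum>k. if T k \<omega> < ennreal t then 1 else 0)) \<in> borel_measurable P"
    by (rule measurable_compose[OF order_count_measurable]) simp
  then show "(\<lambda>\<omega>. real (N t \<omega>)) \<in> borel_measurable P"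
    by (rule measurable_cong[THEN iffD1, rotated]) (simp add: order_count_finite[OF fin])
  have "(\<integral>\<^sup>+\<omega>. ennreal (real (N t \<omega>)) \<partial>P) = (\<integral>\<^sup>+\<omega>. (\<Sum>k. if T k \<omega> < ennreal t then 1 else 0) \<partial>P)"
    by (rule nn_integral_cong) (simp add: order_count_finite[OF fin])
  then show "(\<integral>\<^sup>+\<omega>. ennreal (real (N t \<omega>)) \<partial>P) < \<infinity>" using assms(2) by simp
qed simp

end

lemma suminf_infinite_const:
  assumes "infinite {k. c k}" "0 < a"
  shows "(\<Sum>k. if c k then ennreal a else 0) = \<infinity>"
proof (rule ccontr)
  assume "\<not> ?thesis"
  then have "(\<Sum>k. if c k then ennreal a else 0) < \<infinity>" by (simp add: less_top)
  then obtain n :: nat where n: "(\<Sum>k. if c k then ennreal a else 0) < ennreal (real n * a)"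
  proof -
    obtain r where r: "0 \<le> r" "(\<Sum>k. if c k then ennreal a else 0) = ennreal r"
      using \<open>(\<Sum>k. if c k then ennreal a else 0) < \<infinity>\<close> by (cases "(\<Sum>k. if c k then ennreal a else 0)") auto
    obtain n where "r < real n * a" using reals_Archimedean3[OF \<open>0 < a\<close>] by blast
    then show ?thesis using that[of n] r by (simp add: ennreal_less_iff)
  qed
  obtain A where A: "A \<subseteq> {k. c k}" "card A = n" "finite A" using infinite_arbitrarily_large[OF assms(1)] by blast
  have "ennreal (real n * a) = (\<Sum>k\<in>A. ennreal a)" using A assms(2) by (simp add: ennreal_mult ennreal_of_nat_eq_real_of_nat)
  also have "\<dots> = (\<Sum>k\<in>A. if c k then ennreal a else 0)" using A by (intro sum.cong) auto
  also have "\<dots> \<le> (\<Sum>k. if c k then ennreal a else 0)" by (rule sum_le_suminf_ennreal[OF A(3)])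
  finally show False using n by simp
qed

section \<open>Pathwise and expected cost of an arbitrary policy\<close>

context drifted_brownian_motion
begin

text \<open>Each of several simultaneous orders is charged for the whole jump of the inventory at
  that time, which is at least its own quantity because quantities are nonnegative.\<close>

lemma cost_ge_orders:
  assumes om: "\<omega> \<in> space M" and mono: "\<And>k. order_time p k \<omega> \<le> order_time p (Suc k) \<omega>"
    and nn: "\<And>k. 0 \<le> order_qty p k \<omega>" and k12: "0 < k1" "0 < k2" and t: "0 \<le> t"
  shows "(\<integral>\<^sup>+s\<in>{0..t}. ennreal (f (inventory X0 p s \<omega>)) \<partial>lborel)
     + (\<Sum>k. if order_time p k \<omega> \<le> ennreal t then ennreal (k1 + k2 * order_qty p k \<omega>) else 0) \<le> cost_upto f (c1 k1 k2) X0 x0 p t \<omega>"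
proof (cases "summable (ordered p t \<omega>)")
  case False then show ?thesis by (simp add: cost_upto_def)
next
  case True
  have "(if order_time p k \<omega> \<le> ennreal t then ennreal (k1 + k2 * order_qty p k \<omega>) else 0)
    \<le> (if order_time p k \<omega> \<le> ennreal t then
             (let r = enn2real (order_time p k \<omega>)
              in ennreal (c1 k1 k2 (inventory_left X0 x0 p r \<omega>) (inventory X0 p r \<omega>)))
            else 0)" for k
  proof (cases "order_time p k \<omega> \<le> ennreal t")
    case False then show ?thesis by simp
  next
    case k: True
    define r where "r = enn2real (order_time p k \<omega>)"
    have r: "order_time p k \<omega> = ennreal r" "0 \<le> r" using k unfolding r_def by (metis ennreal_enn2real ennreal_less_top order_le_less_trans) simp
    then have rt: "r \<le> t" using k t by (simp add: ennreal_le_iff)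
    have mono': "order_time p i \<omega> \<le> order_time p j \<omega>" if "i \<le> j" for i j
      using that by (induction rule: dec_induct) (auto intro: order_trans[OF _ mono])
    \<comment> \<open>Orders strictly before \<open>r\<close> have smaller indices, so the left
      limit involves finitely many orders even if infinitely many are placed at
      \<open>r\<close>.\<close>
    have lt: "j < k" if "order_time p j \<omega> < ennreal r" for j
      using that mono'[of k j] r by (metis leD linorder_not_less)
    then have fin: "finite {j. order_time p j \<omega> < ennreal r}" by (auto intro: finite_subset[of _ "{..<k}"])
    have sr: "summable (ordered p r \<omega>)"
    proof (rule summable_comparison_test'[OF True])
      fix n show "norm (ordered p r \<omega> n) \<le> ordered p t \<omega> n"
        using nn[of n] rt by (auto simp: ordered_def intro: order_trans[OF _ ennreal_leI])
    qed
    have "(\<Sum>j\<in>insert k {j. order_time p j \<omega> < ennreal r}. ordered p r \<omega> j) \<le> (\<Sum>j. ordered p r \<omega> j)"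
      using nn fin by (intro sum_le_suminf sr) (auto simp: ordered_def)
    moreover have "(\<Sum>j\<in>insert k {j. order_time p j \<omega> < ennreal r}. ordered p r \<omega> j) = order_qty p k \<omega> + (\<Sum>j\<in>{j. order_time p j \<omega> < ennreal r}. order_qty p j \<omega>)"
      using fin r by (auto simp: ordered_def intro!: sum.cong)
    ultimately have inv: "X0 r \<omega> + order_qty p k \<omega> + (\<Sum>j\<in>{j. order_time p j \<omega> < ennreal r}. order_qty p j \<omega>) \<le> inventory X0 p r \<omega>"
      unfolding inventory_def by linarith
    have left: "inventory_left X0 x0 p r \<omega> = X0 r \<omega> + (\<Sum>j\<in>{j. order_time p j \<omega> < ennreal r}. order_qty p j \<omega>)"
    proof (cases "r = 0")
      case True then show ?thesis by (simp add: inventory_left_def X0_zero[OF om])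
    next
      case False then show ?thesis using r(2) fin X0_continuous[OF om] by (intro inventory_left_finite) auto
    qed
    have "k1 + k2 * order_qty p k \<omega> \<le> c1 k1 k2 (inventory_left X0 x0 p r \<omega>) (inventory X0 p r \<omega>)"
      unfolding c1_def using inv k12 by (intro add_left_mono mult_left_mono) (auto simp: left)
    then show ?thesis using k by (simp add: Let_def r_def[symmetric] ennreal_leI)
  qed
  then have "(\<Sum>k. if order_time p k \<omega> \<le> ennreal t then ennreal (k1 + k2 * order_qty p k \<omega>) else 0)
    \<le> (\<Sum>k. if order_time p k \<omega> \<le> ennreal t then
             (let r = enn2real (order_time p k \<omega>)
              in ennreal (c1 k1 k2 (inventory_left X0 x0 p r \<omega>) (inventory X0 p r \<omega>)))
            else 0)"
    by (intro suminf_le) auto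
  then show ?thesis using True by (simp add: cost_upto_def add_left_mono)
qed

text \<open>If the expected number of orders is infinite, the fixed costs alone are infinite.
  Otherwise the formula of Ito applies, and its two values of \<open>U\<close>, at the start and at
  \<open>t\<close>, account for the loss of \<open>2 * B\<close>.\<close>

lemma cost_lower_bound:
  assumes p: "p \<in> admissible M (augmented_filtration M X0)" and k12: "0 < k1" "0 < k2" and t: "0 < t"
    and tf: "test_function U w v" and B: "\<And>x. \<bar>U x\<bar> \<le> B"
    and gen: "\<And>x. l \<le> gen w v x + f x"
    and ord: "\<And>a b. a \<le> b \<Longrightarrow> U a - U b \<le> c1 k1 k2 a b"
  shows "ennreal (l * t - 2 * B) \<le> (\<integral>\<^sup>+\<omega>. cost_upto f (c1 k1 k2) X0 x0 p t \<omega> \<partial>P)"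
proof -
  interpret test_function U w v by fact
  have mono: "\<And>k \<omega>. \<omega> \<in> space M \<Longrightarrow> order_time p k \<omega> \<le> order_time p (Suc k) \<omega>"
    and nn: "\<And>k \<omega>. \<omega> \<in> space M \<Longrightarrow> 0 \<le> order_qty p k \<omega>"
    using p unfolding admissible_def by (auto simp: case_prod_beta)
  let ?cnt = "\<lambda>\<omega>. \<Sum>k. if order_time p k \<omega> < ennreal t then 1 else 0 :: ennreal"
  let ?cost = "\<lambda>\<omega>. cost_upto f (c1 k1 k2) X0 x0 p t \<omega>"
  have cnt_meas: "?cnt \<in> borel_measurable P"
    by (rule measurable_cong[THEN iffD1, OF _ ordering.order_count_measurable[OF admissible_adapted[OF p sets.top AE_space], of t]]) auto
  have cnt_le: "ennreal k1 * ?cnt \<omega> \<le> ?cost \<omega>" if om: "\<omega> \<in> space M" for \<omega>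
  proof -
    have "ennreal k1 * ?cnt \<omega> = (\<Sum>k. ennreal k1 * (if order_time p k \<omega> < ennreal t then 1 else 0))" by (rule ennreal_suminf_cmult[symmetric])
    also have "\<dots> \<le> (\<Sum>k. if order_time p k \<omega> \<le> ennreal t then ennreal (k1 + k2 * order_qty p k \<omega>) else 0)"
      using nn[OF om] k12 by (intro suminf_le) (auto intro!: ennreal_leI)
    also have "\<dots> \<le> (\<integral>\<^sup>+s\<in>{0..t}. ennreal (f (inventory X0 p s \<omega>)) \<partial>lborel) + \<dots>" by simp
    also have "\<dots> \<le> ?cost \<omega>" by (rule cost_ge_orders) (use om mono nn k12 t in auto)
    finally show ?thesis .
  qed
  show ?thesis
  proof (cases "(\<integral>\<^sup>+\<omega>. ?cnt \<omega> \<partial>P) < \<infinity>")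
    case False
    then have "\<infinity> = ennreal k1 * (\<integral>\<^sup>+\<omega>. ?cnt \<omega> \<partial>P)" using k12 by (simp add: less_top[symmetric] ennreal_mult_top)
    also have "\<dots> = (\<integral>\<^sup>+\<omega>. ennreal k1 * ?cnt \<omega> \<partial>P)" by (rule nn_integral_cmult[symmetric]) (rule cnt_meas)
    also have "\<dots> \<le> (\<integral>\<^sup>+\<omega>. ?cost \<omega> \<partial>P)" by (intro nn_integral_mono cnt_le) simp
    finally have "(\<integral>\<^sup>+\<omega>. ?cost \<omega> \<partial>P) = \<infinity>" by (simp add: top_unique)
    then show ?thesis by simp
  next
    case True
    define G where "G = {\<omega>\<in>space M. ?cnt \<omega> < \<infinity>}"
    have GP: "G \<in> sets P"
    proof -
      have "?cnt -` {..<\<infinity>} \<inter> space P \<in> sets P" by (rule measurable_sets[OF cnt_meas]) simp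
      moreover have "?cnt -` {..<\<infinity>} \<inter> space P = G" by (auto simp only: G_def space_completion)
      ultimately show ?thesis by (simp only:)
    qed
    have "AE \<omega> in P. ?cnt \<omega> \<noteq> \<infinity>"
      by (rule nn_integral_PInf_AE[OF cnt_meas]) (use True in auto)
    then have GAE: "AE \<omega> in P. \<omega> \<in> G" using AE_space by eventually_elim (auto simp: G_def less_top)
    txt \<open>Moving the order times to \<open>\<infinity>\<close> on the null set of paths with infinitely many orders keeps the
      policy adapted, because the history is completed.\<close>
    define T' where "T' k \<omega> = (if \<omega> \<in> G then order_time p k \<omega> else \<infinity>)" for k \<omega>
    interpret O': ordering M W \<mu> \<sigma> x0 T' "order_qty p"
      unfolding T'_def by (rule admissible_adapted[OF p GP GAE])
    have fin: "finite {k. T' k \<omega> < ennreal t}" if "\<omega> \<in> space M" for \<omega>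
    proof (cases "\<omega> \<in> G")
      case True
      then have "?cnt \<omega> < \<infinity>" unfolding G_def by blast
      then have c: "?cnt \<omega> \<noteq> \<infinity>" by (rule less_imp_neq)
      show ?thesis
      proof (rule ccontr)
        assume "infinite {k. T' k \<omega> < ennreal t}"
        then have "infinite {k. order_time p k \<omega> < ennreal t}" using True by (simp add: T'_def)
        from suminf_infinite_const[OF this zero_less_one] show False using c unfolding ennreal_1 by contradiction
      qed
    next
      case False then show ?thesis by (simp add: T'_def)
    qed
    have "(\<integral>\<^sup>+\<omega>. (\<Sum>k. if T' k \<omega> < ennreal t then 1 else 0) \<partial>P) \<le> (\<integral>\<^sup>+\<omega>. ?cnt \<omega> \<partial>P)"
      by (intro nn_integral_mono suminf_le) (auto simp: T'_def)
    then have Nint: "integrable P (\<lambda>\<omega>. real (O'.N t \<omega>))"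
      using True by (intro O'.integrable_N fin) auto
    note ito = O'.ito[OF tf t fin Nint]
    let ?I = "\<lambda>\<omega>. \<integral>s. indicator {0..<t} s * gen w v (X0 s \<omega> + O'.Z s \<omega>) \<partial>lborel"
    let ?J = "\<lambda>\<omega>. \<Sum>k<O'.N t \<omega>. O'.jump U k \<omega>"
    \<comment> \<open>An integrable minorant of the cost: \<open>ito\<close> gives its mean, and
      monotonicity of the nonnegative integral passes it to the cost. \<open>D\<close> may be
      negative, where conversion to \<open>ennreal\<close> clips it to 0; this only enters
      inequalities in the right direction.\<close>
    define D where "D \<omega> = (l * t - ?I \<omega>) + - ?J \<omega>" for \<omega>
    have Dint: "integrable P D" unfolding D_def using ito(1,2) by auto
    have "(\<integral>\<omega>. D \<omega> \<partial>P) = l * t - (\<integral>\<omega>. ?I \<omega> \<partial>P) - (\<integral>\<omega>. ?J \<omega> \<partial>P)"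
      unfolding D_def using ito(1,2) by (simp add: prob_space)
    also have "\<dots> = l * t + U x0 - (\<integral>\<omega>. U (X0 t \<omega> + O'.Zl t \<omega>) \<partial>P)" using ito(4) by simp
    also have "\<dots> \<ge> l * t - 2 * B"
    proof -
      have "(\<integral>\<omega>. U (X0 t \<omega> + O'.Zl t \<omega>) \<partial>P) \<le> (\<integral>\<omega>. B \<partial>P)"
      proof (intro integral_mono ito(3))
        fix \<omega> show "U (X0 t \<omega> + O'.Zl t \<omega>) \<le> B" using B[of "X0 t \<omega> + O'.Zl t \<omega>"] by linarith
      qed simp_all
      then have "(\<integral>\<omega>. U (X0 t \<omega> + O'.Zl t \<omega>) \<partial>P) \<le> B" by (simp add: prob_space)
      then show ?thesis using B[of x0] by linarith
    qed
    finally have ED: "l * t - 2 * B \<le> (\<integral>\<omega>. D \<omega> \<partial>P)" .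
    have D_le: "ennreal (D \<omega>) \<le> ?cost \<omega>" if om: "\<omega> \<in> space M" and omG: "\<omega> \<in> G" for \<omega>
    proof -
      have Teq: "T' k \<omega> = order_time p k \<omega>" for k using omG by (simp add: T'_def)
      have ipath: "integrable lborel (\<lambda>s. indicator {0..<t} s * gen w v (X0 s \<omega> + O'.Z s \<omega>))" by (rule O'.path_integrable[OF tf om fin[OF om]])
      note it = integral_indicator_const[OF less_imp_le[OF t], of l]
      have "ennreal (l * t - ?I \<omega>) = ennreal (\<integral>s. indicator {0..<t} s * l - indicator {0..<t} s * gen w v (X0 s \<omega> + O'.Z s \<omega>) \<partial>lborel)"
        unfolding Bochner_Integration.integral_diff[OF it(1) ipath] it(2) ..
      also have "\<dots> \<le> (\<integral>\<^sup>+s. ennreal (indicator {0..<t} s * l - indicator {0..<t} s * gen w v (X0 s \<omega> + O'.Z s \<omega>)) \<partial>lborel)"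
        by (rule ennreal_integral_le_nn_integral[OF Bochner_Integration.integrable_diff[OF it(1) ipath]])
      also have "\<dots> \<le> (\<integral>\<^sup>+s\<in>{0..t}. ennreal (f (inventory X0 p s \<omega>)) \<partial>lborel)"
      proof (rule nn_integral_mono)
        fix s
        show "ennreal (indicator {0..<t} s * l - indicator {0..<t} s * gen w v (X0 s \<omega> + O'.Z s \<omega>)) \<le> ennreal (f (inventory X0 p s \<omega>)) * indicator {0..t} s"
        proof (cases "s \<in> {0..<t}")
          case True
          have "finite {k. order_time p k \<omega> \<le> ennreal s}"
            using fin[OF om] True by (rule_tac finite_subset[of _ "{k. T' k \<omega> < ennreal t}"]) (auto simp: Teq ennreal_less_iff intro: order_le_less_trans)
          then have "inventory X0 p s \<omega> = X0 s \<omega> + O'.Z s \<omega>" by (simp add: inventory_finite O'.Z_def Teq)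
          then show ?thesis using True gen[of "X0 s \<omega> + O'.Z s \<omega>"] by (auto intro!: ennreal_leI simp: algebra_simps)
        qed (simp add: indicator_def)
      qed
      finally have 1: "ennreal (l * t - ?I \<omega>) \<le> (\<integral>\<^sup>+s\<in>{0..t}. ennreal (f (inventory X0 p s \<omega>)) \<partial>lborel)" .
      have "ennreal (- ?J \<omega>) = ennreal (\<Sum>k<O'.N t \<omega>. - O'.jump U k \<omega>)" by (simp add: sum_negf)
      also have "\<dots> \<le> (\<Sum>k<O'.N t \<omega>. ennreal (- O'.jump U k \<omega>))" by (rule ennreal_sum_le)
      also have "\<dots> \<le> (\<Sum>k<O'.N t \<omega>. if order_time p k \<omega> \<le> ennreal t then ennreal (k1 + k2 * order_qty p k \<omega>) else 0)"
      proof (rule sum_mono)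
        fix k assume "k \<in> {..<O'.N t \<omega>}"
        then have "order_time p k \<omega> < ennreal t" using O'.less_iff[OF om fin[OF om], of k] Teq by simp
        moreover have "- O'.jump U k \<omega> \<le> k1 + k2 * order_qty p k \<omega>"
        proof -
          let ?x = "X0 (enn2real (T' k \<omega>)) \<omega>"
          have "U (?x + O'.S k \<omega>) - U (?x + O'.S (Suc k) \<omega>) \<le> c1 k1 k2 (?x + O'.S k \<omega>) (?x + O'.S (Suc k) \<omega>)"
            using nn[OF om, of k] by (intro ord) (simp add: O'.S_def)
          also have "\<dots> = k1 + k2 * order_qty p k \<omega>" by (simp add: c1_def O'.S_def)
          finally show ?thesis by (simp add: O'.jump_def Let_def)
        qed
        ultimately show "ennreal (- O'.jump U k \<omega>) \<le> (if order_time p k \<omega> \<le> ennreal t then ennreal (k1 + k2 * order_qty p k \<omega>) else 0)"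
          by (auto intro: ennreal_leI)
      qed
      also have "\<dots> \<le> (\<Sum>k. if order_time p k \<omega> \<le> ennreal t then ennreal (k1 + k2 * order_qty p k \<omega>) else 0)"
        by (rule sum_le_suminf_ennreal) simp
      finally have 2: "ennreal (- ?J \<omega>) \<le> (\<Sum>k. if order_time p k \<omega> \<le> ennreal t then ennreal (k1 + k2 * order_qty p k \<omega>) else 0)" .
      have "ennreal (D \<omega>) \<le> ennreal (l * t - ?I \<omega>) + ennreal (- ?J \<omega>)" unfolding D_def by (rule ennreal_plus_le)
      also have "\<dots> \<le> (\<integral>\<^sup>+s\<in>{0..t}. ennreal (f (inventory X0 p s \<omega>)) \<partial>lborel) + (\<Sum>k. if order_time p k \<omega> \<le> ennreal t then ennreal (k1 + k2 * order_qty p k \<omega>) else 0)"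
        by (rule add_mono[OF 1 2])
      also have "\<dots> \<le> ?cost \<omega>" by (rule cost_ge_orders) (use om mono nn k12 t in auto)
      finally show ?thesis .
    qed
    have "ennreal (l * t - 2 * B) \<le> ennreal (\<integral>\<omega>. D \<omega> \<partial>P)" by (rule ennreal_leI[OF ED])
    also have "\<dots> \<le> (\<integral>\<^sup>+\<omega>. ennreal (D \<omega>) \<partial>P)" by (rule ennreal_integral_le_nn_integral[OF Dint])
    also have "\<dots> \<le> (\<integral>\<^sup>+\<omega>. ?cost \<omega> \<partial>P)"
      using GAE AE_space[of P] by (intro nn_integral_mono_AE) (auto elim!: eventually_elim2 intro: D_le)
    finally show ?thesis .
  qed
qed

end

section \<open>Paths of the (y, z) policy\<close>

lemma ennreal_cases_time:
  fixes T :: ennreal assumes "T \<noteq> \<infinity>"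
  obtains r where "T = ennreal r" "0 \<le> r"
  using assms by (cases T) auto

locale yz_setting = drifted_brownian_motion M W \<mu> \<sigma> x0
  for M :: "'a measure" and W :: "real \<Rightarrow> 'a \<Rightarrow> real" and \<mu> \<sigma> x0 :: real +
  fixes y z :: real
  assumes y_less_z: "y < z"
begin

text \<open>Only positive times qualify, as each order time is an infimum over times after the
  previous one and that of index 0 is 0. The infimum itself can be 0, for instance when
  \<open>x0 < l\<close>.\<close>

definition "hit l \<omega> = Inf {ennreal t | t. 0 < t \<and> X0 t \<omega> \<le> l}"

text \<open>After the first order the inventory is \<open>z\<close>, so order \<open>k\<close> (counted from \<open>0\<close>) is placed when
  \<open>X0\<close> first reaches \<open>min x0 y - k (z - y)\<close>. The first order is triggered by the level \<open>y\<close>, which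
  differs from \<open>min x0 y\<close> if the process starts below \<open>y\<close>.\<close>

definition "bottom k = min x0 y - real k * (z - y)"
definition "level k = (if k = 0 then y else bottom k)"
definition "\<tau> k \<omega> = hit (level k) \<omega>"
definition "qty k = (if k = 0 then z - min x0 y else z - y)"

lemma qty_pos: "0 < qty k"
  using y_less_z by (auto simp: qty_def)

lemma sum_qty: "(\<Sum>j<k. qty j) = y - level k"
proof (induction k)
  case (Suc k)
  then show ?case by (cases "k = 0") (auto simp: level_def bottom_def qty_def algebra_simps)
qed (simp add: level_def)

lemma bottom_Suc: "bottom (Suc k) < bottom k"
  using y_less_z by (simp add: bottom_def algebra_simps)

lemma bottom_le_level: "bottom k \<le> level k"
  by (simp add: level_def bottom_def)

lemma hit_le: "0 < t \<Longrightarrow> X0 t \<omega> \<le> l \<Longrightarrow> hit l \<omega> \<le> ennreal t"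
  unfolding hit_def by (intro Inf_lower) auto

lemma X0_near:
  assumes om: "\<omega> \<in> space M" and r: "0 \<le> r"
  shows "l < X0 r \<omega> \<Longrightarrow> \<exists>d>0. \<forall>s\<ge>0. \<bar>s - r\<bar> < d \<longrightarrow> l < X0 s \<omega>"
    and "X0 r \<omega> < l \<Longrightarrow> \<exists>d>0. \<forall>s\<ge>0. \<bar>s - r\<bar> < d \<longrightarrow> X0 s \<omega> < l"
proof -
  have c: "\<exists>d>0. \<forall>s\<in>{0..}. dist s r < d \<longrightarrow> dist (X0 s \<omega>) (X0 r \<omega>) < e" if "0 < e" for e
    using X0_continuous[OF om] r that unfolding continuous_on_iff by auto
  show "\<exists>d>0. \<forall>s\<ge>0. \<bar>s - r\<bar> < d \<longrightarrow> l < X0 s \<omega>" if "l < X0 r \<omega>"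
  proof -
    obtain d where "d > 0" "\<forall>s\<in>{0..}. dist s r < d \<longrightarrow> dist (X0 s \<omega>) (X0 r \<omega>) < X0 r \<omega> - l"
      using c[of "X0 r \<omega> - l"] \<open>l < X0 r \<omega>\<close> by auto
    then show ?thesis by (intro exI[of _ d]) (force simp: dist_real_def abs_less_iff)
  qed
  show "\<exists>d>0. \<forall>s\<ge>0. \<bar>s - r\<bar> < d \<longrightarrow> X0 s \<omega> < l" if "X0 r \<omega> < l"
  proof -
    obtain d where "d > 0" "\<forall>s\<in>{0..}. dist s r < d \<longrightarrow> dist (X0 s \<omega>) (X0 r \<omega>) < l - X0 r \<omega>"
      using c[of "l - X0 r \<omega>"] \<open>X0 r \<omega> < l\<close> by auto
    then show ?thesis by (intro exI[of _ d]) (force simp: dist_real_def abs_less_iff)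
  qed
qed

lemma hit_attained:
  assumes om: "\<omega> \<in> space M" and r: "hit l \<omega> = ennreal r" "0 \<le> r"
  shows "X0 r \<omega> \<le> l"
proof (rule ccontr)
  assume "\<not> X0 r \<omega> \<le> l"
  then obtain d where d: "d > 0" "\<And>s. 0 \<le> s \<Longrightarrow> \<bar>s - r\<bar> < d \<Longrightarrow> l < X0 s \<omega>"
    using X0_near(1)[OF om r(2), of l] by auto
  have "hit l \<omega> < ennreal (r + d)" using r d(1) by (simp add: ennreal_less_iff)
  then obtain t where t: "0 < t" "X0 t \<omega> \<le> l" "ennreal t < ennreal (r + d)"
    unfolding hit_def Inf_less_iff by auto
  have "ennreal r \<le> ennreal t" using hit_le[OF t(1,2)] r by simp
  then have "r \<le> t" using t(1) by (simp add: ennreal_le_iff)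
  moreover have "t < r + d" using t by (simp add: ennreal_less_iff)
  ultimately show False using d(2)[of t] t(1,2) by auto
qed

lemma hit_eq:
  assumes om: "\<omega> \<in> space M" and r: "hit l \<omega> = ennreal r" "0 < r"
  shows "X0 r \<omega> = l"
proof (rule antisym)
  show "X0 r \<omega> \<le> l" using assms by (intro hit_attained) auto
  show "l \<le> X0 r \<omega>"
  proof (rule ccontr)
    assume "\<not> l \<le> X0 r \<omega>"
    then obtain d where d: "d > 0" "\<And>s. 0 \<le> s \<Longrightarrow> \<bar>s - r\<bar> < d \<Longrightarrow> X0 s \<omega> < l"
      using X0_near(2)[OF om, of r l] r by auto
    define s where "s = max (r / 2) (r - d / 2)"
    have s: "0 < s" "s < r" "\<bar>s - r\<bar> < d" using r d(1) by (auto simp: s_def abs_if)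
    then have "hit l \<omega> \<le> ennreal s" using d(2)[of s] by (intro hit_le) auto
    then show False using r s by (simp add: ennreal_le_iff)
  qed
qed

text \<open>At a positive hitting time continuity forces equality with the level. An order at time 0
  can only be the first, since all later levels lie below \<open>x0\<close>.\<close>

lemma X0_at_order:
  assumes om: "\<omega> \<in> space M" and r: "\<tau> k \<omega> = ennreal r" "0 \<le> r"
  shows "X0 r \<omega> = bottom k" and "r = 0 \<Longrightarrow> k = 0"
proof -
  have r': "hit (level k) \<omega> = ennreal r" using r by (simp add: \<tau>_def)
  have le: "X0 r \<omega> \<le> level k" by (rule hit_attained[OF om r' r(2)])
  show k0: "k = 0" if "r = 0"
  proof (rule ccontr)
    assume "k \<noteq> 0"
    then have "0 < real k * (z - y)" using y_less_z by simp
    then have "level k < x0" using \<open>k \<noteq> 0\<close> by (auto simp: level_def bottom_def min_def)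
    then show False using le that X0_zero[OF om] by simp
  qed
  show "X0 r \<omega> = bottom k"
  proof (cases "r = 0")
    case True
    then show ?thesis using k0 le X0_zero[OF om] by (simp add: level_def bottom_def)
  next
    case False
    then have e: "X0 r \<omega> = level k" using hit_eq[OF om r'] r by simp
    show ?thesis
    proof (cases "k = 0 \<and> x0 < y")
      case True
      then have "X0 0 \<omega> < y" using X0_zero[OF om] by simp
      then obtain d where d: "d > 0" "\<And>s. 0 \<le> s \<Longrightarrow> \<bar>s - 0\<bar> < d \<Longrightarrow> X0 s \<omega> < y"
        using X0_near(2)[OF om order_refl] by blast
      define s where "s = min (r / 2) (d / 2)"
      have s: "0 < s" "s < r" "\<bar>s - 0\<bar> < d" using \<open>r \<noteq> 0\<close> r d(1) by (auto simp: s_def)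
      then have "hit (level k) \<omega> \<le> ennreal s" using d(2)[of s] True by (intro hit_le) (auto simp: level_def)
      then show ?thesis using r' s by (simp add: ennreal_le_iff)
    next
      case False
      then show ?thesis using e by (auto simp: level_def bottom_def)
    qed
  qed
qed

lemma \<tau>_le:
  assumes "0 < t" "X0 t \<omega> \<le> bottom k" shows "\<tau> k \<omega> \<le> ennreal t"
  unfolding \<tau>_def using assms bottom_le_level[of k] by (intro hit_le) auto

text \<open>The next level is strictly lower, so \<open>X0\<close> takes different values at the two
  times.\<close>

lemma \<tau>_Suc:
  assumes om: "\<omega> \<in> space M"
  shows "\<tau> k \<omega> \<le> \<tau> (Suc k) \<omega>" and "\<tau> (Suc k) \<omega> \<noteq> \<infinity> \<Longrightarrow> \<tau> k \<omega> < \<tau> (Suc k) \<omega>"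
proof -
  show lt: "\<tau> k \<omega> < \<tau> (Suc k) \<omega>" if fin: "\<tau> (Suc k) \<omega> \<noteq> \<infinity>"
  proof -
    obtain r where r: "\<tau> (Suc k) \<omega> = ennreal r" "0 \<le> r" using ennreal_cases_time[OF fin] .
    have X: "X0 r \<omega> = bottom (Suc k)" "r \<noteq> 0" using X0_at_order[OF om r] by auto
    have "\<tau> k \<omega> \<le> ennreal r" using X bottom_Suc[of k] r by (intro \<tau>_le) auto
    moreover have "\<tau> k \<omega> \<noteq> ennreal r" using X0_at_order(1)[OF om _ r(2), of k] X(1) bottom_Suc[of k] by auto
    ultimately show ?thesis using r by auto
  qed
  show "\<tau> k \<omega> \<le> \<tau> (Suc k) \<omega>" using lt by (cases "\<tau> (Suc k) \<omega> = \<infinity>") auto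
qed

lemma \<tau>_mono: "\<omega> \<in> space M \<Longrightarrow> i \<le> j \<Longrightarrow> \<tau> i \<omega> \<le> \<tau> j \<omega>"
  by (rule lift_Suc_mono_le[of "\<lambda>k. \<tau> k \<omega>"]) (auto intro: \<tau>_Suc)

lemma \<tau>_strict_mono:
  assumes om: "\<omega> \<in> space M" and "i < j" and "\<tau> j \<omega> \<noteq> \<infinity>" shows "\<tau> i \<omega> < \<tau> j \<omega>"
proof -
  obtain k where k: "j = Suc k" "i \<le> k" using \<open>i < j\<close> by (cases j) auto
  have "\<tau> i \<omega> \<le> \<tau> k \<omega>" by (rule \<tau>_mono[OF om k(2)])
  also have "\<dots> < \<tau> j \<omega>" using \<tau>_Suc(2)[OF om, of k] assms(3) k by simp
  finally show ?thesis .
qed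

text \<open>After \<open>n\<close> orders the total ordered is \<open>y - level n\<close>, so the
  inventory reaches \<open>y\<close> exactly when \<open>X0\<close> reaches \<open>level n\<close>;
  this turns the recursion into explicit hitting times.\<close>

lemma yz_truncated_eq:
  assumes om: "\<omega> \<in> space M"
  shows "fst (yz_truncated X0 x0 y z n) j \<omega> = (if j = 0 then 0 else if j \<le> n then \<tau> (j - 1) \<omega> else \<infinity>) \<and>
    snd (yz_truncated X0 x0 y z n) j \<omega> = (if j \<noteq> 0 \<and> j \<le> n \<and> \<tau> (j - 1) \<omega> \<noteq> \<infinity> then qty (j - 1) else 0)"
proof (induction n arbitrary: j)
  case 0
  show ?case by simp
next
  case (Suc n)
  define p where "p = yz_truncated X0 x0 y z n"
  have pf: "fst p j \<omega> = (if j = 0 then 0 else if j \<le> n then \<tau> (j - 1) \<omega> else \<infinity>)"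
    and ps: "snd p j \<omega> = (if j \<noteq> 0 \<and> j \<le> n \<and> \<tau> (j - 1) \<omega> \<noteq> \<infinity> then qty (j - 1) else 0)" for j
    using Suc.IH[of j] by (auto simp: p_def)
  have left: "inventory_left X0 x0 p t \<omega> = X0 t \<omega> + (y - level n)" if t: "0 < t" and lt: "fst p n \<omega> < ennreal t" for t
  proof -
    have K: "{k. order_time p k \<omega> < ennreal t} = {..<n}"
    proof (intro equalityI subsetI)
      fix k assume "k \<in> {..<n}"
      then have k: "k \<le> n - 1" "0 < n" by auto
      have "\<tau> k \<omega> \<le> \<tau> (n - 1) \<omega>" by (rule \<tau>_mono[OF om k(1)])
      also have "\<dots> < ennreal t" using lt k by (simp add: pf)
      finally show "k \<in> {k. order_time p k \<omega> < ennreal t}" using k by (simp add: pf)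
    qed (auto simp: pf split: if_splits)
    have "(\<Sum>k<n. order_qty p k \<omega>) = (\<Sum>k<n. qty k)"
    proof (rule sum.cong[OF refl])
      fix k assume k: "k \<in> {..<n}"
      then have "order_time p k \<omega> < ennreal t" using K by blast
      then have "\<tau> k \<omega> \<noteq> \<infinity>" using k by (auto simp: pf)
      then show "order_qty p k \<omega> = qty k" using k by (simp add: ps)
    qed
    then show ?thesis
      using inventory_left_finite[where X = X0 and \<omega> = \<omega> and r = t and p = p] X0_continuous[OF om] t K by (simp add: sum_qty)
  qed
  define T where "T = Inf {ennreal t | t. 0 \<le> t \<and> fst p n \<omega> < ennreal t \<and> inventory_left X0 x0 p t \<omega> \<le> y}"
  have T: "T = \<tau> n \<omega>"
  proof -
    \<comment> \<open>The requirement that \<open>t\<close> follow the previous order is automatic: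
      hitting \<open>level n\<close> at \<open>t\<close> implies
      \<open>\<tau> n \<omega> \<le> ennreal t\<close>, and the order times are strictly
      increasing.\<close>
    have "(0 \<le> t \<and> fst p n \<omega> < ennreal t \<and> inventory_left X0 x0 p t \<omega> \<le> y) \<longleftrightarrow> (0 < t \<and> X0 t \<omega> \<le> level n)" for t
    proof
      assume a: "0 \<le> t \<and> fst p n \<omega> < ennreal t \<and> inventory_left X0 x0 p t \<omega> \<le> y"
      have "0 < ennreal t" by (rule order_le_less_trans[of 0 "fst p n \<omega>"]) (use a in auto)
      then have "0 < t" by simp
      then show "0 < t \<and> X0 t \<omega> \<le> level n" using a left[of t] by auto
    next
      assume a: "0 < t \<and> X0 t \<omega> \<le> level n"
      then have "\<tau> n \<omega> \<le> ennreal t" unfolding \<tau>_def by (intro hit_le) auto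
      have lt: "fst p n \<omega> < ennreal t"
      proof (cases n)
        case 0 then show ?thesis using a by (simp add: pf)
      next
        case (Suc m)
        have "\<tau> n \<omega> \<noteq> \<infinity>" using \<open>\<tau> n \<omega> \<le> ennreal t\<close> by (auto simp: top_unique)
        then have "\<tau> m \<omega> < \<tau> n \<omega>" using \<tau>_Suc(2)[OF om] Suc by simp
        then show ?thesis using \<open>\<tau> n \<omega> \<le> ennreal t\<close> Suc by (simp add: pf)
      qed
      then show "0 \<le> t \<and> fst p n \<omega> < ennreal t \<and> inventory_left X0 x0 p t \<omega> \<le> y" using a left[of t] by auto
    qed
    then show ?thesis unfolding T_def \<tau>_def hit_def by simp
  qed
  have Q: "(if T = \<infinity> then 0 else z - inventory_left X0 x0 p (enn2real T) \<omega>) = (if \<tau> n \<omega> \<noteq> \<infinity> then qty n else 0)"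
  proof (cases "\<tau> n \<omega> = \<infinity>")
    case True then show ?thesis by (simp add: T)
  next
    case False
    then obtain r where r: "\<tau> n \<omega> = ennreal r" "0 \<le> r" by (rule ennreal_cases_time)
    note X = X0_at_order[OF om r]
    have "z - inventory_left X0 x0 p r \<omega> = qty n"
    proof (cases "r = 0")
      case True
      then show ?thesis using X X0_zero[OF om] by (simp add: inventory_left_def qty_def bottom_def)
    next
      case False
      have "fst p n \<omega> < ennreal r"
      proof (cases n)
        case 0 then show ?thesis using False r by (simp add: pf)
      next
        case (Suc m)
        then show ?thesis using \<tau>_Suc(2)[OF om, of m] r by (simp add: pf)
      qed
      then show ?thesis using left[of r] False r X(1) by (simp add: qty_def level_def bottom_def)
    qed
    then show ?thesis using False r by (simp add: T)
  qed
  have "fst (yz_truncated X0 x0 y z (Suc n)) (Suc n) \<omega> = T" "snd (yz_truncated X0 x0 y z (Suc n)) (Suc n) \<omega> = (if T = \<infinity> then 0 else z - inventory_left X0 x0 p (enn2real T) \<omega>)"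
    by (simp_all only: yz_truncated.simps Let_def fst_conv snd_conv fun_upd_same T_def p_def)
  moreover have "fst (yz_truncated X0 x0 y z (Suc n)) j \<omega> = fst p j \<omega>" "snd (yz_truncated X0 x0 y z (Suc n)) j \<omega> = snd p j \<omega>" if "j \<noteq> Suc n"
    by (simp_all only: yz_truncated.simps Let_def fst_conv snd_conv fun_upd_other[OF that] p_def)
  ultimately show ?case using T Q pf[of j] ps[of j] by (cases "j = Suc n") auto
qed

abbreviation "pol \<equiv> yz_policy X0 x0 y z"

lemma pol_eq:
  assumes "\<omega> \<in> space M"
  shows "order_time pol k \<omega> = \<tau> k \<omega>" and "order_qty pol k \<omega> = (if \<tau> k \<omega> \<noteq> \<infinity> then qty k else 0)"
  using yz_truncated_eq[OF assms, of "Suc k" "Suc k"] by (auto simp: yz_policy_def)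

text \<open>A continuous path reaches \<open>l\<close> or less in a compact interval if and only if
  its minimum there is at most \<open>l\<close>, that is, if it comes within every
  \<open>1 / real (Suc n)\<close> of \<open>l\<close> from above or lower. This can be tested at
  rational times; the rational \<open>a > 0\<close> excludes time 0.\<close>

lemma hit_less_history:
  shows "{\<omega>\<in>space M. hit l \<omega> < ennreal u} \<in> sets (\<H> u)"
proof -
  let ?R = "{(a, b :: rat). 0 < a \<and> a < b \<and> real_of_rat b < u}"
  let ?E = "\<lambda>a b. {\<omega>\<in>space M. \<forall>n. \<exists>q\<in>{q. a \<le> q \<and> q \<le> b}. X0 (real_of_rat q) \<omega> < l + 1 / real (Suc n)}"
  have eq: "{\<omega>\<in>space M. hit l \<omega> < ennreal u} = (\<Union>(a, b)\<in>?R. ?E a b)"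
  proof (intro equalityI subsetI)
    fix \<omega> assume "\<omega> \<in> {\<omega>\<in>space M. hit l \<omega> < ennreal u}"
    then have om: "\<omega> \<in> space M" and "hit l \<omega> < ennreal u" by auto
    then obtain t where t: "0 < t" "X0 t \<omega> \<le> l" "t < u"
      unfolding hit_def Inf_less_iff by (auto simp: ennreal_less_iff)
    obtain a where a: "0 < real_of_rat a" "real_of_rat a < t" using of_rat_dense[OF t(1)] by auto
    obtain b where b: "t < real_of_rat b" "real_of_rat b < u" using of_rat_dense[OF t(3)] by auto
    have "a < b" using a b by (metis of_rat_less order_less_trans)
    then have ab: "(a, b) \<in> ?R" using a b by simp
    have "\<exists>q\<in>{q. a \<le> q \<and> q \<le> b}. X0 (real_of_rat q) \<omega> < l + 1 / real (Suc n)" for n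
    proof -
      have "X0 t \<omega> < l + 1 / real (Suc n)" using t(2) by (intro order_le_less_trans[OF t(2)]) simp
      then obtain d where d: "d > 0" "\<And>s. 0 \<le> s \<Longrightarrow> \<bar>s - t\<bar> < d \<Longrightarrow> X0 s \<omega> < l + 1 / real (Suc n)"
        using X0_near(2)[OF om less_imp_le[OF t(1)]] by blast
      have "t < min (t + d) (real_of_rat b)" using d b by simp
      from of_rat_dense[OF this] obtain q where q: "t < real_of_rat q" "real_of_rat q < t + d" "real_of_rat q < real_of_rat b" by auto
      have "a \<le> q" "q \<le> b" using q a by (auto simp: of_rat_less less_imp_le) (metis of_rat_less order_less_trans less_imp_le)
      moreover have "X0 (real_of_rat q) \<omega> < l + 1 / real (Suc n)" by (rule d(2)) (use q t in linarith)+
      ultimately show ?thesis by blast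
    qed
    then show "\<omega> \<in> (\<Union>(a, b)\<in>?R. ?E a b)" using ab om by blast
  next
    fix \<omega> assume "\<omega> \<in> (\<Union>(a, b)\<in>?R. ?E a b)"
    then obtain a b where ab: "0 < a" "a < b" "real_of_rat b < u" and om: "\<omega> \<in> space M"
      and q: "\<And>n. \<exists>q\<in>{q. a \<le> q \<and> q \<le> b}. X0 (real_of_rat q) \<omega> < l + 1 / real (Suc n)" by auto
    have "\<exists>t\<in>{real_of_rat a..real_of_rat b}. \<forall>s\<in>{real_of_rat a..real_of_rat b}. X0 t \<omega> \<le> X0 s \<omega>"
      using ab by (intro continuous_attains_inf continuous_on_subset[OF X0_continuous[OF om]]) (auto simp: of_rat_less_eq)
    then obtain t where t: "t \<in> {real_of_rat a..real_of_rat b}" "\<And>s. s \<in> {real_of_rat a..real_of_rat b} \<Longrightarrow> X0 t \<omega> \<le> X0 s \<omega>" by blast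
    have ln: "X0 t \<omega> \<le> l + 1 / real (Suc n)" for n
    proof -
      obtain q where "a \<le> q" "q \<le> b" "X0 (real_of_rat q) \<omega> < l + 1 / real (Suc n)" using q[of n] by blast
      then show ?thesis using t(2)[of "real_of_rat q"] by (simp add: of_rat_less_eq)
    qed
    have "X0 t \<omega> \<le> l"
    proof (rule field_le_epsilon)
      fix e :: real assume "0 < e"
      then obtain n where "1 / real (Suc n) < e" using reals_Archimedean by (auto simp: inverse_eq_divide)
      then show "X0 t \<omega> \<le> l + e" using ln[of n] by linarith
    qed
    moreover have "0 < t" using ab t(1) by (metis atLeastAtMost_iff order_less_le_trans zero_less_of_rat_iff)
    ultimately have "hit l \<omega> \<le> ennreal t" by (intro hit_le) auto
    also have "\<dots> < ennreal u" using t(1) ab(3) \<open>0 < t\<close> by (simp add: ennreal_less_iff)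
    finally show "\<omega> \<in> {\<omega>\<in>space M. hit l \<omega> < ennreal u}" using om by simp
  qed
  have E: "?E a b \<in> sets (\<H> u)" if "(a, b) \<in> ?R" for a b
  proof -
    have "{\<omega>\<in>space (\<H> u). \<exists>q\<in>{q. a \<le> q \<and> q \<le> b}. X0 (real_of_rat q) \<omega> < l + 1 / real (Suc n)} \<in> sets (\<H> u)" for n
    proof -
      have "{\<omega>\<in>space (\<H> u). \<exists>q\<in>{q. a \<le> q \<and> q \<le> b}. X0 (real_of_rat q) \<omega> < l + 1 / real (Suc n)}
        = (\<Union>q\<in>{q. a \<le> q \<and> q \<le> b}. {\<omega>\<in>space (\<H> u). X0 (real_of_rat q) \<omega> < l + 1 / real (Suc n)})" by blast
      also have "\<dots> \<in> sets (\<H> u)"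
      proof (intro sets.countable_UN'')
        fix q assume q: "q \<in> {q. a \<le> q \<and> q \<le> b}"
        have "0 \<le> q" using q that by auto
        moreover have "real_of_rat q \<le> real_of_rat b" using q by (simp add: of_rat_less_eq)
        ultimately have "X0 (real_of_rat q) \<in> borel_measurable (\<H> u)"
          using that by (intro measurable_completed_history ennreal_leI) auto
        from measurable_sets_Collect[OF this, of "\<lambda>x. x < l + 1 / real (Suc n)"]
        show "{\<omega>\<in>space (\<H> u). X0 (real_of_rat q) \<omega> < l + 1 / real (Suc n)} \<in> sets (\<H> u)" by simp
      qed auto
      finally show ?thesis .
    qed
    then have "{\<omega>\<in>space (\<H> u). \<forall>n. \<exists>q\<in>{q. a \<le> q \<and> q \<le> b}. X0 (real_of_rat q) \<omega> < l + 1 / real (Suc n)} \<in> sets (\<H> u)"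
      by (intro sets.sets_Collect_countable_All)
    then show ?thesis by simp
  qed
  show ?thesis unfolding eq
  proof (intro sets.countable_UN'')
    show "countable ?R" by (rule countable_subset[of _ UNIV]) auto
    fix ab assume "ab \<in> ?R"
    then show "(case ab of (a, b) \<Rightarrow> ?E a b) \<in> sets (\<H> u)" using E by (cases ab) auto
  qed
qed

text \<open>A hit immediately after \<open>t\<close> already makes the infimum equal to
  \<open>t\<close>, so the event is decided only just after \<open>t\<close>. It is the intersection
  of the strict events at times decreasing to \<open>t\<close>, which lies in every later
  history.\<close>

lemma hit_stopping_time:
  "{\<omega>\<in>space M. hit l \<omega> \<le> t} \<in> sets (augmented_filtration M X0 t)"
proof (cases t)
  case top
  then have "{\<omega>\<in>space M. hit l \<omega> \<le> t} = space (augmented_filtration M X0 t)" by simp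
  then show ?thesis by (simp only: sets.top)
next
  case (real t0)
  show ?thesis
  proof (rule augmentedI)
    fix s assume s: "t < s \<or> s = \<infinity>"
    obtain d where d: "0 < d" "ennreal (t0 + d) \<le> s"
    proof (cases s)
      case top then show ?thesis using that[of 1] by simp
    next
      case (real s0)
      then have "t0 < s0" using s \<open>t = ennreal t0\<close> \<open>0 \<le> t0\<close> by (auto simp: ennreal_less_iff)
      then show ?thesis using that[of "s0 - t0"] real by simp
    qed
    have "{\<omega>\<in>space M. hit l \<omega> \<le> t} = (\<Inter>n. {\<omega>\<in>space M. hit l \<omega> < ennreal (t0 + d / real (Suc n))})"
    proof (intro equalityI subsetI)
      fix \<omega> assume "\<omega> \<in> {\<omega>\<in>space M. hit l \<omega> \<le> t}"
      then have "\<omega> \<in> space M" "hit l \<omega> < ennreal (t0 + d / real (Suc n))" for n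
        using d real by (auto intro: order_le_less_trans simp: ennreal_less_iff simp del: of_nat_Suc)
      then show "\<omega> \<in> (\<Inter>n. {\<omega>\<in>space M. hit l \<omega> < ennreal (t0 + d / real (Suc n))})" by blast
    next
      fix \<omega> assume a: "\<omega> \<in> (\<Inter>n. {\<omega>\<in>space M. hit l \<omega> < ennreal (t0 + d / real (Suc n))})"
      have "(\<lambda>n. ennreal (t0 + d / real (Suc n))) \<longlonglongrightarrow> ennreal (t0 + 0)"
        by (intro tendsto_ennrealI tendsto_add tendsto_const LIMSEQ_Suc lim_const_over_n)
      then have "hit l \<omega> \<le> ennreal (t0 + 0)"
        by (rule LIMSEQ_le_const) (use a in \<open>auto intro: less_imp_le\<close>)
      then show "\<omega> \<in> {\<omega>\<in>space M. hit l \<omega> \<le> t}" using a real by auto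
    qed
    also have "\<dots> \<in> sets (completed_history M X0 s)"
    proof (intro sets.countable_INT image_subsetI)
      fix n :: nat
      have "d / real (Suc n) \<le> d" using d(1) by (simp add: divide_le_eq)
      then have "ennreal (t0 + d / real (Suc n)) \<le> s" using d(2) by (meson add_left_mono ennreal_leI order_trans)
      then have "sets (\<H> (t0 + d / real (Suc n))) \<subseteq> sets (completed_history M X0 s)" by (rule sets_completed_history_mono)
      then show "{\<omega>\<in>space M. hit l \<omega> < ennreal (t0 + d / real (Suc n))} \<in> sets (completed_history M X0 s)"
        using hit_less_history by blast
    qed auto
    finally show "{\<omega>\<in>space M. hit l \<omega> \<le> t} \<in> sets (completed_history M X0 s)" .
  qed
qed

lemma pol_admissible: "pol \<in> admissible M (augmented_filtration M X0)"
proof -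
  let ?F = "augmented_filtration M X0"
  interpret filtration "space M" ?F by (rule filtration_augmented)
  have st: "stopping_time ?F (order_time pol k)" for k
  proof
    fix t
    have "{\<omega>\<in>space (?F t). order_time pol k \<omega> \<le> t} = {\<omega>\<in>space M. hit (level k) \<omega> \<le> t}"
      using pol_eq(1) by (auto simp: \<tau>_def)
    then show "Measurable.pred (?F t) (\<lambda>\<omega>. order_time pol k \<omega> \<le> t)" using hit_stopping_time by (simp add: pred_def)
  qed
  have "order_qty pol k \<in> borel_measurable (pre_sigma (order_time pol k))" for k
  proof -
    \<comment> \<open>The quantity is a deterministic constant unless the order time is infinite,
      hence a function of the order time.\<close>
    have "(\<lambda>\<omega>. (\<lambda>x. if x = \<infinity> then 0 else qty k) (order_time pol k \<omega>)) \<in> borel_measurable (pre_sigma (order_time pol k))"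
      by (rule measurable_compose[OF measurable_stopping_time_pre_sigma[OF st]]) simp
    then show ?thesis
      by (rule measurable_cong[THEN iffD1, rotated]) (simp add: space_pre_sigma pol_eq)
  qed
  then have Q: "snd pol k \<in> borel_measurable (pre_sigma (fst pol k))" if "1 \<le> k" for k using that by (cases k) auto
  have st': "stopping_time ?F (fst pol k)" if "1 \<le> k" for k using st that by (cases k) auto
  have m: "fst pol k \<omega> \<le> fst pol (Suc k) \<omega>" if "1 \<le> k" "\<omega> \<in> space M" for k \<omega>
    using that pol_eq(1)[OF that(2)] \<tau>_Suc(1)[OF that(2)] by (cases k) auto
  have q: "0 \<le> snd pol k \<omega>" if "1 \<le> k" "\<omega> \<in> space M" for k \<omega>
    using that pol_eq(2)[OF that(2)] qty_pos by (cases k) (auto intro: less_imp_le)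
  show ?thesis unfolding admissible_def mem_Collect_eq
    using Q st' m q by (auto simp: case_prod_beta)
qed

text \<open>Order \<open>k\<close> requires \<open>X0\<close> to have come down to
  \<open>bottom k\<close>, and a continuous path is bounded below on a compact interval.\<close>

lemma finite_orders:
  assumes om: "\<omega> \<in> space M"
  shows "finite {k. \<tau> k \<omega> < ennreal t}"
proof (cases "0 < t")
  case False then show ?thesis by (simp add: ennreal_neg not_less)
next
  case True
  have "\<exists>s\<in>{0..t}. \<forall>r\<in>{0..t}. X0 s \<omega> \<le> X0 r \<omega>"
    using True by (intro continuous_attains_inf continuous_on_subset[OF X0_continuous[OF om]]) auto
  then obtain s where s: "\<And>r. r \<in> {0..t} \<Longrightarrow> X0 s \<omega> \<le> X0 r \<omega>" by blast
  have "real k \<le> (min x0 y - X0 s \<omega>) / (z - y)" if "\<tau> k \<omega> < ennreal t" for k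
  proof -
    have "\<tau> k \<omega> \<noteq> \<infinity>" using that by auto
    then obtain r where r: "\<tau> k \<omega> = ennreal r" "0 \<le> r" by (rule ennreal_cases_time)
    then have "r \<in> {0..t}" using that by (simp add: ennreal_less_iff)
    then have "X0 s \<omega> \<le> bottom k" using s X0_at_order(1)[OF om r] by metis
    then have "real k * (z - y) \<le> min x0 y - X0 s \<omega>" unfolding bottom_def by linarith
    then show ?thesis using y_less_z by (simp only: pos_le_divide_eq diff_gt_0_iff_gt)
  qed
  then have "{k. \<tau> k \<omega> < ennreal t} \<subseteq> {..nat \<lfloor>(min x0 y - X0 s \<omega>) / (z - y)\<rfloor>}"
    by (auto simp: le_nat_floor)
  then show ?thesis by (rule finite_subset) simp
qed

end

section \<open>Cost of the optimal policy\<close>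

lemma (in ordering) ordering_truncate:
  "ordering M W \<mu> \<sigma> x0 (\<lambda>k \<omega>. if k < K then T k \<omega> else \<infinity>) Q"
proof
  fix k and s u :: real assume su: "0 \<le> s" "s < u"
  show "{\<omega> \<in> space M. (if k < K then T k \<omega> else \<infinity>) \<le> ennreal s} \<in> sets (\<H> u)"
    using T_adapted[OF su, of k] by (cases "k < K") (auto simp: top_unique)
  show "(\<lambda>\<omega>. if (if k < K then T k \<omega> else \<infinity>) \<le> ennreal s then Q k \<omega> else 0) \<in> borel_measurable (\<H> u)"
    using Q_adapted[OF su, of k] by (cases "k < K") (auto simp: top_unique)
qed (use T_mono in auto)

locale yz_costs = yz_setting M W \<mu> \<sigma> x0 y z + inventory_costs \<mu> \<sigma> cb ch k1 k2 y z x0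
  for M :: "'a measure" and W :: "real \<Rightarrow> 'a \<Rightarrow> real" and \<mu> \<sigma> x0 y z cb ch k1 k2 :: real
begin

text \<open>The inventory just before order \<open>k\<close>. It differs from \<open>y\<close> only
  for a first order placed at time 0 from \<open>x0 < y\<close>.\<close>

definition "before k = (if k = (0::nat) then min x0 y else y)"

end

text \<open>Allowing some order times to be \<infinity> covers the policy and its truncations after
  finitely many orders alike.\<close>

locale yz_costs_ordering = yz_costs M W \<mu> \<sigma> x0 y z cb ch k1 k2
    + ordering M W \<mu> \<sigma> x0 T "\<lambda>k. snd (yz_policy (inventory0 \<mu> \<sigma> W x0) x0 y z) (Suc k)"
  for M :: "'a measure" and W :: "real \<Rightarrow> 'a \<Rightarrow> real" and \<mu> \<sigma> x0 y z cb ch k1 k2 :: real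
    and T :: "nat \<Rightarrow> 'a \<Rightarrow> ennreal" +
  assumes T_eq: "\<omega> \<in> space M \<Longrightarrow> T k \<omega> = \<tau> k \<omega> \<or> T k \<omega> = \<infinity>"
begin

lemma finite_T:
  assumes om: "\<omega> \<in> space M" shows "finite {k. T k \<omega> < ennreal t}"
proof (rule finite_subset[OF _ finite_orders[OF om]])
  show "{k. T k \<omega> < ennreal t} \<subseteq> {k. \<tau> k \<omega> < ennreal t}"
  proof
    fix k assume "k \<in> {k. T k \<omega> < ennreal t}"
    then show "k \<in> {k. \<tau> k \<omega> < ennreal t}" using T_eq[OF om, of k] by auto
  qed
qed

lemma S_eq:
  assumes om: "\<omega> \<in> space M" and fin: "\<And>j. j < k \<Longrightarrow> \<tau> j \<omega> \<noteq> \<infinity>"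
  shows "S k \<omega> = y - level k"
proof -
  have "S k \<omega> = (\<Sum>j<k. qty j)"
    unfolding S_def by (rule sum.cong) (use pol_eq(2)[OF om] fin in auto)
  then show ?thesis by (simp add: sum_qty)
qed

lemma position_at_order:
  assumes om: "\<omega> \<in> space M" and fin: "\<tau> k \<omega> \<noteq> \<infinity>"
  shows "X0 (enn2real (\<tau> k \<omega>)) \<omega> + S k \<omega> = before k" "X0 (enn2real (\<tau> k \<omega>)) \<omega> + S (Suc k) \<omega> = z"
proof -
  from fin obtain r where r: "\<tau> k \<omega> = ennreal r" "0 \<le> r" by (rule ennreal_cases_time)
  have f: "\<tau> j \<omega> \<noteq> \<infinity>" if "j \<le> k" for j
    using \<tau>_mono[OF om that] fin by (auto simp: top_unique)
  have "S k \<omega> = y - level k" "S (Suc k) \<omega> = y - level (Suc k)"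
    using f by (auto intro!: S_eq[OF om])
  moreover have "X0 (enn2real (\<tau> k \<omega>)) \<omega> = bottom k" using X0_at_order(1)[OF om r] r by simp
  ultimately show "X0 (enn2real (\<tau> k \<omega>)) \<omega> + S k \<omega> = before k" "X0 (enn2real (\<tau> k \<omega>)) \<omega> + S (Suc k) \<omega> = z"
    by (auto simp: before_def level_def bottom_def algebra_simps)
qed

lemma jump_eq:
  assumes om: "\<omega> \<in> space M" and lt: "T k \<omega> < ennreal t"
  shows "jump U k \<omega> = U z - U (before k)"
proof -
  have "T k \<omega> = \<tau> k \<omega>" using T_eq[OF om, of k] lt by auto
  moreover have "\<tau> k \<omega> \<noteq> \<infinity>" using lt calculation by auto
  ultimately show ?thesis using position_at_order[OF om, of k] by (simp add: jump_def Let_def)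
qed

text \<open>Every order from \<open>y\<close> to \<open>z\<close> lowers \<open>U\<close> by exactly
  \<open>c\<close>, while the formula of Ito bounds the expected total decrease by
  \<open>2 * B + A * t\<close>. The rest of the bound accounts for the first order.\<close>

lemma order_count_bound:
  assumes tf: "test_function U w v" and B: "\<And>x. \<bar>U x\<bar> \<le> B" and A: "\<And>x. \<bar>gen w v x\<bar> \<le> A"
    and c: "U y - U z = c" "0 < c" and t: "0 < t" and Nint: "integrable P (\<lambda>\<omega>. real (N t \<omega>))"
  shows "c * (\<integral>\<omega>. real (N t \<omega>) \<partial>P) \<le> 4 * B + c + A * t"
proof -
  note ito = ito[OF tf t finite_T Nint]
  let ?I = "\<lambda>\<omega>. \<integral>s. indicator {0..<t} s * gen w v (X0 s \<omega> + Z s \<omega>) \<partial>lborel"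
  let ?J = "\<lambda>\<omega>. \<Sum>k<N t \<omega>. jump U k \<omega>"
  have B0: "0 \<le> B" using B[of 0] by linarith
  have "c * real (N t \<omega>) \<le> - ?J \<omega> + (c + 2 * B)" if om: "\<omega> \<in> space M" for \<omega>
  proof -
    \<comment> \<open>The first order may start from \<open>x0\<close>; there \<open>- jump\<close>
      is only known to be at least \<open>- 2 * B\<close>, so the summand is lowered by
      \<open>c + 2 * B\<close>.\<close>
    have "(\<Sum>k<N t \<omega>. c - (if k = 0 then c + 2 * B else 0)) \<le> (\<Sum>k<N t \<omega>. - jump U k \<omega>)"
    proof (rule sum_mono)
      fix k assume "k \<in> {..<N t \<omega>}"
      then have "T k \<omega> < ennreal t" using less_iff[OF om finite_T[OF om]] by simp
      from jump_eq[OF om this] show "c - (if k = 0 then c + 2 * B else 0) \<le> - jump U k \<omega>"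
        using B[of z] B[of "min x0 y"] c by (auto simp: before_def abs_le_iff)
    qed
    also have "\<dots> = - ?J \<omega>" by (rule sum_negf)
    finally have "c * real (N t \<omega>) - (\<Sum>k<N t \<omega>. if k = 0 then c + 2 * B else 0) \<le> - ?J \<omega>" by (simp add: sum_subtractf mult.commute)
    moreover have "(\<Sum>k<N t \<omega>. if k = 0 then c + 2 * B else 0) \<le> c + 2 * B"
      using c B0 by (simp add: sum.delta')
    ultimately show ?thesis by linarith
  qed
  then have "(\<integral>\<omega>. c * real (N t \<omega>) \<partial>P) \<le> (\<integral>\<omega>. - ?J \<omega> + (c + 2 * B) \<partial>P)"
    using Nint ito(2) by (intro integral_mono) auto
  also have "\<dots> = - (\<integral>\<omega>. ?J \<omega> \<partial>P) + (c + 2 * B)" using ito(2) by (simp add: prob_space)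
  also have "\<dots> \<le> 2 * B + A * t + (c + 2 * B)"
  proof -
    have "- (\<integral>\<omega>. U (X0 t \<omega> + Zl t \<omega>) \<partial>P) = (\<integral>\<omega>. - U (X0 t \<omega> + Zl t \<omega>) \<partial>P)" by simp
    also have "\<dots> \<le> (\<integral>\<omega>. B \<partial>P)"
    proof (rule integral_mono)
      show "- U (X0 t \<omega> + Zl t \<omega>) \<le> B" for \<omega> using B[of "X0 t \<omega> + Zl t \<omega>"] by linarith
    qed (use ito(3) in auto)
    finally have 1: "- (\<integral>\<omega>. U (X0 t \<omega> + Zl t \<omega>) \<partial>P) \<le> B" by (simp add: prob_space)
    have "(\<integral>\<omega>. ?I \<omega> \<partial>P) \<le> (\<integral>\<omega>. A * t \<partial>P)"
    proof (rule integral_mono[OF ito(1)])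
      fix \<omega> assume "\<omega> \<in> space P"
      then have om: "\<omega> \<in> space M" by simp
      have "?I \<omega> \<le> (\<integral>s. indicator {0..<t} s * A \<partial>lborel)"
      proof (rule integral_mono[OF path_integrable[OF tf om finite_T[OF om]] integral_indicator_const(1)])
        show "indicator {0..<t} s * gen w v (X0 s \<omega> + Z s \<omega>) \<le> indicator {0..<t} s * A" for s
          using A[of "X0 s \<omega> + Z s \<omega>"] by (auto simp: indicator_def)
      qed (use t in simp)
      also have "\<dots> = A * t" using t by (intro integral_indicator_const) simp
      finally show "?I \<omega> \<le> A * t" .
    qed simp_all
    then have 2: "(\<integral>\<omega>. ?I \<omega> \<partial>P) \<le> A * t" by (simp add: prob_space)
    show ?thesis using ito(4) 1 2 B[of x0] by linarith
  qed
  finally show ?thesis by simp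
qed

end

section \<open>Finite order counts and the cost of the policy at a fixed time\<close>

context yz_costs
begin

definition "To k \<omega> = (if \<omega> \<in> space M then order_time pol k \<omega> else \<infinity>)"

lemma To_eq: "\<omega> \<in> space M \<Longrightarrow> To k \<omega> = \<tau> k \<omega>"
  by (simp add: To_def pol_eq)

lemma To_ordering: "ordering M W \<mu> \<sigma> x0 To (order_qty pol)"
  unfolding To_def[abs_def] by (rule admissible_adapted[OF pol_admissible]) (auto intro: AE_I2)

sublocale O: yz_costs_ordering M W \<mu> \<sigma> x0 y z cb ch k1 k2 To
  by (intro yz_costs_ordering.intro yz_costs_axioms To_ordering yz_costs_ordering_axioms.intro) (simp add: To_eq)

lemma truncated_ordering: "yz_costs_ordering M W \<mu> \<sigma> x0 y z cb ch k1 k2 (\<lambda>k \<omega>. if k < K then To k \<omega> else \<infinity>)"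
  by (intro yz_costs_ordering.intro yz_costs_axioms O.ordering_truncate yz_costs_ordering_axioms.intro) (simp add: To_eq)

lemma exists_test_function:
  obtains U w v B A c where "test_function U w v" "\<And>x. \<bar>U x\<bar> \<le> B" "\<And>x. \<bar>gen w v x\<bar> \<le> A" "U y - U z = c" "0 < c"
proof -
  obtain C D \<delta>0 where 1: "0 < \<delta>0" "\<forall>\<delta>. 0 < \<delta> \<longrightarrow> \<delta> < \<delta>0 \<longrightarrow> (\<exists>U w v. certificate C D \<delta> U w v)" using test_function_exists by blast
  have "0 < \<delta>0 / 2" "\<delta>0 / 2 < \<delta>0" using 1(1) by auto
  then obtain U w v where "certificate C D (\<delta>0 / 2) U w v" using 1(2) by blast
  then have tf: "test_function U w v" "U y - U z = c1 k1 k2 y z" unfolding certificate_def by blast+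
  obtain B where B: "\<And>x. \<bar>U x\<bar> \<le> B" using test_function.ex_bound[OF tf(1)] by metis
  obtain A where A: "\<And>x. \<bar>gen w v x\<bar> \<le> A" using O.gen_continuous_bounded(2)[OF tf(1)] by blast
  have "0 < c1 k1 k2 y z" using pos y_less_z by (simp add: c1_def add_pos_pos)
  then show ?thesis by (rule that[OF tf(1) B A tf(2)])
qed

lemma N_integrable: assumes t: "0 < t" shows "integrable P (\<lambda>\<omega>. real (O.N t \<omega>))"
proof -
  obtain U w v B A c where tf: "test_function U w v" "\<And>x. \<bar>U x\<bar> \<le> B" "\<And>x. \<bar>gen w v x\<bar> \<le> A" "U y - U z = c" "0 < c"
    by (rule exists_test_function) blast
  txt \<open>The formula is only available for an integrable order count, so it is first applied to the
    policy stopped after \<open>K\<close> orders; the resulting bound does not depend on \<open>K\<close>.\<close>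
  let ?ind = "\<lambda>k \<omega>. if To k \<omega> < ennreal t then 1 else 0 :: ennreal"
  have meas: "?ind k \<in> borel_measurable P" for k
    using O.T_less_sets[of k t] by (intro measurable_If) simp_all
  have partial: "(\<Sum>k<K. (\<integral>\<^sup>+\<omega>. ?ind k \<omega> \<partial>P)) \<le> ennreal ((4 * B + c + A * t) / c)" for K
  proof -
    interpret K: yz_costs_ordering M W \<mu> \<sigma> x0 y z cb ch k1 k2 "\<lambda>k \<omega>. if k < K then To k \<omega> else \<infinity>"
      by (rule truncated_ordering)
    have sum_eq: "(\<Sum>k. if (if k < K then To k \<omega> else \<infinity>) < ennreal t then 1 else 0 :: ennreal) = (\<Sum>k<K. ?ind k \<omega>)" for \<omega>
      by (subst suminf_finite[of "{..<K}"]) auto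
    have le: "(\<integral>\<^sup>+\<omega>. (\<Sum>k. if (if k < K then To k \<omega> else \<infinity>) < ennreal t then 1 else 0) \<partial>P) \<le> (\<integral>\<^sup>+\<omega>. of_nat K \<partial>P)"
      unfolding sum_eq
    proof (rule nn_integral_mono)
      fix \<omega>
      have "(\<Sum>k<K. ?ind k \<omega>) \<le> (\<Sum>k<K. 1)" by (rule sum_mono) auto
      then show "(\<Sum>k<K. ?ind k \<omega>) \<le> of_nat K" by simp
    qed
    also have "\<dots> < \<infinity>" by (simp add: emeasure_space_1 of_nat_less_top)
    finally have Nint: "integrable P (\<lambda>\<omega>. real (K.N t \<omega>))" by (intro K.integrable_N K.finite_T)
    have "(\<Sum>k<K. (\<integral>\<^sup>+\<omega>. ?ind k \<omega> \<partial>P)) = (\<integral>\<^sup>+\<omega>. (\<Sum>k<K. ?ind k \<omega>) \<partial>P)"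
      by (rule nn_integral_sum[symmetric]) (rule meas)
    also have "\<dots> = (\<integral>\<^sup>+\<omega>. ennreal (real (K.N t \<omega>)) \<partial>P)"
      by (rule nn_integral_cong) (simp add: sum_eq[symmetric] K.order_count_finite[OF K.finite_T])
    also have "\<dots> = ennreal (\<integral>\<omega>. real (K.N t \<omega>) \<partial>P)" by (rule nn_integral_eq_integral[OF Nint]) simp
    also have "\<dots> \<le> ennreal ((4 * B + c + A * t) / c)"
      using K.order_count_bound[OF tf t Nint] tf(5) by (intro ennreal_leI) (simp add: pos_le_divide_eq mult.commute)
    finally show ?thesis .
  qed
  have "(\<integral>\<^sup>+\<omega>. (\<Sum>k. ?ind k \<omega>) \<partial>P) = (\<Sum>k. (\<integral>\<^sup>+\<omega>. ?ind k \<omega> \<partial>P))"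
    by (rule nn_integral_suminf) (rule meas)
  also have "\<dots> \<le> ennreal ((4 * B + c + A * t) / c)"
    unfolding suminf_eq_SUP by (rule SUP_least) (rule partial)
  also have "\<dots> < \<infinity>" by simp
  finally show ?thesis by (intro O.integrable_N O.finite_T)
qed

text \<open>If \<open>X0\<close> were below the next level at \<open>t\<close>, continuity would
  place it below that level slightly earlier, and the next order would precede
  \<open>t\<close>.\<close>

lemma position_ge:
  assumes om: "\<omega> \<in> space M" and t: "0 < t"
  shows "y \<le> X0 t \<omega> + O.Zl t \<omega>"
proof -
  let ?n = "O.N t \<omega>"
  note fin = O.finite_T[OF om, of t]
  have lt: "\<tau> j \<omega> < ennreal t \<longleftrightarrow> j < ?n" for j using O.less_iff[OF om fin, of j] To_eq[OF om] by simp
  have "O.Zl t \<omega> = y - level ?n"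
    unfolding O.Zl_eq[OF om fin]
  proof (rule O.S_eq[OF om])
    show "\<tau> j \<omega> \<noteq> \<infinity>" if "j < ?n" for j using lt[of j] that by auto
  qed
  moreover have "level ?n \<le> X0 t \<omega>"
  proof (rule ccontr)
    assume "\<not> level ?n \<le> X0 t \<omega>"
    then obtain d where d: "d > 0" "\<And>s. 0 \<le> s \<Longrightarrow> \<bar>s - t\<bar> < d \<Longrightarrow> X0 s \<omega> < level ?n"
      using X0_near(2)[OF om, of t "level ?n"] t by auto
    define s where "s = max (t / 2) (t - d / 2)"
    have s: "0 < s" "s < t" "\<bar>s - t\<bar> < d" using t d(1) by (auto simp: s_def abs_if)
    then have "\<tau> ?n \<omega> \<le> ennreal s" unfolding \<tau>_def using d(2)[of s] by (intro hit_le) auto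
    also have "\<dots> < ennreal t" using s by (simp add: ennreal_less_iff)
    finally show False using lt by simp
  qed
  ultimately show ?thesis by simp
qed

text \<open>Finite order times of this policy are strictly increasing, so each order is charged
  exactly for its own move from \<open>before k\<close> to \<open>z\<close>.\<close>

lemma cost_upper_path:
  assumes om: "\<omega> \<in> space M" and t: "0 \<le> t" "t < t'"
  shows "cost_upto (c0 cb ch) (c1 k1 k2) X0 x0 pol t \<omega>
    \<le> (\<integral>\<^sup>+s. ennreal (indicator {0..<t'} s * c0 cb ch (X0 s \<omega> + O.Z s \<omega>)) \<partial>lborel) + (\<Sum>k<O.N t' \<omega>. ennreal (c1 k1 k2 (before k) z))"
proof -
  note fin' = O.finite_T[OF om, of t']
  have lt': "\<tau> j \<omega> < ennreal t' \<longleftrightarrow> j < O.N t' \<omega>" for j using O.less_iff[OF om fin', of j] To_eq[OF om] by simp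
  have tt: "ennreal t < ennreal t'" using t by (simp add: ennreal_less_iff)
  have fin: "finite {k. order_time pol k \<omega> \<le> ennreal s}" if "s < t'" "0 \<le> s" for s
  proof (rule finite_subset)
    have "ennreal s < ennreal t'" using that by (simp add: ennreal_less_iff)
    then show "{k. order_time pol k \<omega> \<le> ennreal s} \<subseteq> {..<O.N t' \<omega>}"
      by (auto simp: pol_eq[OF om] lt'[symmetric] intro: order_le_less_trans)
  qed simp
  have inv: "inventory X0 pol s \<omega> = X0 s \<omega> + O.Z s \<omega>" if "s < t'" "0 \<le> s" for s
    using inventory_finite(1)[OF fin[OF that], of X0] by (simp add: O.Z_def To_eq[OF om] pol_eq(1)[OF om])
  have hold: "(\<integral>\<^sup>+s\<in>{0..t}. ennreal (c0 cb ch (inventory X0 pol s \<omega>)) \<partial>lborel)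
    \<le> (\<integral>\<^sup>+s. ennreal (indicator {0..<t'} s * c0 cb ch (X0 s \<omega> + O.Z s \<omega>)) \<partial>lborel)"
    by (rule nn_integral_mono) (use t in \<open>auto simp: indicator_def inv\<close>)
  have ordc: "(if order_time pol k \<omega> \<le> ennreal t then
             (let r = enn2real (order_time pol k \<omega>)
              in ennreal (c1 k1 k2 (inventory_left X0 x0 pol r \<omega>) (inventory X0 pol r \<omega>)))
            else 0) \<le> (if k < O.N t' \<omega> then ennreal (c1 k1 k2 (before k) z) else 0)" for k
  proof (cases "order_time pol k \<omega> \<le> ennreal t")
    case False then show ?thesis by simp
  next
    case True
    then have \<tau>t: "\<tau> k \<omega> \<le> ennreal t" by (simp add: pol_eq(1)[OF om])
    then have fk: "\<tau> k \<omega> \<noteq> \<infinity>" by (auto simp: top_unique)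
    then obtain r where r: "\<tau> k \<omega> = ennreal r" "0 \<le> r" by (rule ennreal_cases_time)
    have rt: "r < t'" using \<tau>t r t by (simp add: ennreal_le_iff)
    have k: "k < O.N t' \<omega>" using lt'[of k] order_le_less_trans[OF \<tau>t tt] by blast
    have left_set: "{j. order_time pol j \<omega> < ennreal r} = {..<k}"
    proof (intro equalityI subsetI)
      fix j assume "j \<in> {j. order_time pol j \<omega> < ennreal r}"
      then have "\<tau> j \<omega> < \<tau> k \<omega>" using r by (simp add: pol_eq(1)[OF om])
      then show "j \<in> {..<k}" using \<tau>_mono[OF om, of k j] by (meson leI leD lessThan_iff)
    qed (use \<tau>_strict_mono[OF om _ fk] r in \<open>auto simp: pol_eq(1)[OF om]\<close>)
    have set: "{j. To j \<omega> \<le> ennreal r} = {..<Suc k}"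
    proof (intro equalityI subsetI)
      fix j assume "j \<in> {j. To j \<omega> \<le> ennreal r}"
      then have "\<tau> j \<omega> \<le> \<tau> k \<omega>" using r by (simp add: To_eq[OF om])
      then have jf: "\<tau> j \<omega> \<noteq> \<infinity>" using fk by (auto simp: top_unique)
      show "j \<in> {..<Suc k}"
      proof (rule ccontr)
        assume "j \<notin> {..<Suc k}"
        then have "\<tau> k \<omega> < \<tau> j \<omega>" by (intro \<tau>_strict_mono[OF om _ jf]) auto
        then show False using \<open>\<tau> j \<omega> \<le> \<tau> k \<omega>\<close> by simp
      qed
    qed (use \<tau>_mono[OF om, of _ k] r in \<open>auto simp: To_eq[OF om] less_Suc_eq_le\<close>)
    have pos_r: "X0 r \<omega> + O.S k \<omega> = before k" "X0 r \<omega> + O.S (Suc k) \<omega> = z"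
      using O.position_at_order[OF om fk] r by auto
    have "inventory_left X0 x0 pol r \<omega> = before k"
    proof (cases "r = 0")
      case True
      then have "k = 0" using X0_at_order(2)[OF om r] by simp
      then show ?thesis using True X0_zero[OF om] pos_r(1) by (simp add: inventory_left_def O.S_def)
    next
      case False
      then have "inventory_left X0 x0 pol r \<omega> = X0 r \<omega> + (\<Sum>j\<in>{j. order_time pol j \<omega> < ennreal r}. order_qty pol j \<omega>)"
        using r X0_continuous[OF om] left_set by (intro inventory_left_finite) auto
      then show ?thesis using left_set pos_r(1) by (simp add: O.S_def)
    qed
    moreover have "inventory X0 pol r \<omega> = z"
      using inv[OF rt r(2)] set pos_r(2) by (simp add: O.Z_def O.S_def)
    ultimately show ?thesis using k r by (simp add: pol_eq(1)[OF om] Let_def)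
  qed
  have "(\<Sum>k. if order_time pol k \<omega> \<le> ennreal t then
             (let r = enn2real (order_time pol k \<omega>)
              in ennreal (c1 k1 k2 (inventory_left X0 x0 pol r \<omega>) (inventory X0 pol r \<omega>)))
            else 0) \<le> (\<Sum>k. if k < O.N t' \<omega> then ennreal (c1 k1 k2 (before k) z) else 0)"
    by (intro suminf_le ordc) auto
  also have "\<dots> = (\<Sum>k<O.N t' \<omega>. ennreal (c1 k1 k2 (before k) z))"
    by (subst suminf_finite[of "{..<O.N t' \<omega>}"]) auto
  finally show ?thesis
    using hold inventory_finite(2)[OF fin[OF t(2,1)]] by (simp add: cost_upto_def add_mono)
qed

lemma c0_nonneg: "0 \<le> c0 cb ch x"
  using pos by (simp add: c0_def mult_le_0_iff)

lemma c0_measurable [measurable]: "c0 cb ch \<in> borel_measurable borel"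
  unfolding c0_def[abs_def] by measurable

lemma cutoff_measurable [measurable]: "cutoff \<delta> \<in> borel_measurable borel"
  by (intro borel_measurable_continuous_onI continuous_at_imp_continuous_on ballI DERIV_isCont[OF cutoff_has_derivative])

text \<open>\<open>R\<close> is a measurable majorant, ready for an application of Fatou's lemma
  over the paths. One \<open>D\<close> pays for the first order, the other for the final value of
  \<open>U\<close>, which \<open>position_ge\<close> controls. The weight \<open>\<rho>\<close> will
  be the cutoff.\<close>

lemma path_bound:
  assumes tf: "test_function U w v" and t: "0 < t"
    and le: "\<And>x. gen w v x \<le> l - \<rho> x * c0 cb ch x" and \<rho>: "\<And>x. 0 \<le> \<rho> x"
    and ord: "U y - U z = c1 k1 k2 y z" "c1 k1 k2 (min x0 y) z \<le> U (min x0 y) - U z + D" and D: "0 \<le> D"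
    and low: "\<And>x. min x0 y \<le> x \<Longrightarrow> U x0 - U x \<le> D"
  shows "\<exists>R. R \<in> borel_measurable P \<and> (\<integral>\<^sup>+\<omega>. R \<omega> \<partial>P) \<le> ennreal (l * t + 2 * D) \<and>
    (\<forall>\<omega>\<in>space M. (\<integral>\<^sup>+s. ennreal (indicator {0..<t} s * (\<rho> (X0 s \<omega> + O.Z s \<omega>) * c0 cb ch (X0 s \<omega> + O.Z s \<omega>))) \<partial>lborel)
      + (\<Sum>k<O.N t \<omega>. ennreal (c1 k1 k2 (before k) z)) \<le> R \<omega>)"
proof -
  note ito = O.ito[OF tf t O.finite_T N_integrable[OF t]]
  let ?I = "\<lambda>\<omega>. \<integral>s. indicator {0..<t} s * gen w v (X0 s \<omega> + O.Z s \<omega>) \<partial>lborel"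
  let ?J = "\<lambda>\<omega>. \<Sum>k<O.N t \<omega>. O.jump U k \<omega>"
  have c1_nn: "0 \<le> c1 k1 k2 (before k) z" for k
    using pos y_less_z by (simp add: c1_def before_def)
  define r1 where "r1 \<omega> = l * t - ?I \<omega>" for \<omega>
  define r2 where "r2 \<omega> = - ?J \<omega> + D" for \<omega>
  note it = integral_indicator_const[OF less_imp_le[OF t], of l]
  have b1: "(\<integral>\<^sup>+s. ennreal (indicator {0..<t} s * (\<rho> (X0 s \<omega> + O.Z s \<omega>) * c0 cb ch (X0 s \<omega> + O.Z s \<omega>))) \<partial>lborel) \<le> ennreal (r1 \<omega>)" "0 \<le> r1 \<omega>"
    if om: "\<omega> \<in> space M" for \<omega>
  proof -
    let ?x = "\<lambda>s. X0 s \<omega> + O.Z s \<omega>"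
    let ?g = "\<lambda>s. indicator {0..<t} s * l - indicator {0..<t} s * gen w v (?x s)"
    have ip: "integrable lborel (\<lambda>s. indicator {0..<t} s * gen w v (?x s))" by (rule O.path_integrable[OF tf om O.finite_T[OF om]])
    have ig: "integrable lborel ?g" by (rule Bochner_Integration.integrable_diff[OF it(1) ip])
    have eg: "(\<integral>s. ?g s \<partial>lborel) = r1 \<omega>" unfolding r1_def Bochner_Integration.integral_diff[OF it(1) ip] it(2) ..
    have g: "indicator {0..<t} s * (\<rho> (?x s) * c0 cb ch (?x s)) \<le> ?g s" for s
      using le[of "?x s"] by (auto simp: indicator_def)
    have g0: "0 \<le> ?g s" for s
      by (rule order_trans[OF _ g]) (use \<rho> c0_nonneg in simp)
    have "(\<integral>\<^sup>+s. ennreal (indicator {0..<t} s * (\<rho> (?x s) * c0 cb ch (?x s))) \<partial>lborel) \<le> (\<integral>\<^sup>+s. ennreal (?g s) \<partial>lborel)"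
      by (intro nn_integral_mono ennreal_leI g)
    also have "\<dots> = ennreal (r1 \<omega>)" unfolding eg[symmetric] by (rule nn_integral_eq_integral[OF ig]) (use g0 in simp)
    finally show "(\<integral>\<^sup>+s. ennreal (indicator {0..<t} s * (\<rho> (?x s) * c0 cb ch (?x s))) \<partial>lborel) \<le> ennreal (r1 \<omega>)" .
    show "0 \<le> r1 \<omega>" unfolding eg[symmetric] by (rule Bochner_Integration.integral_nonneg) (rule g0)
  qed
  have b2: "(\<Sum>k<O.N t \<omega>. ennreal (c1 k1 k2 (before k) z)) \<le> ennreal (r2 \<omega>)" "0 \<le> r2 \<omega>" if om: "\<omega> \<in> space M" for \<omega>
  proof -
    have "(\<Sum>k<O.N t \<omega>. c1 k1 k2 (before k) z - (if k = 0 then D else 0)) \<le> (\<Sum>k<O.N t \<omega>. - O.jump U k \<omega>)"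
    proof (rule sum_mono)
      fix k assume "k \<in> {..<O.N t \<omega>}"
      then have "To k \<omega> < ennreal t" using O.less_iff[OF om O.finite_T[OF om]] by simp
      from O.jump_eq[OF om this] show "c1 k1 k2 (before k) z - (if k = 0 then D else 0) \<le> - O.jump U k \<omega>"
        using ord by (auto simp: before_def)
    qed
    then have "(\<Sum>k<O.N t \<omega>. c1 k1 k2 (before k) z) - (\<Sum>k<O.N t \<omega>. if k = 0 then D else 0) \<le> - ?J \<omega>"
      by (simp only: sum_subtractf sum_negf)
    moreover have "(\<Sum>k<O.N t \<omega>. if k = 0 then D else 0) \<le> D" using D by (simp add: sum.delta')
    ultimately have le: "(\<Sum>k<O.N t \<omega>. c1 k1 k2 (before k) z) \<le> r2 \<omega>" unfolding r2_def by linarith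
    then show "(\<Sum>k<O.N t \<omega>. ennreal (c1 k1 k2 (before k) z)) \<le> ennreal (r2 \<omega>)"
      using c1_nn by (subst sum_ennreal) (auto intro: ennreal_leI)
    show "0 \<le> r2 \<omega>" using le c1_nn by (meson order_trans sum_nonneg)
  qed
  define R where "R \<omega> = ennreal (r1 \<omega> + r2 \<omega>)" for \<omega>
  have ir: "integrable P (\<lambda>\<omega>. r1 \<omega> + r2 \<omega>)" unfolding r1_def r2_def using ito(1,2) by auto
  have "(\<integral>\<^sup>+\<omega>. R \<omega> \<partial>P) = ennreal (\<integral>\<omega>. r1 \<omega> + r2 \<omega> \<partial>P)"
    unfolding R_def by (rule nn_integral_eq_integral[OF ir]) (use b1(2) b2(2) in \<open>auto intro!: AE_I2 add_nonneg_nonneg\<close>)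
  also have "\<dots> \<le> ennreal (l * t + 2 * D)"
  proof (rule ennreal_leI)
    have "(\<integral>\<omega>. r1 \<omega> + r2 \<omega> \<partial>P) = l * t - (\<integral>\<omega>. ?I \<omega> \<partial>P) - (\<integral>\<omega>. ?J \<omega> \<partial>P) + D"
      unfolding r1_def r2_def using ito(1,2) by (simp add: prob_space)
    moreover have "U x0 - (\<integral>\<omega>. U (X0 t \<omega> + O.Zl t \<omega>) \<partial>P) \<le> D"
    proof -
      have "U x0 - (\<integral>\<omega>. U (X0 t \<omega> + O.Zl t \<omega>) \<partial>P) = (\<integral>\<omega>. U x0 - U (X0 t \<omega> + O.Zl t \<omega>) \<partial>P)"
        using ito(3) by (simp add: prob_space)
      also have "\<dots> \<le> (\<integral>\<omega>. D \<partial>P)"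
      proof (rule integral_mono)
        fix \<omega> assume "\<omega> \<in> space P"
        then have "y \<le> X0 t \<omega> + O.Zl t \<omega>" by (intro position_ge t) simp
        then show "U x0 - U (X0 t \<omega> + O.Zl t \<omega>) \<le> D" by (intro low) simp
      qed (use ito(3) in auto)
      finally show ?thesis by (simp add: prob_space)
    qed
    ultimately show "(\<integral>\<omega>. r1 \<omega> + r2 \<omega> \<partial>P) \<le> l * t + 2 * D" using ito(4) by linarith
  qed
  finally have "(\<integral>\<^sup>+\<omega>. R \<omega> \<partial>P) \<le> ennreal (l * t + 2 * D)" .
  moreover have "R \<in> borel_measurable P"
    unfolding R_def[abs_def] by (rule measurable_compose[OF borel_measurable_integrable[OF ir] measurable_ennreal])
  moreover have "(\<integral>\<^sup>+s. ennreal (indicator {0..<t} s * (\<rho> (X0 s \<omega> + O.Z s \<omega>) * c0 cb ch (X0 s \<omega> + O.Z s \<omega>))) \<partial>lborel)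
      + (\<Sum>k<O.N t \<omega>. ennreal (c1 k1 k2 (before k) z)) \<le> R \<omega>" if om: "\<omega> \<in> space M" for \<omega>
    unfolding R_def ennreal_plus[OF b1(2)[OF om] b2(2)[OF om]] by (rule add_mono[OF b1(1)[OF om] b2(1)[OF om]])
  ultimately show ?thesis by blast
qed

text \<open>At a fixed horizon the cutoff is eventually 1 at every point as \<delta> tends to 0.
  Fatou's lemma over time recovers the full holding cost, and over the paths it bounds the
  expectation, because \<open>C\<close> and \<open>D\<close> do not depend on \<delta>.\<close>

lemma cost_upper_bound:
  "\<exists>D\<ge>0. \<forall>t\<ge>0. (\<integral>\<^sup>+\<omega>. cost_upto (c0 cb ch) (c1 k1 k2) X0 x0 pol t \<omega> \<partial>P) \<le> ennreal (lam * (t + 1) + 2 * D)"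
proof -
  obtain C D \<delta>0 where \<delta>0: "0 < \<delta>0" "0 \<le> C" "0 \<le> D" and ex: "\<And>\<delta>. 0 < \<delta> \<Longrightarrow> \<delta> < \<delta>0 \<Longrightarrow> \<exists>U w v. certificate C D \<delta> U w v" using test_function_exists by blast
  \<comment> \<open>The denominator starts at 2, so that the first value is already strictly below
    \<open>\<delta>0\<close>.\<close>
  define \<delta> where "\<delta> n = \<delta>0 / real (Suc (Suc n))" for n
  have \<delta>: "0 < \<delta> n" "\<delta> n < \<delta>0" for n using \<delta>0(1) by (auto simp: \<delta>_def divide_less_eq)
  have \<delta>_lim: "\<delta> \<longlonglongrightarrow> 0" unfolding \<delta>_def[abs_def] by (intro LIMSEQ_Suc lim_const_over_n)
  have "(\<integral>\<^sup>+\<omega>. cost_upto (c0 cb ch) (c1 k1 k2) X0 x0 pol t \<omega> \<partial>P) \<le> ennreal (lam * (t + 1) + 2 * D)" if t: "0 \<le> t" for t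
  proof -
    txt \<open>\<open>path_bound\<close> counts the orders strictly before its time argument, whereas the cost includes an
      order placed at \<open>t\<close>.\<close>
    let ?t = "t + 1"
    have t': "0 < ?t" "t < ?t" using t by auto
    let ?A = "\<lambda>n \<omega>. \<integral>\<^sup>+s. ennreal (indicator {0..<?t} s * (cutoff (\<delta> n) (X0 s \<omega> + O.Z s \<omega>) * c0 cb ch (X0 s \<omega> + O.Z s \<omega>))) \<partial>lborel"
    let ?B = "\<lambda>\<omega>. \<Sum>k<O.N ?t \<omega>. ennreal (c1 k1 k2 (before k) z)"
    have "\<forall>n. \<exists>R. R \<in> borel_measurable P \<and> (\<integral>\<^sup>+\<omega>. R \<omega> \<partial>P) \<le> ennreal ((lam + C * \<delta> n) * ?t + 2 * D) \<and> (\<forall>\<omega>\<in>space M. ?A n \<omega> + ?B \<omega> \<le> R \<omega>)"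
    proof
      fix n
      obtain U w v where "certificate C D (\<delta> n) U w v" using ex[OF \<delta>, of n] by blast
      then have U: "test_function U w v" "\<And>x. \<sigma>\<^sup>2 / 2 * v x - \<mu> * w x \<le> lam - cutoff (\<delta> n) x * c0 cb ch x + C * \<delta> n"
        "U y - U z = c1 k1 k2 y z" "c1 k1 k2 (min x0 y) z \<le> U (min x0 y) - U z + D" "\<And>x. min x0 y \<le> x \<Longrightarrow> U x0 - U x \<le> D"
        unfolding certificate_def by blast+
      show "\<exists>R. R \<in> borel_measurable P \<and> (\<integral>\<^sup>+\<omega>. R \<omega> \<partial>P) \<le> ennreal ((lam + C * \<delta> n) * ?t + 2 * D) \<and> (\<forall>\<omega>\<in>space M. ?A n \<omega> + ?B \<omega> \<le> R \<omega>)"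
        by (rule path_bound[OF U(1) t'(1) _ cutoff_bounds(1) U(3,4) \<delta>0(3) U(5)]) (use U(2) in \<open>auto simp: gen_def algebra_simps\<close>)
    qed
    from choice[OF this] obtain R where R: "\<And>n. R n \<in> borel_measurable P" "\<And>n. (\<integral>\<^sup>+\<omega>. R n \<omega> \<partial>P) \<le> ennreal ((lam + C * \<delta> n) * ?t + 2 * D)"
      "\<And>n \<omega>. \<omega> \<in> space M \<Longrightarrow> ?A n \<omega> + ?B \<omega> \<le> R n \<omega>" by blast
    have path: "cost_upto (c0 cb ch) (c1 k1 k2) X0 x0 pol t \<omega> \<le> liminf (\<lambda>n. R n \<omega>)" if om: "\<omega> \<in> space M" for \<omega>
    proof -
      let ?x = "\<lambda>s. X0 s \<omega> + O.Z s \<omega>"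
      let ?u = "\<lambda>n s. ennreal (indicator {0..<?t} s * (cutoff (\<delta> n) (?x s) * c0 cb ch (?x s)))"
      have "(\<integral>\<^sup>+s. ennreal (indicator {0..<?t} s * c0 cb ch (?x s)) \<partial>lborel) = (\<integral>\<^sup>+s. liminf (\<lambda>n. ?u n s) \<partial>lborel)"
      proof (rule nn_integral_cong)
        fix s
        have "(\<lambda>n. \<delta> n * ln (1 + (?x s)\<^sup>2)) \<longlonglongrightarrow> 0 * ln (1 + (?x s)\<^sup>2)" by (intro tendsto_mult \<delta>_lim tendsto_const)
        then have "eventually (\<lambda>n. \<delta> n * ln (1 + (?x s)\<^sup>2) < 1) sequentially" by (rule order_tendstoD(2)) simp
        then have "eventually (\<lambda>n. ?u n s = ennreal (indicator {0..<?t} s * c0 cb ch (?x s))) sequentially"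
          by eventually_elim (simp add: cutoff_eq_1)
        then have "(\<lambda>n. ?u n s) \<longlonglongrightarrow> ennreal (indicator {0..<?t} s * c0 cb ch (?x s))" by (rule tendsto_eventually)
        then show "ennreal (indicator {0..<?t} s * c0 cb ch (?x s)) = liminf (\<lambda>n. ?u n s)"
          by (intro lim_imp_Liminf[symmetric]) auto
      qed
      also have "\<dots> \<le> liminf (\<lambda>n. ?A n \<omega>)"
      proof (rule nn_integral_liminf)
        fix n
        have "(\<lambda>s. indicator {0..<?t} s * (\<lambda>x. cutoff (\<delta> n) x * c0 cb ch x) (?x s)) \<in> borel_measurable lborel"
          by (rule O.path_measurable[OF _ om O.finite_T[OF om]]) measurable
        then show "?u n \<in> borel_measurable lborel" by (intro measurable_compose[OF _ measurable_ennreal])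
      qed
      finally have "(\<integral>\<^sup>+s. ennreal (indicator {0..<?t} s * c0 cb ch (?x s)) \<partial>lborel) + ?B \<omega> \<le> liminf (\<lambda>n. ?A n \<omega>) + ?B \<omega>"
        by (rule add_right_mono)
      also have "\<dots> = liminf (\<lambda>n. ?A n \<omega> + ?B \<omega>)" by (rule Liminf_add_const[symmetric]) simp
      also have "\<dots> \<le> liminf (\<lambda>n. R n \<omega>)" using R(3)[OF om] by (intro Liminf_mono always_eventually) auto
      finally show ?thesis using cost_upper_path[OF om t t'(2)] by (rule order_trans[rotated])
    qed
    have "(\<integral>\<^sup>+\<omega>. cost_upto (c0 cb ch) (c1 k1 k2) X0 x0 pol t \<omega> \<partial>P) \<le> (\<integral>\<^sup>+\<omega>. liminf (\<lambda>n. R n \<omega>) \<partial>P)"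
      by (rule nn_integral_mono) (use path in simp)
    also have "\<dots> \<le> liminf (\<lambda>n. \<integral>\<^sup>+\<omega>. R n \<omega> \<partial>P)" by (rule nn_integral_liminf[OF R(1)])
    also have "\<dots> \<le> liminf (\<lambda>n. ennreal ((lam + C * \<delta> n) * ?t + 2 * D))"
      using R(2) by (intro Liminf_mono always_eventually) auto
    also have "\<dots> = ennreal ((lam + C * 0) * ?t + 2 * D)"
      by (intro lim_imp_Liminf tendsto_ennrealI tendsto_intros \<delta>_lim) simp
    finally show ?thesis by simp
  qed
  then show ?thesis using \<delta>0(3) by blast
qed

section \<open>Long-run averages and comparison of policies\<close>

lemma long_run_cost_pol_le: "long_run_cost M (c0 cb ch) (c1 k1 k2) X0 x0 pol \<le> ennreal lam"
proof -
  obtain D where D: "0 \<le> D" "\<And>t. 0 \<le> t \<Longrightarrow> (\<integral>\<^sup>+\<omega>. cost_upto (c0 cb ch) (c1 k1 k2) X0 x0 pol t \<omega> \<partial>P) \<le> ennreal (lam * (t + 1) + 2 * D)"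
    using cost_upper_bound by blast
  have ev: "eventually (\<lambda>t. (\<integral>\<^sup>+\<omega>. cost_upto (c0 cb ch) (c1 k1 k2) X0 x0 pol t \<omega> \<partial>P) / ennreal t \<le> ennreal (lam + (lam + 2 * D) / t)) at_top"
    using eventually_gt_at_top[of 0]
  proof eventually_elim
    case (elim t)
    have "(\<integral>\<^sup>+\<omega>. cost_upto (c0 cb ch) (c1 k1 k2) X0 x0 pol t \<omega> \<partial>P) / ennreal t \<le> ennreal (lam * (t + 1) + 2 * D) / ennreal t"
      using elim by (intro divide_right_mono_ennreal D(2)) simp
    also have "\<dots> = ennreal ((lam * (t + 1) + 2 * D) / t)"
      using elim lam_pos D(1) by (intro divide_ennreal) auto
    also have "(lam * (t + 1) + 2 * D) / t = lam + (lam + 2 * D) / t" using elim by (simp add: field_simps)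
    finally show ?case .
  qed
  have "((\<lambda>t. lam + (lam + 2 * D) / t) \<longlongrightarrow> lam + 0) at_top"
    by (intro tendsto_intros tendsto_divide_0[OF tendsto_const] filterlim_at_top_imp_at_infinity filterlim_ident)
  then have lim: "((\<lambda>t. ennreal (lam + (lam + 2 * D) / t)) \<longlongrightarrow> ennreal lam) at_top" by (intro tendsto_ennrealI) simp
  have "long_run_cost M (c0 cb ch) (c1 k1 k2) X0 x0 pol \<le> Limsup at_top (\<lambda>t. ennreal (lam + (lam + 2 * D) / t))"
    unfolding long_run_cost_def by (rule Limsup_mono[OF ev])
  also have "\<dots> = ennreal lam" by (rule lim_imp_Limsup[OF _ lim]) simp
  finally show ?thesis .
qed

text \<open>The bound \<open>B\<close> of the test function depends on \<delta>, so time tends to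
  infinity for each fixed \<delta>, which removes \<open>2 * B / t\<close>; only then does \<delta>
  tend to 0.\<close>

lemma long_run_cost_ge:
  assumes p: "p \<in> admissible M (augmented_filtration M X0)"
  shows "ennreal lam \<le> long_run_cost M (c0 cb ch) (c1 k1 k2) X0 x0 p"
proof -
  let ?J = "long_run_cost M (c0 cb ch) (c1 k1 k2) X0 x0 p"
  obtain C D \<delta>0 where \<delta>0: "0 < \<delta>0" and ex: "\<And>\<delta>. 0 < \<delta> \<Longrightarrow> \<delta> < \<delta>0 \<Longrightarrow> \<exists>U w v. certificate C D \<delta> U w v" using test_function_exists by blast
  have low: "ennreal (lam - C * \<delta>) \<le> ?J" if \<delta>: "0 < \<delta>" "\<delta> < \<delta>0" for \<delta>
  proof -
    obtain U w v where "certificate C D \<delta> U w v" using ex[OF \<delta>] by blast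
    then have U: "test_function U w v" "\<And>x. lam - C * \<delta> \<le> \<sigma>\<^sup>2 / 2 * v x - \<mu> * w x + c0 cb ch x"
      "\<And>a b. a \<le> b \<Longrightarrow> U a - U b \<le> c1 k1 k2 a b" by (simp_all only: certificate_def)
    obtain B where B: "\<And>x. \<bar>U x\<bar> \<le> B" using test_function.ex_bound[OF U(1)] by metis
    have ev: "eventually (\<lambda>t. ennreal (lam - C * \<delta> - 2 * B / t) \<le> (\<integral>\<^sup>+\<omega>. cost_upto (c0 cb ch) (c1 k1 k2) X0 x0 p t \<omega> \<partial>P) / ennreal t) at_top"
      using eventually_gt_at_top[of 0]
    proof eventually_elim
      case (elim t)
      have "ennreal (lam - C * \<delta> - 2 * B / t) = ennreal (((lam - C * \<delta>) * t - 2 * B) / t)"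
        using elim by (simp add: diff_divide_distrib)
      also have "\<dots> \<le> ennreal ((lam - C * \<delta>) * t - 2 * B) / ennreal t"
      proof (cases "0 \<le> (lam - C * \<delta>) * t - 2 * B")
        case True then show ?thesis using elim by (simp add: divide_ennreal)
      next
        case False then show ?thesis using elim by (simp add: ennreal_neg divide_nonpos_pos)
      qed
      also have "\<dots> \<le> (\<integral>\<^sup>+\<omega>. cost_upto (c0 cb ch) (c1 k1 k2) X0 x0 p t \<omega> \<partial>P) / ennreal t"
        using elim U(2,3) pos by (intro divide_right_mono_ennreal cost_lower_bound[OF p _ _ _ U(1) B]) (auto simp: gen_def)
      finally show ?case .
    qed
    have "((\<lambda>t. lam - C * \<delta> - 2 * B / t) \<longlongrightarrow> lam - C * \<delta> - 0) at_top"
      by (intro tendsto_intros tendsto_divide_0[OF tendsto_const] filterlim_at_top_imp_at_infinity filterlim_ident)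
    then have lim: "((\<lambda>t. ennreal (lam - C * \<delta> - 2 * B / t)) \<longlongrightarrow> ennreal (lam - C * \<delta>)) at_top" by (intro tendsto_ennrealI) simp
    have "ennreal (lam - C * \<delta>) = Limsup at_top (\<lambda>t. ennreal (lam - C * \<delta> - 2 * B / t))"
      by (rule lim_imp_Limsup[OF _ lim, symmetric]) simp
    also have "\<dots> \<le> ?J" unfolding long_run_cost_def by (rule Limsup_mono[OF ev])
    finally show ?thesis .
  qed
  have "((\<lambda>\<delta>. ennreal (lam - C * \<delta>)) \<longlongrightarrow> ennreal (lam - C * 0)) (at_right 0)"
    by (intro tendsto_ennrealI tendsto_intros)
  moreover have "eventually (\<lambda>\<delta>. ennreal (lam - C * \<delta>) \<le> ?J) (at_right 0)"
    using eventually_at_right_real[OF \<delta>0] by eventually_elim (auto intro: low)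
  ultimately have "ennreal (lam - C * 0) \<le> ?J" by (rule tendsto_upperbound) simp
  then show ?thesis by simp
qed

end

theorem theorem4p8:
  fixes M :: "'a measure" and W :: "real \<Rightarrow> 'a \<Rightarrow> real"
    and \<mu> \<sigma> cb ch k1 k2 x0 ystar zstar :: real
  defines "X0 \<equiv> inventory0 \<mu> \<sigma> W x0"
  defines "\<A> \<equiv> admissible M (augmented_filtration M X0)"
  defines "J \<equiv> long_run_cost M (c0 cb ch) (c1 k1 k2) X0 x0"
  assumes "\<mu> > 0" and "\<sigma> > 0" and "cb > 0" and "ch > 0" and "k1 > 0" and "k2 > 0"
    and "standard_brownian_motion M W"
    and unique_minimizer:
      "{p. is_arg_min (F_ratio \<mu> \<sigma> cb ch k1 k2) (\<lambda>(y, z). y < z) p} = {(ystar, zstar)}"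
  shows "yz_policy X0 x0 ystar zstar \<in> \<A> \<and>
    (\<forall>p\<in>\<A>. J (yz_policy X0 x0 ystar zstar) \<le> J p)"
proof -
  interpret standard_brownian_motion M W by fact
  have min: "is_arg_min (F_ratio \<mu> \<sigma> cb ch k1 k2) (\<lambda>(y, z). y < z) (ystar, zstar)"
    using unique_minimizer by blast
  have F_min: "F_ratio \<mu> \<sigma> cb ch k1 k2 (ystar, zstar) \<le> F_ratio \<mu> \<sigma> cb ch k1 k2 (a, b)" if "a < b" for a b
  proof -
    have "\<not> F_ratio \<mu> \<sigma> cb ch k1 k2 p < F_ratio \<mu> \<sigma> cb ch k1 k2 (ystar, zstar)" if "case p of (y, z) \<Rightarrow> y < z" for p
      using min that unfolding is_arg_min_def by blast
    from this[of "(a, b)"] \<open>a < b\<close> show ?thesis by (simp add: not_less)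
  qed
  have less: "ystar < zstar" using min by (simp add: is_arg_min_def)
  interpret yz_costs M W \<mu> \<sigma> x0 ystar zstar cb ch k1 k2
    by unfold_locales (use assms(4-9) F_min less in auto)
  show ?thesis
    unfolding \<A>_def J_def X0_def
    by (intro conjI ballI pol_admissible order_trans[OF long_run_cost_pol_le long_run_cost_ge])
qed

end
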